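(* For positive integers $m,\ell,n$ put $A:=\ell/m$ and $B:=n/m^2$, and let $c=c(A,B)$, $d=d(A,B)$ and $\Delta=\Delta(A,B)$ be the quantities defined in the context. Let $K$ be any compact subset of $\{(x,y)\in\mathbb{R}^2 : x\ge 2y>0\}$. Then, as $m\to\infty$ with $\ell$ and $n$ varying so that $(A,B)$ remains in $K$, $$N_n(\ell,m)\sim \frac{e^{m\left[cA+2dB-\log(1-e^{-c-d})\right]}}{2\pi m^2\sqrt{\Delta\,(1-e^{-c})\,(1-e^{-c-d})}},$$ where $c$ and $d$ vary in a Lipschitz manner with $(A,B)\in K$ (that is, $c$ and $d$ are Lipschitz functions of $(A,B)$ on $K$).
   Context: $N_n(\ell,m)$ denotes the number of partitions $\lambda$ of $n$ with largest part at most $\ell$ and at most $m$ parts; equivalently $\sum_{n=0}^{\ell m}N_n(\ell,m)q^n=\frac{\prod_{i=1}^{\ell+m}(1-q^i)}{\prod_{i=1}^{\ell}(1-q^i)\prod_{i=1}^{m}(1-q^i)}$. The symbol $\sim$ means equality up to a factor $1+o(1)$. For $A>2B>0$, $(c,d)$ is the unique pair of positive real numbers satisfying $$A=\int_0^1\frac{1}{1-e^{-c-dt}}\,dt-1=\frac1d\log\left(\frac{e^{c+d}-1}{e^c-1}\right)-1,$$ $$B=\int_0^1\frac{t}{1-e^{-c-dt}}\,dt-\frac12=\frac{d\log(1-e^{-c-d})+\mathrm{dilog}(1-e^{-c})-\mathrm{dilog}(1-e^{-c-d})}{d^2},$$ where $\mathrm{dilog}(x)=\int_1^x\frac{\log t}{1-t}\,dt=\sum_{k\ge1}\frac{(1-x)^k}{k^2}$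 for $|x-1|<1$. The quantity $\Delta$, which is strictly positive, is $$\Delta=\frac{2Be^c(e^d-1)+2A(e^c-1)-1}{d^2(e^{d+c}-1)(e^c-1)}-\frac{A^2}{d^2}.$$ In the special case $A=2B$ one takes $d=0$, $c=\log\frac{A+1}{A}$ and $\Delta=\frac{A^2(A+1)^2}{12}$ (the limiting values as $d\to0$). *)

theory Defs
  imports "HOL-Analysis.Analysis" "HOL-Library.Multiset" "HOL-Library.Landau_Symbols"
begin

(* A partition is the multiset of its (positive) parts. *)
definition box_partitions :: "nat \<Rightarrow> nat \<Rightarrow> nat \<Rightarrow> nat multiset set" where
  "box_partitions n l m =
     {P. sum_mset P = n \<and> (\<forall>x \<in># P. 0 < x \<and> x \<le> l) \<and> size P \<le> m}"

definition box_partition_count :: "nat \<Rightarrow> nat \<Rightarrow> nat \<Rightarrow> nat" where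
  "box_partition_count n l m = card (box_partitions n l m)"

definition saddle_eqs :: "real \<Rightarrow> real \<Rightarrow> real \<Rightarrow> real \<Rightarrow> bool" where
  "saddle_eqs A B c d \<longleftrightarrow>
     A = integral {0..1} (\<lambda>t. 1 / (1 - exp (- c - d * t))) - 1 \<and>
     B = integral {0..1} (\<lambda>t. t / (1 - exp (- c - d * t))) - 1 / 2"

(* The intended domain is A \<ge> 2 * B > 0. For A > 2 * B > 0 the pair is the unique positive
   solution of the saddle point equations; on A = 2 * B it is the limiting value, with d = 0. *)
definition saddle_pair :: "real \<Rightarrow> real \<Rightarrow> real \<times> real" where
  "saddle_pair A B =
     (if A = 2 * B then (ln ((A + 1) / A), 0)
      else (THE (c, d). 0 < c \<and> 0 < d \<and> saddle_eqs A B c d))"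

definition saddle_c :: "real \<Rightarrow> real \<Rightarrow> real" where
  "saddle_c A B = fst (saddle_pair A B)"

definition saddle_d :: "real \<Rightarrow> real \<Rightarrow> real" where
  "saddle_d A B = snd (saddle_pair A B)"

definition saddle_Delta :: "real \<Rightarrow> real \<Rightarrow> real" where
  "saddle_Delta A B =
     (let c = saddle_c A B; d = saddle_d A B in
      if A = 2 * B then A\<^sup>2 * (A + 1)\<^sup>2 / 12
      else (2 * B * exp c * (exp d - 1) + 2 * A * (exp c - 1) - 1) /
             (d\<^sup>2 * (exp (d + c) - 1) * (exp c - 1)) - A\<^sup>2 / d\<^sup>2)"

(* Along this filter on triples (m, l, n), m tends to infinity while the positive integers l and n
   vary arbitrarily subject to (l / m, n / m^2) \<in> K. Limits along it are thus uniform in l and n. *)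
definition rescaled_in :: "(real \<times> real) set \<Rightarrow> (nat \<times> nat \<times> nat) filter" where
  "rescaled_in K =
     inf (filtercomap fst at_top)
         (principal {(m, l, n). 0 < m \<and> 0 < l \<and> 0 < n \<and>
                                (real l / real m, real n / (real m)\<^sup>2) \<in> K})"

end

theory Submission
  imports Defs "HOL-Probability.Probability" "HOL-Real_Asymp.Real_Asymp"
begin

text \<open>Passing to the conjugate partition, the number of partitions of \<open>n\<close> in an \<open>l\<close> by \<open>m\<close> box is the number
  of \<open>(x\<^sub>0, \<dots>, x\<^sub>m)\<close> with \<open>\<Sum> x\<^sub>j = l\<close> and \<open>\<Sum> j * x\<^sub>j = n\<close>. Give \<open>x\<^sub>j\<close> independent geometric laws with
  ratio \<open>exp (- c - d * j / m)\<close>: all these vectors then have the same probability, and the saddle point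
  equations say that the mean is \<open>(l, n)\<close> up to a negligible error. The count is therefore an explicit factor,
  evaluated with the trapezoid rule, times a point probability, and a local central limit theorem gives
  the latter as \<open>1 / (2 * pi * m\<^sup>2 * sqrt \<Delta>)\<close>, where \<open>\<Delta>\<close> is the limiting covariance determinant. The map from
  \<open>(c, d)\<close> to \<open>(A, B)\<close> is strongly monotone on compact sets, which makes its inverse Lipschitz.\<close>

section \<open>The recursion of the conjugate partition\<close>

text \<open>The variable x_0 is slack: the conjugate partition has at most \<open>l\<close> parts,
  and x_0 fills them up to exactly \<open>l\<close>; hence \<open>Suc m\<close> factors. Accuracy
  decides the quadrature. The explicit factor is the exponential of a sum, which must be known up to
  o(1); the trapezoid rule errs by O(1/m), and its end-point term is the origin of the factors 1 -
  exp (-c) and 1 - exp (-c-d) under the root. The means matter only relative to the standard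
  deviations, of order sqrt m and m sqrt m, so there a bounded error of the Riemann sums is enough.
  No probability space is built: the count is an integral of a product of characteristic functions
  over one period, identified by the partition recursion. Two obstacles shape the estimates. Since c
  and d move with m and need not converge, all constants depend only on a lower bound of c and an
  upper bound of c + d, and what tends to 0 is the difference from a moving Gaussian integral. And
  dominated convergence needs one integrable majorant on the whole growing rectangle of integration,
  also far from the origin.\<close>

lemma finite_box_partitions: "finite (box_partitions n l m)"
proof (rule finite_subset)
  show "box_partitions n l m \<subseteq> mset ` {xs. set xs \<subseteq> {..l} \<and> length xs \<le> m}"
  proof
    fix P assume P: "P \<in> box_partitions n l m"
    obtain xs where xs: "P = mset xs" using ex_mset by metis
    have "set xs \<subseteq> {..l}" "length xs \<le> m" using P by (auto simp: box_partitions_def xs)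
    with xs show "P \<in> mset ` {xs. set xs \<subseteq> {..l} \<and> length xs \<le> m}" by blast
  qed
qed (simp add: finite_lists_length_le)

lemma box_partition_count_0: "box_partition_count n l 0 = (if n = 0 then 1 else 0)"
proof -
  have "box_partitions n l 0 = (if n = 0 then {{#}} else {})"
    by (auto simp: box_partitions_def)
  then show ?thesis by (simp add: box_partition_count_def)
qed

lemma size_le_sum_mset: "(\<forall>x\<in>#P. 0 < x) \<Longrightarrow> size P \<le> sum_mset P" for P :: "nat multiset"
  by (induction P) (auto simp: Suc_le_eq)

text \<open>Removing one box from each part of a partition with exactly \<open>Suc m\<close> parts, i.e. the first
  column of its diagram, is the recursion of the conjugate partition.\<close>

lemma box_partition_count_Suc:
  "box_partition_count n l (Suc m) = box_partition_count n l m +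
     (if Suc m \<le> n \<and> 0 < l then box_partition_count (n - Suc m) (l - 1) (Suc m) else 0)"
proof -
  define E where "E = {P \<in> box_partitions n l (Suc m). size P = Suc m}"
  have un: "box_partitions n l (Suc m) = box_partitions n l m \<union> E"
    by (auto simp: E_def box_partitions_def)
  have dj: "box_partitions n l m \<inter> E = {}"
    by (auto simp: E_def box_partitions_def)
  have fE: "finite E" by (simp add: E_def finite_box_partitions)
  have cE: "card E = (if Suc m \<le> n \<and> 0 < l
      then box_partition_count (n - Suc m) (l - 1) (Suc m) else 0)"
  proof (cases "Suc m \<le> n \<and> 0 < l")
    case False
    have "E = {}"
    proof (rule ccontr)
      assume "E \<noteq> {}"
      then obtain P where P: "sum_mset P = n" "\<forall>x\<in>#P. 0 < x \<and> x \<le> l" "size P = Suc m"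
        by (auto simp: E_def box_partitions_def)
      then have "Suc m \<le> n" using size_le_sum_mset[of P] by auto
      moreover obtain x where "x \<in># P" using P(3) by (metis size_eq_Suc_imp_elem)
      ultimately show False using P(2) False by force
    qed
    with False show ?thesis by auto
  next
    case True
    define S where "S = box_partitions (n - Suc m) (l - 1) (Suc m)"
    \<comment> \<open>Parts equal to 1 disappear when a box is removed, so \<open>f\<close> first
      pads with zeros up to \<open>Suc m\<close> parts before raising every part; its inverse
      \<open>g\<close> lowers every part and discards the zeros.\<close>
    define f where "f = (\<lambda>Q :: nat multiset. image_mset Suc (Q + replicate_mset (Suc m - size Q) 0))"
    define g where "g = (\<lambda>P :: nat multiset. filter_mset (\<lambda>x. 0 < x) (image_mset (\<lambda>x. x - 1) P))"
    have gf: "g (f Q) = Q" if "Q \<in> S" for Q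
    proof -
      have "filter_mset (\<lambda>x. 0 < x) Q = Q"
        using that by (auto simp: S_def box_partitions_def filter_mset_eq_conv)
      then show ?thesis by (simp add: f_def g_def multiset.map_comp o_def)
    qed
    have fS: "f Q \<in> E" if "Q \<in> S" for Q
    proof -
      have Q: "sum_mset Q = n - Suc m" "\<forall>x\<in>#Q. 0 < x \<and> x \<le> l - 1" "size Q \<le> Suc m"
        using that by (auto simp: S_def box_partitions_def)
      have sumS: "sum_mset (image_mset Suc R) = sum_mset R + size R" for R
        by (induction R) auto
      have "sum_mset (f Q) = n" unfolding f_def sumS using Q True by auto
      moreover have "size (f Q) = Suc m" using Q by (simp add: f_def)
      moreover have "0 < x \<and> x \<le> l" if x: "x \<in># f Q" for x
      proof -
        obtain y where y: "x = Suc y" "y \<in># Q + replicate_mset (Suc m - size Q) 0"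
          using x unfolding f_def set_image_mset by blast
        then have "y \<in># Q \<or> y = 0" by (auto split: if_splits)
        then have "y \<le> l - 1" using Q(2) by auto
        with y True show ?thesis by auto
      qed
      ultimately show ?thesis by (simp add: E_def box_partitions_def)
    qed
    have sumg: "sum_mset (g P) + size P = sum_mset P" if "\<forall>x\<in>#P. 0 < x" for P
      using that by (induction P) (auto simp: g_def)
    have gE: "g P \<in> S \<and> f (g P) = P" if "P \<in> E" for P
    proof -
      have P: "sum_mset P = n" "\<forall>x\<in>#P. 0 < x \<and> x \<le> l" "size P = Suc m"
        using that by (auto simp: E_def box_partitions_def)
      have "sum_mset (g P) = n - Suc m" using sumg[of P] P by auto
      moreover have "\<forall>x\<in>#g P. 0 < x \<and> x \<le> l - 1"
        using P(2) by (auto simp: g_def intro: diff_le_mono)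
      moreover have sz: "size (g P) \<le> Suc m"
        using size_filter_mset_lesseq[of _ "image_mset (\<lambda>x. x - 1) P"] P by (simp add: g_def)
      ultimately have gS: "g P \<in> S" by (simp add: S_def box_partitions_def)
      have split: "image_mset (\<lambda>x. x - 1) P = g P + replicate_mset (size P - size (g P)) 0"
        for P :: "nat multiset"
      proof (induction P)
        case (add x P)
        have "size (g P) \<le> size P"
          using size_filter_mset_lesseq[of _ "image_mset (\<lambda>x. x - 1) P"] by (simp add: g_def)
        with add show ?case by (auto simp: g_def Suc_diff_le)
      qed (simp add: g_def)
      then have "f (g P) = image_mset Suc (image_mset (\<lambda>x. x - 1) P)"
        unfolding f_def using split[of P] P(3) by simp
      then have "f (g P) = image_mset (\<lambda>x. Suc (x - 1)) P"
        by (simp add: multiset.map_comp o_def)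
      also have "\<dots> = image_mset (\<lambda>x. x) P" using P by (intro image_mset_cong) auto
      finally have "f (g P) = P" by simp
      with gS show ?thesis by simp
    qed
    have "bij_betw f S E"
      by (rule bij_betw_byWitness[of _ g]) (use gf fS gE in auto)
    then show ?thesis using True
      by (simp add: bij_betw_same_card[symmetric] box_partition_count_def S_def)
  qed
  show ?thesis
    using card_Un_disjoint[OF finite_box_partitions fE dj] un cE by (simp add: box_partition_count_def)
qed

section \<open>Cauchy integral for the partition numbers\<close>

text \<open>Integrand of Cauchy's formula for the coefficient of x^l y^n in the product of 1 / (1 -
  x y^j), j < M, in logarithmic coordinates x = exp z, y = exp w. The exponents are integers because
  the recursion below leads to negative values.\<close>

definition cauchy_kernel :: "nat \<Rightarrow> int \<Rightarrow> int \<Rightarrow> complex \<Rightarrow> complex \<Rightarrow> complex" where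
  "cauchy_kernel M l n z w = exp (- (of_int l * z + of_int n * w)) / (\<Prod>j<M. 1 - exp (z + of_nat j * w))"

lemma norm_one_minus_exp_ge:
  assumes "Re z \<le> - c" "0 < c"
  shows "1 - exp (- c) \<le> norm (1 - exp z :: complex)"
proof -
  have "norm (exp z) \<le> exp (- c)" using assms by simp
  moreover have "1 - norm (exp z) \<le> norm (1 - exp z)" using norm_triangle_ineq2[of 1 "exp z"] by simp
  ultimately show ?thesis by linarith
qed

lemma one_minus_exp_nonzero:
  assumes "Re z < 0"
  shows "1 - exp z \<noteq> (0 :: complex)"
  using norm_one_minus_exp_ge[of z "- Re z"] assms by (auto simp: algebra_simps)

text \<open>This is 1 / (1 - q) = 1 + q / (1 - q) for the last factor q = exp (z + M w):
  multiplication by q shifts \<open>l\<close> by 1 and \<open>n\<close> by \<open>M\<close>. It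
  mirrors \<open>box_partition_count_Suc\<close>.\<close>

lemma cauchy_kernel_Suc:
  assumes "1 - exp (z + of_nat M * w) \<noteq> 0"
  shows "cauchy_kernel (Suc M) l n z w = cauchy_kernel M l n z w + cauchy_kernel (Suc M) (l - 1) (n - int M) z w"
proof -
  have "exp (- (of_int (l - 1) * z + of_int (n - int M) * w))
      = exp (- (of_int l * z + of_int n * w)) * exp (z + of_nat M * w)"
    by (simp add: exp_add[symmetric] algebra_simps)
  then show ?thesis
    using assms unfolding cauchy_kernel_def lessThan_Suc
    by (auto simp: divide_simps) (auto simp: algebra_simps)
qed

lemma norm_cauchy_kernel_le:
  assumes "Re z = - c" "Re w = - e" "0 < c" "0 \<le> e"
  shows "norm (cauchy_kernel M l n z w) \<le> exp (of_int l * c + of_int n * e) / (1 - exp (- c)) ^ M"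
proof -
  have "(1 - exp (- c)) ^ M = (\<Prod>j<M. 1 - exp (- c))" by simp
  also have "\<dots> \<le> (\<Prod>j<M. norm (1 - exp (z + of_nat j * w)))"
    using assms by (intro prod_mono conjI norm_one_minus_exp_ge) auto
  finally have "(1 - exp (- c)) ^ M \<le> (\<Prod>j<M. norm (1 - exp (z + of_nat j * w)))" .
  moreover have "norm (exp (- (of_int l * z + of_int n * w))) = exp (of_int l * c + of_int n * e)"
    using assms by (simp add: algebra_simps)
  ultimately show ?thesis
    unfolding cauchy_kernel_def norm_divide prod_norm[symmetric] using assms
    by (intro frac_le) auto
qed

lemma lattice_point_nonzero:
  assumes "0 < c" "0 \<le> e"
  shows "1 - exp (Complex (- c) u + of_nat j * Complex (- e) v) \<noteq> 0"
proof (rule one_minus_exp_nonzero)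
  have "0 \<le> real j * e" using assms by simp
  moreover have "Re (Complex (- c) u + of_nat j * Complex (- e) v) = - c - real j * e" by simp
  ultimately show "Re (Complex (- c) u + of_nat j * Complex (- e) v) < 0" using assms by linarith
qed

definition rect :: "real \<Rightarrow> real \<Rightarrow> (real \<times> real) set" where
  "rect s t = {- pi * s..pi * s} \<times> {- pi * t..pi * t}"

lemma compact_rect [simp]: "compact (rect s t)"
  unfolding rect_def by (intro compact_Times compact_Icc)

lemma sets_rect [simp]: "rect s t \<in> sets borel"
  by (intro borel_compact compact_rect)

text \<open>The coefficient integral over one full period of both angles, up to its normalisation.
  The angles are already rescaled by \<open>s\<close> and \<open>t\<close>, later sqrt m and m sqrt
  m, the orders of the two standard deviations.\<close>

definition kernel_integral :: "real \<Rightarrow> real \<Rightarrow> real \<Rightarrow> real \<Rightarrow> nat \<Rightarrow> int \<Rightarrow> int \<Rightarrow> complex" where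
  "kernel_integral c e s t M l n =
     (\<integral>p. indicator (rect s t) p *\<^sub>R cauchy_kernel M l n (Complex (- c) (fst p / s)) (Complex (- e) (snd p / t)) \<partial>lborel)"

lemma Complex_continuous [continuous_intros]:
  "continuous_on S f \<Longrightarrow> continuous_on S g \<Longrightarrow> continuous_on S (\<lambda>x. Complex (f x) (g x))"
  unfolding Complex_eq by (intro continuous_intros)

lemma integrable_cauchy_kernel:
  assumes "0 < c" "0 \<le> e" "0 < s" "0 < t"
  shows "integrable lborel (\<lambda>p. indicator (rect s t) p *\<^sub>R
           cauchy_kernel M l n (Complex (- c) (fst p / s)) (Complex (- e) (snd p / t)))"
proof (rule borel_integrable_compact)
  have "1 - exp (Complex (- c) (fst p / s) + of_nat j * Complex (- e) (snd p / t)) \<noteq> 0" for p j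
    using assms by (intro lattice_point_nonzero) auto
  then show "continuous_on (rect s t)
      (\<lambda>p. cauchy_kernel M l n (Complex (- c) (fst p / s)) (Complex (- e) (snd p / t)))"
    unfolding cauchy_kernel_def using assms by (intro continuous_intros) auto
qed simp

lemma kernel_integral_Suc:
  assumes "0 < c" "0 \<le> e" "0 < s" "0 < t"
  shows "kernel_integral c e s t (Suc M) l n =
    kernel_integral c e s t M l n + kernel_integral c e s t (Suc M) (l - 1) (n - int M)"
proof -
  have "cauchy_kernel (Suc M) l n (Complex (- c) u) (Complex (- e) v) =
        cauchy_kernel M l n (Complex (- c) u) (Complex (- e) v) +
        cauchy_kernel (Suc M) (l - 1) (n - int M) (Complex (- c) u) (Complex (- e) v)" for u v
    using assms by (intro cauchy_kernel_Suc lattice_point_nonzero) auto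
  then show ?thesis
    unfolding kernel_integral_def
    by (subst Bochner_Integration.integral_add[symmetric])
       (use assms in \<open>auto intro!: integrable_cauchy_kernel simp: scaleR_add_right\<close>)
qed

lemma norm_kernel_integral_le:
  assumes "0 < c" "0 \<le> e" "0 < s" "0 < t"
  shows "norm (kernel_integral c e s t M l n) \<le>
    measure lborel (rect s t) * (exp (of_int l * c + of_int n * e) / (1 - exp (- c)) ^ M)"
proof -
  let ?B = "exp (of_int l * c + of_int n * e) / (1 - exp (- c)) ^ M"
  have "norm (kernel_integral c e s t M l n) \<le> (\<integral>p. indicator (rect s t) p * ?B \<partial>lborel)"
    unfolding kernel_integral_def
  proof (rule Bochner_Integration.integral_norm_bound[THEN order_trans], rule integral_mono)
    show "integrable lborel (\<lambda>p. norm (indicat_real (rect s t) p *\<^sub>R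
        cauchy_kernel M l n (Complex (- c) (fst p / s)) (Complex (- e) (snd p / t))))"
      by (intro integrable_norm integrable_cauchy_kernel assms)
    show "integrable lborel (\<lambda>p. indicator (rect s t) p * ?B)"
      by (intro integrable_mult_left integrable_real_indicator emeasure_compact_finite) auto
    show "norm (indicat_real (rect s t) p *\<^sub>R
        cauchy_kernel M l n (Complex (- c) (fst p / s)) (Complex (- e) (snd p / t)))
        \<le> indicator (rect s t) p * ?B" for p
      using norm_cauchy_kernel_le[of "Complex (- c) (fst p / s)" c "Complex (- e) (snd p / t)" e M l n] assms
      by (auto simp: indicator_def)
  qed
  then show ?thesis by simp
qed

lemma integral_exp_period:
  fixes k :: int
  assumes s: "0 < s"
  shows "(\<integral>u. indicator {- pi * s..pi * s} u *\<^sub>R exp (- (\<i> * of_int k * of_real (u / s))) \<partial>lborel)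
           = (if k = 0 then of_real (2 * pi * s) else 0)"
proof (cases "k = 0")
  case True
  have "(\<integral>u. indicator {- pi * s..pi * s} u *\<^sub>R (1 :: complex) \<partial>lborel)
      = of_real (pi * s) - of_real (- pi * s)"
    using s by (intro integral_FTC_Icc) (auto intro!: derivative_eq_intros continuous_intros)
  then show ?thesis using True by simp
next
  case False
  define a where "a = - (\<i> * of_int k / of_real s)"
  have a: "a \<noteq> 0" using s False by (simp add: a_def)
  have "((\<lambda>u. exp (a * of_real u) / a) has_vector_derivative exp (a * of_real u)) (at u within S)" for u S
    using a by (intro has_vector_derivative_real_field) (auto intro!: derivative_eq_intros)
  then have "(\<integral>u. indicator {- pi * s..pi * s} u *\<^sub>R exp (a * of_real u) \<partial>lborel)
      = exp (a * of_real (pi * s)) / a - exp (a * of_real (- pi * s)) / a"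
    using s by (intro integral_FTC_Icc) (auto intro!: continuous_intros)
  also have "a * of_real (pi * s) = \<i> * of_real (- of_int k * pi)" using s by (simp add: a_def)
  also have "a * of_real (- pi * s) = \<i> * of_real (of_int k * pi)" using s by (simp add: a_def)
  \<comment> \<open>The phases at the two end points differ by a multiple of 2 pi, so the
    antiderivative takes equal values there.\<close>
  also have "exp (\<i> * of_real (- of_int k * pi)) = exp (\<i> * of_real (of_int k * pi))"
    using sin_npi_int[of k] unfolding cis_conv_exp[symmetric] by (simp add: complex_eq_iff mult.commute)
  finally show ?thesis using False by (simp add: a_def field_simps)
qed

text \<open>The denominator is an empty product, so Fubini splits the integral into two
  orthogonality relations; the remaining real factor \<open>K\<close> equals 1 in the only
  nonvanishing case.\<close>

lemma kernel_integral_0: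
  assumes "0 < c" "0 \<le> e" "0 < s" "0 < t"
  shows "kernel_integral c e s t 0 l n = (if l = 0 \<and> n = 0 then of_real (4 * pi\<^sup>2 * s * t) else 0)"
proof -
  define f where "f = (\<lambda>u. indicator {- pi * s..pi * s} u *\<^sub>R exp (- (\<i> * of_int l * of_real (u / s))))"
  define g where "g = (\<lambda>u. indicator {- pi * t..pi * t} u *\<^sub>R exp (- (\<i> * of_int n * of_real (u / t))))"
  define K where "K = (of_real (exp (of_int l * c + of_int n * e)) :: complex)"
  have eq: "indicator (rect s t) p *\<^sub>R cauchy_kernel 0 l n (Complex (- c) (fst p / s)) (Complex (- e) (snd p / t))
      = f (fst p) * g (snd p) * K" for p
  proof -
    have "cauchy_kernel 0 l n (Complex (- c) x) (Complex (- e) y)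
      = exp (- (\<i> * of_int l * of_real x)) * exp (- (\<i> * of_int n * of_real y)) * K" for x y
      unfolding cauchy_kernel_def K_def exp_of_real[symmetric] exp_add[symmetric]
      by (simp add: Complex_eq algebra_simps)
    then show ?thesis
      by (auto simp: f_def g_def rect_def indicator_def mem_Times_iff)
  qed
  have int: "integrable (lborel \<Otimes>\<^sub>M lborel) (\<lambda>p. f (fst p) * g (snd p) * K)"
    using integrable_cauchy_kernel[OF assms, of 0 l n] unfolding eq lborel_prod .
  have "kernel_integral c e s t 0 l n = (\<integral>p. f (fst p) * g (snd p) * K \<partial>(lborel \<Otimes>\<^sub>M lborel))"
    unfolding kernel_integral_def eq lborel_prod ..
  also have "\<dots> = (\<integral>x. (\<integral>y. f x * g y * K \<partial>lborel) \<partial>lborel)"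
    unfolding lborel_pair.integral_fst'[OF int, symmetric] fst_conv snd_conv ..
  also have "\<dots> = (\<integral>x. f x \<partial>lborel) * (\<integral>y. g y \<partial>lborel) * K" by simp
  finally show ?thesis
    using integral_exp_period[OF assms(3), of l] integral_exp_period[OF assms(4), of n]
    by (auto simp: f_def g_def K_def power2_eq_square)
qed

section \<open>Vanishing for negative indices and identification with the count\<close>

text \<open>Iterating the recursion moves \<open>l\<close> to \<open>- \<infinity>\<close>, where the integral decays geometrically.\<close>

lemma kernel_integral_neg_l:
  assumes "0 < c" "0 \<le> e" "0 < s" "0 < t" "l < 0"
  shows "kernel_integral c e s t M l n = 0"
  using \<open>l < 0\<close>
proof (induction M arbitrary: l n)
  case 0
  then show ?case using kernel_integral_0[OF assms(1-4)] by simp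
next
  case (Suc M l n)
  note neg = Suc.IH
  have l: "l < 0" by fact
  let ?J = "kernel_integral c e s t"
  define K where "K = measure lborel (rect s t) * (exp (of_int l * c + of_int n * e) / (1 - exp (- c)) ^ Suc M)"
  \<comment> \<open>For negative \<open>l\<close> the term with one factor fewer is zero by the
    outer induction, so each use of the recursion is a pure shift.\<close>
  have shift: "?J (Suc M) l n = ?J (Suc M) (l - int k) (n - int k * int M)" for k
  proof (induction k)
    case (Suc k)
    have "?J (Suc M) (l - int k) (n - int k * int M) =
        ?J (Suc M) (l - int k - 1) (n - int k * int M - int M)"
      using kernel_integral_Suc[OF assms(1-4), of M "l - int k" "n - int k * int M"]
        neg[of "l - int k"] l by simp
    then show ?case using Suc.IH by (simp add: algebra_simps)
  qed simp
  have "norm (?J (Suc M) l n) \<le> K * exp (- c) ^ k" for k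
  proof -
    have "norm (?J (Suc M) l n) \<le> measure lborel (rect s t) *
        (exp (of_int (l - int k) * c + of_int (n - int k * int M) * e) / (1 - exp (- c)) ^ Suc M)"
      unfolding shift[of k] by (rule norm_kernel_integral_le[OF assms(1-4)])
    \<comment> \<open>Lowering \<open>n\<close> can only help because \<open>0 \<le> e\<close>; the
      geometric decay comes from \<open>c\<close> alone.\<close>
    also have "\<dots> \<le> measure lborel (rect s t) *
        (exp (of_int l * c + of_int n * e - real k * c) / (1 - exp (- c)) ^ Suc M)"
      using assms by (intro mult_left_mono divide_right_mono) (auto simp: algebra_simps)
    also have "\<dots> = K * exp (- c) ^ k"
      by (simp add: K_def exp_diff exp_minus exp_of_nat_mult[symmetric] field_simps)
    finally show ?thesis .
  qed
  moreover have "(\<lambda>k. K * exp (- c) ^ k) \<longlonglongrightarrow> K * 0"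
    using assms by (intro tendsto_intros LIMSEQ_power_zero) auto
  ultimately have "norm (?J (Suc M) l n) \<le> K * 0"
    by (intro LIMSEQ_le_const) auto
  then show ?case by simp
qed

lemma kernel_integral_neg_n:
  assumes "0 < c" "0 \<le> e" "0 < s" "0 < t" "n < 0"
  shows "kernel_integral c e s t M l n = 0"
  using \<open>n < 0\<close>
proof (induction M arbitrary: l n)
  case 0
  then show ?case using kernel_integral_0[OF assms(1-4)] by simp
next
  case (Suc M l n)
  note neg_l = kernel_integral_neg_l[OF assms(1-4)]
  have nat: "n < 0 \<Longrightarrow> kernel_integral c e s t (Suc M) (int k) n = 0" for k n
  proof (induction k arbitrary: n)
    case 0
    then show ?case using kernel_integral_Suc[OF assms(1-4), of M 0 n] neg_l Suc.IH by simp
  next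
    case (Suc k)
    then show ?case
      using kernel_integral_Suc[OF assms(1-4), of M "int (Suc k)" n] \<open>\<And>l n. n < 0 \<Longrightarrow> kernel_integral c e s t M l n = 0\<close>
      by simp
  qed
  show ?case
  proof (cases "l < 0")
    case False
    then show ?thesis using nat[of n "nat l"] Suc.prems by simp
  qed (simp add: neg_l)
qed

text \<open>Both sides obey the same recursion in \<open>m\<close> and \<open>l\<close>, and the
  terms that would leave the range of natural numbers vanish on the left. The index is
  \<open>Suc m\<close> because the factors j = 0, ..., m include the slack variable.\<close>

lemma kernel_integral_box_partition_count:
  assumes "0 < c" "0 \<le> e" "0 < s" "0 < t"
  shows "kernel_integral c e s t (Suc m) (int l) (int n)
           = of_real (4 * pi\<^sup>2 * s * t * real (box_partition_count n l m))"
proof -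
  let ?J = "kernel_integral c e s t"
  note rec = kernel_integral_Suc[OF assms] and neg_l = kernel_integral_neg_l[OF assms]
    and neg_n = kernel_integral_neg_n[OF assms]
  show ?thesis
  proof (induction m arbitrary: l n)
    case 0
    show ?case
    proof (induction l)
      case 0
      then show ?case
        using rec[of 0 0 "int n"] neg_l by (simp add: kernel_integral_0[OF assms] box_partition_count_0)
    next
      case (Suc l)
      then show ?case
        using rec[of 0 "int (Suc l)" "int n"]
        by (simp add: kernel_integral_0[OF assms] box_partition_count_0)
    qed
  next
    case (Suc m)
    note outer = Suc.IH
    show ?case
    proof (induction l arbitrary: n)
      case 0
      have "?J (Suc (Suc m)) (int 0) (int n) = ?J (Suc m) (int 0) (int n)"
        using rec[of "Suc m" 0 "int n"] neg_l by simp
      then show ?case using outer[of 0 n] box_partition_count_Suc[of n 0 m] by simp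
    next
      case (Suc l)
      have "?J (Suc (Suc m)) (int (Suc l)) (int n)
          = ?J (Suc m) (int (Suc l)) (int n) + ?J (Suc (Suc m)) (int l) (int n - int (Suc m))"
        using rec[of "Suc m" "int (Suc l)" "int n"] by simp
      moreover have "?J (Suc (Suc m)) (int l) (int n - int (Suc m)) = (if Suc m \<le> n
          then of_real (4 * pi\<^sup>2 * s * t * real (box_partition_count (n - Suc m) l (Suc m))) else 0)"
      proof (cases "Suc m \<le> n")
        case True
        then have "int n - int (Suc m) = int (n - Suc m)" by simp
        with True Suc.IH[of "n - Suc m"] show ?thesis by presburger
      next
        case False
        then have "int n - int (Suc m) < 0" by simp
        with False neg_n show ?thesis by presburger
      qed
      ultimately show ?case
        unfolding outer box_partition_count_Suc[of n "Suc l" m]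
        by (simp add: algebra_simps)
    qed
  qed
qed

section \<open>The saddle point equations\<close>

text \<open>The function \<open>bose\<close> is the mean of a geometric law with ratio \<open>exp (- x)\<close> and \<open>- bose'\<close> its variance.\<close>

definition bose :: "real \<Rightarrow> real" where "bose x = 1 / (exp x - 1)"

definition bose_var :: "real \<Rightarrow> real" where "bose_var x = bose x * (1 + bose x)"

lemma bose_pos: "0 < x \<Longrightarrow> 0 < bose x"
  by (simp add: bose_def)

lemma bose_var_pos: "0 < x \<Longrightarrow> 0 < bose_var x"
  using bose_pos[of x] by (simp add: bose_var_def)

lemma bose_antimono: "0 < x \<Longrightarrow> x \<le> y \<Longrightarrow> bose y \<le> bose x"
  by (simp add: bose_def frac_le)

lemma bose_var_antimono: "0 < x \<Longrightarrow> x \<le> y \<Longrightarrow> bose_var y \<le> bose_var x"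
  unfolding bose_var_def using bose_antimono[of x y] bose_pos[of y] by (intro mult_mono) auto

lemma bose_alt: "0 < x \<Longrightarrow> 1 / (1 - exp (- x)) = 1 + bose x"
  by (simp add: bose_def exp_minus field_simps)

lemma bose_le_inverse: "0 < x \<Longrightarrow> bose x \<le> 1 / x"
proof -
  assume x: "0 < x"
  have "x \<le> exp x - 1" using exp_ge_add_one_self[of x] by linarith
  then show ?thesis unfolding bose_def using x by (intro divide_left_mono) auto
qed

lemma bose_has_derivative [derivative_intros]:
  assumes "(f has_real_derivative f') (at x within S)" "0 < f x"
  shows "((\<lambda>x. bose (f x)) has_real_derivative - bose_var (f x) * f') (at x within S)"
proof -
  have "(bose has_real_derivative - bose_var (f x)) (at (f x))"
    unfolding bose_def bose_var_def using assms(2)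
    by (auto intro!: derivative_eq_intros simp: field_simps power2_eq_square)
  then show ?thesis using assms(1) by (rule DERIV_chain2)
qed

lemma ln_one_minus_exp_has_derivative [derivative_intros]:
  assumes "(f has_real_derivative f') (at x within S)" "0 < f x"
  shows "((\<lambda>x. ln (1 - exp (- f x))) has_real_derivative bose (f x) * f') (at x within S)"
proof -
  have "((\<lambda>x. ln (1 - exp (- x))) has_real_derivative bose (f x)) (at (f x))"
    unfolding bose_def using assms(2)
    by (auto intro!: derivative_eq_intros simp: field_simps exp_minus)
  then show ?thesis using assms(1) by (rule DERIV_chain2)
qed

lemma bose_continuous [continuous_intros]:
  assumes "continuous_on S f" "\<And>x. x \<in> S \<Longrightarrow> 0 < f x"
  shows "continuous_on S (\<lambda>x. bose (f x))"
  unfolding bose_def using assms by (intro continuous_intros) (auto dest: assms(2))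

lemma bose_var_continuous [continuous_intros]:
  assumes "continuous_on S f" "\<And>x. x \<in> S \<Longrightarrow> 0 < f x"
  shows "continuous_on S (\<lambda>x. bose_var (f x))"
  unfolding bose_var_def using assms by (intro continuous_intros) auto

section \<open>The saddle point map and its strong monotonicity\<close>

definition moment0 :: "real \<Rightarrow> real \<Rightarrow> real" where
  "moment0 c d = integral {0..1} (\<lambda>t. bose (c + d * t))"

definition moment1 :: "real \<Rightarrow> real \<Rightarrow> real" where
  "moment1 c d = integral {0..1} (\<lambda>t. t * bose (c + d * t))"

lemma affine_pos: "0 < c \<Longrightarrow> 0 \<le> d \<Longrightarrow> 0 \<le> t \<Longrightarrow> 0 < c + d * (t :: real)"
  by (intro add_pos_nonneg) auto

lemma integrable_bose_affine:
  assumes "0 < c" "0 \<le> d" "continuous_on {0..1} p"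
  shows "(\<lambda>t. p t * bose (c + d * t)) integrable_on {0..1}"
    and "(\<lambda>t. p t * bose_var (c + d * t)) integrable_on {0..1}"
    and "(\<lambda>t. bose (c + d * t)) integrable_on {0..1}"
    and "(\<lambda>t. bose_var (c + d * t)) integrable_on {0..1}"
  using assms by (auto intro!: integrable_continuous_real continuous_intros affine_pos)

text \<open>Since 1 / (1 - exp (-x)) = 1 + \<open>bose x\<close>, the constants 1 and 1/2 subtracted
  in the equations are exactly the integrals of 1 and t.\<close>

lemma saddle_eqs_iff:
  assumes "0 < c" "0 \<le> d"
  shows "saddle_eqs A B c d \<longleftrightarrow> A = moment0 c d \<and> B = moment1 c d"
proof -
  have eq: "1 / (1 - exp (- c - d * t)) = 1 + bose (c + d * t)" if "t \<in> {0..1}" for t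
    using bose_alt[OF affine_pos[OF assms, of t]] that by (simp add: algebra_simps)
  have "integral {0..1} (\<lambda>t. 1 / (1 - exp (- c - d * t))) = integral {0..1} (\<lambda>t. 1 + bose (c + d * t))"
    by (intro Henstock_Kurzweil_Integration.integral_cong eq)
  also have "\<dots> = 1 + moment0 c d"
    unfolding moment0_def using assms
    by (subst Henstock_Kurzweil_Integration.integral_add) (auto intro!: integrable_bose_affine)
  finally have 0: "integral {0..1} (\<lambda>t. 1 / (1 - exp (- c - d * t))) = 1 + moment0 c d" .
  have "integral {0..1} (\<lambda>t. t / (1 - exp (- c - d * t))) = integral {0..1} (\<lambda>t. t + t * bose (c + d * t))"
    using eq by (intro Henstock_Kurzweil_Integration.integral_cong) (metis distrib_left mult.right_neutral times_divide_eq_right)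
  also have "\<dots> = integral {0..1} (\<lambda>t. t) + moment1 c d"
    unfolding moment1_def using assms
    by (subst Henstock_Kurzweil_Integration.integral_add)
       (auto intro!: integrable_bose_affine integrable_continuous_real continuous_intros affine_pos)
  also have "integral {0..1} (\<lambda>t :: real. t) = 1 / 2"
    using ident_has_integral[of 0 "1 :: real"] by (simp add: integral_unique)
  finally show ?thesis unfolding saddle_eqs_def 0 by auto
qed

text \<open>Mean value theorem: \<open>bose\<close> has slope \<open>- bose_var\<close>, and
  \<open>bose_var\<close> is decreasing, so its least value up to \<open>M\<close> is taken at
  \<open>M\<close>.\<close>

lemma bose_var_lower:
  assumes "0 < x" "x \<le> M" "0 < y" "y \<le> M"
  shows "bose_var M * (x - y)\<^sup>2 \<le> (bose y - bose x) * (x - y)"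
proof -
  have *: "bose_var M * (x - y) \<le> bose y - bose x" if "0 < y" "y < x" "x \<le> M" for x y
  proof -
    have "\<exists>z. y < z \<and> z < x \<and> bose x - bose y = (x - y) * - bose_var z"
      using that by (intro MVT2) (auto intro!: derivative_eq_intros)
    then obtain z where z: "y < z" "z < x" "bose x - bose y = (x - y) * - bose_var z" by blast
    then have "bose_var M \<le> bose_var z" using that by (intro bose_var_antimono) auto
    then have "(x - y) * bose_var M \<le> (x - y) * bose_var z" using that by (intro mult_left_mono) auto
    then show ?thesis using z by (simp add: algebra_simps)
  qed
  show ?thesis
  proof (cases x y rule: linorder_cases)
    case less
    have "bose_var M * (y - x) * (y - x) \<le> (bose x - bose y) * (y - x)"
      using *[of x y] less assms by (intro mult_right_mono) auto
    then show ?thesis by (simp add: power2_eq_square algebra_simps)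
  next
    case greater
    have "bose_var M * (x - y) * (x - y) \<le> (bose y - bose x) * (x - y)"
      using *[of y x] greater assms by (intro mult_right_mono) auto
    then show ?thesis by (simp add: power2_eq_square algebra_simps)
  qed simp
qed

text \<open>The right-hand side is the integral of (u + w t)^2 over the unit interval. The least
  eigenvalue of this form is (4 - sqrt 13) / 6, about 0.0657, which explains 1/16.\<close>

lemma quadratic_form_lower: "(u\<^sup>2 + w\<^sup>2) / 16 \<le> u\<^sup>2 + u * w + w\<^sup>2 / (3 :: real)"
proof -
  have "u\<^sup>2 + u * w + w\<^sup>2 / 3 - (u\<^sup>2 + w\<^sup>2) / 16 = 15/16 * (u + 8/15 * w)\<^sup>2 + (13/48 - 4/15) * w\<^sup>2"
    by (simp add: power2_eq_square field_simps)
  also have "\<dots> \<ge> 0" by simp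
  finally show ?thesis by simp
qed

lemma integral_affine_square:
  "((\<lambda>t. (u + w * t)\<^sup>2) has_integral u\<^sup>2 + u * w + w\<^sup>2 / 3) {0..1 :: real}"
proof -
  have "((\<lambda>t. (u + w * t)\<^sup>2) has_integral
      (u\<^sup>2 * 1 + u * w * 1\<^sup>2 + w\<^sup>2 / 3 * 1 ^ 3) - (u\<^sup>2 * 0 + u * w * 0\<^sup>2 + w\<^sup>2 / 3 * 0 ^ 3)) {0..1 :: real}"
    by (rule fundamental_theorem_of_calculus)
       (auto intro!: derivative_eq_intros simp: has_real_derivative_iff_has_vector_derivative[symmetric] power2_eq_square algebra_simps)
  then show ?thesis by simp
qed

text \<open>The saddle point map is, up to sign, the gradient of a strictly convex function.\<close>

lemma moments_strongly_monotone:
  assumes "0 < c" "0 \<le> d" "c + d \<le> M" "0 < c'" "0 \<le> d'" "c' + d' \<le> M"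
  shows "bose_var M / 16 * ((c - c')\<^sup>2 + (d - d')\<^sup>2) \<le>
    (moment0 c' d' - moment0 c d) * (c - c') + (moment1 c' d' - moment1 c d) * (d - d')"
proof -
  let ?f = "\<lambda>t. (bose (c' + d' * t) - bose (c + d * t)) * ((c - c') + (d - d') * t)"
  have I: "(?f has_integral
      (moment0 c' d' - moment0 c d) * (c - c') + (moment1 c' d' - moment1 c d) * (d - d')) {0..1}"
  proof -
    have m: "((\<lambda>t. bose (c + d * t)) has_integral moment0 c d) {0..1}"
      "((\<lambda>t. t * bose (c + d * t)) has_integral moment1 c d) {0..1}" if "0 < c" "0 \<le> d" for c d
      unfolding moment0_def moment1_def
      using integrable_bose_affine[OF that continuous_on_id] by (auto simp: has_integral_integral)
    have "((\<lambda>t. (bose (c' + d' * t) - bose (c + d * t)) * (c - c')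
             + (t * bose (c' + d' * t) - t * bose (c + d * t)) * (d - d')) has_integral
      (moment0 c' d' - moment0 c d) * (c - c') + (moment1 c' d' - moment1 c d) * (d - d')) {0..1}"
      by (intro has_integral_add has_integral_mult_left has_integral_diff m assms)
    then show ?thesis by (rule has_integral_eq[rotated]) (simp add: algebra_simps)
  qed
  have J: "((\<lambda>t. bose_var M * ((c - c') + (d - d') * t)\<^sup>2) has_integral
      bose_var M * ((c - c')\<^sup>2 + (c - c') * (d - d') + (d - d')\<^sup>2 / 3)) {0..1}"
    by (intro has_integral_mult_right integral_affine_square)
  have le: "c + d * t \<le> M" if "c + d \<le> M" "0 \<le> d" "t \<in> {0..1}" for c d t :: real
    using mult_left_le[of t d] that by auto
  have "bose_var M * ((c - c')\<^sup>2 + (c - c') * (d - d') + (d - d')\<^sup>2 / 3) \<le>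
     (moment0 c' d' - moment0 c d) * (c - c') + (moment1 c' d' - moment1 c d) * (d - d')"
  proof (rule has_integral_le[OF J I])
    fix t :: real assume t: "t \<in> {0..1}"
    show "bose_var M * ((c - c') + (d - d') * t)\<^sup>2 \<le> ?f t"
      using bose_var_lower[of "c + d * t" M "c' + d' * t"] le[of c d t] le[of c' d' t] assms t
        affine_pos[of c d t] affine_pos[of c' d' t] by (simp add: algebra_simps)
  qed
  moreover have "bose_var M * (((c - c')\<^sup>2 + (d - d')\<^sup>2) / 16) \<le>
      bose_var M * ((c - c')\<^sup>2 + (c - c') * (d - d') + (d - d')\<^sup>2 / 3)"
    using bose_var_pos[of M] assms by (intro mult_left_mono quadratic_form_lower) auto
  ultimately show ?thesis by simp
qed

text \<open>Strong monotonicity and Cauchy-Schwarz, divided by the distance of the arguments. It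
  yields both the uniqueness of the saddle point and its Lipschitz dependence.\<close>

lemma moments_inverse_lipschitz:
  assumes "0 < c" "0 \<le> d" "c + d \<le> M" "0 < c'" "0 \<le> d'" "c' + d' \<le> M"
  shows "dist (c, d) (c', d') \<le>
    16 / bose_var M * dist (moment0 c d, moment1 c d) (moment0 c' d', moment1 c' d')"
proof -
  let ?x = "(c - c', d - d')" and ?y = "(moment0 c' d' - moment0 c d, moment1 c' d' - moment1 c d)"
  have v: "0 < bose_var M" using assms by (intro bose_var_pos) auto
  have n: "(norm ?x)\<^sup>2 = (c - c')\<^sup>2 + (d - d')\<^sup>2" by (simp add: norm_Pair)
  have "bose_var M / 16 * (norm ?x)\<^sup>2 \<le> ?y \<bullet> ?x"
    unfolding n using moments_strongly_monotone[OF assms] by simp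
  also have "\<dots> \<le> norm ?y * norm ?x" by (rule norm_cauchy_schwarz)
  finally have "norm ?x * (bose_var M / 16 * norm ?x) \<le> norm ?x * norm ?y"
    by (simp add: power2_eq_square mult_ac)
  then have "bose_var M / 16 * norm ?x \<le> norm ?y"
  proof (cases "norm ?x = 0")
    case True
    then show ?thesis by (simp only: mult_zero_right norm_ge_zero)
  next
    case False
    then have "0 < norm ?x" using norm_ge_zero[of ?x] by linarith
    then show ?thesis using \<open>norm ?x * _ \<le> _\<close> by (rule mult_left_le_imp_le[rotated])
  qed
  then have "norm ?x \<le> 16 / bose_var M * norm ?y" using v by (simp add: field_simps)
  then show ?thesis by (simp add: dist_norm norm_minus_commute norm_Pair power2_commute)
qed

lemma moment0_has_integral:
  "0 < c \<Longrightarrow> 0 \<le> d \<Longrightarrow> ((\<lambda>t. bose (c + d * t)) has_integral moment0 c d) {0..1}"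
  unfolding moment0_def using integrable_bose_affine(3)[OF _ _ continuous_on_id] by (auto simp: has_integral_integral)

lemma moment1_has_integral:
  "0 < c \<Longrightarrow> 0 \<le> d \<Longrightarrow> ((\<lambda>t. t * bose (c + d * t)) has_integral moment1 c d) {0..1}"
  unfolding moment1_def using integrable_bose_affine(1)[OF _ _ continuous_on_id] by (auto simp: has_integral_integral)

lemma affine_in_interval:
  assumes "0 \<le> d" "t \<in> {0..1}"
  shows "c \<le> c + d * t" "c + d * t \<le> c + (d :: real)"
  using assms mult_left_le[of t d] by auto

lemma affine_pos': "0 < c \<Longrightarrow> 0 \<le> d \<Longrightarrow> 0 \<le> t \<Longrightarrow> - c < d * (t :: real)"
  using affine_pos[of c d t] by simp

lemma ln_one_minus_exp_affine_derivative:
  assumes "0 < c" "0 \<le> d" "t \<in> {0..1}"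
  shows "((\<lambda>t. ln (1 - exp (- (c + d * t)))) has_real_derivative bose (c + d * t) * d) (at t within S)"
  using assms by (intro ln_one_minus_exp_has_derivative) (auto intro!: derivative_eq_intros affine_pos affine_pos')

lemma bose_affine_derivative:
  assumes "0 < c" "0 \<le> d" "t \<in> {0..1}"
  shows "((\<lambda>t. bose (c + d * t)) has_real_derivative - bose_var (c + d * t) * d) (at t within S)"
  using assms by (intro bose_has_derivative) (auto intro!: derivative_eq_intros affine_pos affine_pos')

section \<open>Evaluation and bounds of the moments\<close>

lemma moment0_closed_form:
  assumes "0 < c" "0 < d"
  shows "moment0 c d = (ln (1 - exp (- (c + d))) - ln (1 - exp (- c))) / d"
proof -
  have 1: "((\<lambda>t. bose (c + d * t) * d) has_integral
      ln (1 - exp (- (c + d * 1))) - ln (1 - exp (- (c + d * 0)))) {0..1}"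
    using assms
    by (intro fundamental_theorem_of_calculus)
       (auto intro!: ln_one_minus_exp_affine_derivative simp: has_real_derivative_iff_has_vector_derivative[symmetric]
          simp del: minus_add_distrib)
  have 2: "((\<lambda>t. bose (c + d * t) * d) has_integral moment0 c d * d) {0..1}"
    using assms by (intro has_integral_mult_left moment0_has_integral) auto
  have "moment0 c d * d = ln (1 - exp (- (c + d))) - ln (1 - exp (- c))"
    using has_integral_unique[OF 1 2] by simp
  then show ?thesis using assms by (simp add: field_simps)
qed

text \<open>Integration by parts with antiderivative t ln (1 - exp (- (c + d t))). The term
  \<open>d * moment1 c d\<close> is responsible for the second copy of d B in the final
  exponent.\<close>

lemma ln_one_minus_exp_has_integral:
  assumes "0 < c" "0 \<le> d"
  shows "((\<lambda>t. ln (1 - exp (- (c + d * t)))) has_integral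
    ln (1 - exp (- (c + d))) - d * moment1 c d) {0..1}"
proof -
  have "((\<lambda>t. ln (1 - exp (- (c + d * t))) + d * (t * bose (c + d * t))) has_integral
      1 * ln (1 - exp (- (c + d * 1))) - 0 * ln (1 - exp (- (c + d * 0)))) {0..1}"
  proof (rule fundamental_theorem_of_calculus)
    fix t :: real assume t: "t \<in> {0..1}"
    show "((\<lambda>t. t * ln (1 - exp (- (c + d * t)))) has_vector_derivative
        ln (1 - exp (- (c + d * t))) + d * (t * bose (c + d * t))) (at t within {0..1})"
      unfolding has_real_derivative_iff_has_vector_derivative[symmetric]
      by (rule DERIV_cong[OF DERIV_mult[OF DERIV_ident ln_one_minus_exp_affine_derivative[OF assms t]]])
         (simp add: algebra_simps)
  qed simp
  from has_integral_diff[OF this has_integral_mult_right[OF moment1_has_integral[OF assms], of d]]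
  show ?thesis by simp
qed

lemma moment0_le:
  assumes "0 < c" "0 \<le> d"
  shows "moment0 c d \<le> 1 / c"
proof -
  have "moment0 c d \<le> 1 / c * (1 - 0)"
  proof (rule has_integral_le[OF moment0_has_integral[OF assms]])
    show "((\<lambda>t. 1 / c) has_integral 1 / c * (1 - 0)) {0..1 :: real}"
      using has_integral_const_real[of "1 / c" 0 1] by simp
    fix t :: real assume "t \<in> {0..1}"
    then have "bose (c + d * t) \<le> bose c"
      using assms affine_in_interval(1)[OF assms(2)] by (intro bose_antimono) auto
    also have "\<dots> \<le> 1 / c" using assms by (intro bose_le_inverse)
    finally show "bose (c + d * t) \<le> 1 / c" .
  qed
  then show ?thesis by simp
qed

lemma moment1_le:
  assumes "0 < c" "0 < d"
  shows "moment1 c d \<le> 1 / d"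
proof -
  have "moment1 c d \<le> 1 / d * (1 - 0)"
  proof (rule has_integral_le[OF moment1_has_integral])
    show "((\<lambda>t. 1 / d) has_integral 1 / d * (1 - 0)) {0..1 :: real}"
      using has_integral_const_real[of "1 / d" 0 1] by simp
    fix t :: real assume t: "t \<in> {0..1}"
    have p: "0 < c + d * t" using assms t by (intro affine_pos) auto
    have "t * bose (c + d * t) \<le> t * (1 / (c + d * t))"
      using t p by (intro mult_left_mono bose_le_inverse) auto
    also have "\<dots> \<le> 1 / d" using p assms t by (simp add: field_simps)
    finally show "t * bose (c + d * t) \<le> 1 / d" .
  qed (use assms in auto)
  then show ?thesis by simp
qed

text \<open>The mean of t - 1/2 is zero, so \<open>bose c\<close> may be subtracted from
  \<open>bose (c + d * t)\<close> under the integral; what is left is at most half the oscillation.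
  As this vanishes for small d, the bound is what makes B < A / 2 attainable.\<close>

lemma moment1_ge:
  assumes "0 < c" "0 \<le> d"
  shows "moment0 c d / 2 - (bose c - bose (c + d)) / 2 \<le> moment1 c d"
proof -
  have "((\<lambda>t. bose (c + d * t) * (1 / 2) + ((t - 1 / 2) * bose c - (bose c - bose (c + d)) / 2)) has_integral
      moment0 c d * (1 / 2) + ((1\<^sup>2 - 0\<^sup>2) / 2 - 1 / 2 * (1 - 0)) * bose c - (bose c - bose (c + d)) / 2 * (1 - 0)) {0..1}"
    unfolding add_diff_eq[symmetric]
    using has_integral_const_real[of "1 / 2 :: real" 0 1] has_integral_const_real[of "(bose c - bose (c + d)) / 2" 0 1]
      ident_has_integral[of 0 "1 :: real"] assms
    by (intro has_integral_add has_integral_diff has_integral_mult_left moment0_has_integral) auto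
  then have "((\<lambda>t. bose (c + d * t) * (1 / 2) + ((t - 1 / 2) * bose c - (bose c - bose (c + d)) / 2)) has_integral
      moment0 c d / 2 - (bose c - bose (c + d)) / 2) {0..1}" by simp
  then show ?thesis
  proof (rule has_integral_le[OF _ moment1_has_integral[OF assms]])
    fix t :: real assume t: "t \<in> {0..1}"
    have *: "bose (c + d) \<le> bose (c + d * t)" "bose (c + d * t) \<le> bose c"
      using assms affine_in_interval[OF assms(2) t, of c] by (auto intro!: bose_antimono)
    have "\<bar>t - 1 / 2\<bar> \<le> 1 / 2" using t unfolding abs_le_iff by auto
    then have "\<bar>(t - 1 / 2) * (bose (c + d * t) - bose c)\<bar> \<le> 1 / 2 * (bose c - bose (c + d))"
      unfolding abs_mult using * by (intro mult_mono) auto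
    then show "bose (c + d * t) * (1 / 2) + ((t - 1 / 2) * bose c - (bose c - bose (c + d)) / 2)
        \<le> t * bose (c + d * t)"
      unfolding left_diff_distrib right_diff_distrib diff_divide_distrib abs_le_iff by linarith
  qed
qed

text \<open>For \<open>d > 0\<close> the first saddle point equation is solved by
  \<open>exp c = 1 + (1 - exp (- d)) / (exp (d * A) - 1)\<close>; the second then follows from the
  intermediate value theorem in \<open>d\<close>.\<close>

lemma saddle_exists:
  assumes "0 < B" "2 * B < A"
  shows "\<exists>c d. 0 < c \<and> 0 < d \<and> moment0 c d = A \<and> moment1 c d = B"
proof -
  have A: "0 < A" using assms by simp
  define X where "X = (\<lambda>d. (1 - exp (- d)) / (exp (d * A) - 1))"
  define g where "g = (\<lambda>d. ln (1 + X d))"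
  have X: "0 < X d" if "0 < d" for d using that A by (simp add: X_def)
  have g: "0 < g d" if "0 < d" for d using X[OF that] by (simp add: g_def)
  have expg: "exp (g d) = 1 + X d" if "0 < d" for d using X[OF that] by (simp add: g_def)
  have m0: "moment0 (g d) d = A" if d: "0 < d" for d
  proof -
    have Xd: "X d * (exp (d * A) - 1) = 1 - exp (- d)" using d A by (simp add: X_def)
    have e: "exp (- (g d + d)) = exp (- d) / (1 + X d)" "exp (- g d) = 1 / (1 + X d)"
      using X[OF d] by (simp_all add: exp_diff exp_minus expg[OF d] field_simps)
    have "1 - exp (- (g d + d)) = (1 - exp (- g d)) * exp (d * A)"
      unfolding e using X[OF d] Xd by (simp add: field_simps)
    then have "ln (1 - exp (- (g d + d))) = ln (1 - exp (- g d)) + d * A"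
      using g[OF d] by (simp add: ln_mult)
    then show ?thesis using moment0_closed_form[OF g[OF d] d] d by simp
  qed
  have cont: "continuous_on {a..b} (\<lambda>d. moment1 (g d) d)" if "0 < a" for a b
  proof -
    have "continuous_on ({a..b} \<times> cbox 0 1) (\<lambda>(d, t). t * bose (g d + d * t))"
    proof -
      let ?S = "{a..b} \<times> cbox (0 :: real) 1"
      have S: "0 < fst p" "0 \<le> snd p" if "p \<in> ?S" for p using that \<open>0 < a\<close> by auto
      have "exp (fst p * A) - 1 \<noteq> 0" if "p \<in> ?S" for p using S(1)[OF that] A by simp
      then have "continuous_on ?S (\<lambda>p. X (fst p))"
        unfolding X_def by (intro continuous_intros) auto
      moreover have "1 + X (fst p) \<noteq> 0" if "p \<in> ?S" for p using X[OF S(1)[OF that]] by simp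
      ultimately have "continuous_on ?S (\<lambda>p. g (fst p))"
        unfolding g_def by (intro continuous_on_ln continuous_on_add continuous_on_const) auto
      then have "continuous_on ?S (\<lambda>p. snd p * bose (g (fst p) + fst p * snd p))"
        using S g by (intro continuous_intros affine_pos) (auto simp: less_imp_le)
      then show ?thesis by (simp add: case_prod_beta')
    qed
    from integral_continuous_on_param[OF this] show ?thesis by (simp add: moment1_def)
  qed
  \<comment> \<open>\<open>X d\<close> tends to 1 / A as d decreases to 0, so both terms tend to A;
    the difference is the oscillation that enters \<open>moment1_ge\<close>.\<close>
  have "((\<lambda>d. 1 / X d - 1 / (exp d * (1 + X d) - 1)) \<longlongrightarrow> 0) (at_right 0)"
    unfolding X_def using A by real_asymp
  moreover have "\<forall>\<^sub>F d in at_right 0. 1 / X d - 1 / (exp d * (1 + X d) - 1) = bose (g d) - bose (g d + d)"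
    using eventually_at_right_less[of 0] by eventually_elim (simp add: bose_def expg exp_add mult_ac)
  ultimately have "((\<lambda>d. bose (g d) - bose (g d + d)) \<longlongrightarrow> 0) (at_right 0)"
    by (rule Lim_transform_eventually)
  then have "\<forall>\<^sub>F d in at_right 0. bose (g d) - bose (g d + d) < A - 2 * B"
    using assms by (intro order_tendstoD(2)) auto
  moreover have "\<forall>\<^sub>F d in at_right 0. d < 2 / B"
    using assms by (intro order_tendstoD(2)[of _ 0] tendsto_ident_at) auto
  ultimately have "\<forall>\<^sub>F d in at_right 0. 0 < d \<and> d < 2 / B \<and> bose (g d) - bose (g d + d) < A - 2 * B"
    using eventually_at_right_less[of 0] by eventually_elim auto
  then obtain a where a: "0 < a" "a < 2 / B" "bose (g a) - bose (g a + a) < A - 2 * B"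
    using eventually_happens by force
  \<comment> \<open>At \<open>a\<close> the oscillation is below A - 2 B, so
    \<open>moment1_ge\<close> gives at least A / 2 - (A - 2 B) / 2 = B. At the other end, 2 / B,
    \<open>moment1_le\<close> gives at most B / 2.\<close>
  have "B \<le> moment1 (g a) a" using moment1_ge[OF g[OF a(1)] less_imp_le[OF a(1)]] a unfolding m0[OF a(1)] diff_divide_distrib by linarith
  moreover have "moment1 (g (2 / B)) (2 / B) \<le> B"
    using moment1_le[OF g, of "2 / B" "2 / B"] assms by simp
  ultimately obtain d where "a \<le> d" "d \<le> 2 / B" "moment1 (g d) d = B"
    using IVT2'[of "\<lambda>d. moment1 (g d) d" "2 / B" B a] cont[OF a(1)] a by auto
  then show ?thesis using a g m0 by (intro exI[of _ "g d"] exI[of _ d]) auto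
qed

text \<open>Off the diagonal, \<open>saddle_exists\<close> and the injectivity contained in
  \<open>moments_inverse_lipschitz\<close> justify the definite description. On A = 2 B the
  integrands have d = 0 and \<open>bose c\<close> equals A.\<close>

lemma saddle_point:
  assumes "0 < 2 * B" "2 * B \<le> A"
  shows "0 < saddle_c A B" "0 \<le> saddle_d A B" "saddle_d A B = 0 \<longleftrightarrow> A = 2 * B"
    "moment0 (saddle_c A B) (saddle_d A B) = A" "moment1 (saddle_c A B) (saddle_d A B) = B"
proof -
  have "0 < saddle_c A B \<and> 0 \<le> saddle_d A B \<and> (saddle_d A B = 0 \<longleftrightarrow> A = 2 * B) \<and>
    moment0 (saddle_c A B) (saddle_d A B) = A \<and> moment1 (saddle_c A B) (saddle_d A B) = B"
  proof (cases "A = 2 * B")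
    case True
    then have c: "saddle_c A B = ln ((A + 1) / A)" and d: "saddle_d A B = 0"
      by (simp_all add: saddle_c_def saddle_d_def saddle_pair_def)
    have A: "0 < A" using assms True by simp
    then have "exp (ln ((A + 1) / A)) = (A + 1) / A" by simp
    then have b: "bose (ln ((A + 1) / A)) = A" using A by (simp add: bose_def field_simps)
    have "0 < ln ((A + 1) / A)" using A by (intro ln_gt_zero) (simp add: field_simps)
    moreover have "moment1 (ln ((A + 1) / A)) 0 = A / 2"
      unfolding moment1_def using ident_has_integral[of 0 "1 :: real"]
      by (simp add: b integral_unique)
    then have "moment1 (ln ((A + 1) / A)) 0 = B" using True by simp
    ultimately show ?thesis unfolding c d by (auto simp: True[symmetric] moment0_def b)
  next
    case False
    define P where "P = (\<lambda>(c, d). 0 < c \<and> 0 < d \<and> saddle_eqs A B c d)"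
    have P: "P (c, d) \<longleftrightarrow> 0 < c \<and> 0 < d \<and> moment0 c d = A \<and> moment1 c d = B" for c d
      using saddle_eqs_iff[of c d A B] by (auto simp: P_def)
    have "\<exists>!p. P p"
    proof (rule ex_ex1I)
      show "\<exists>p. P p" using saddle_exists[of B A] assms False by (auto simp: P split_paired_Ex)
      fix p q assume "P p" "P q"
      obtain c d c' d' where pq: "p = (c, d)" "q = (c', d')" by fastforce
      have "dist (c, d) (c', d') \<le> 16 / bose_var (max (c + d) (c' + d')) *
          dist (moment0 c d, moment1 c d) (moment0 c' d', moment1 c' d')"
        using \<open>P p\<close> \<open>P q\<close> by (intro moments_inverse_lipschitz) (auto simp: pq P)
      then show "p = q" using \<open>P p\<close> \<open>P q\<close> by (auto simp: pq P)
    qed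
    then have "P (saddle_pair A B)"
      using theI'[of P] False by (simp add: saddle_pair_def P_def)
    then show ?thesis
      using False by (cases "saddle_pair A B") (auto simp: P saddle_c_def saddle_d_def)
  qed
  then show "0 < saddle_c A B" "0 \<le> saddle_d A B" "saddle_d A B = 0 \<longleftrightarrow> A = 2 * B"
    "moment0 (saddle_c A B) (saddle_d A B) = A" "moment1 (saddle_c A B) (saddle_d A B) = B"
    by auto
qed

section \<open>Uniform bounds and Lipschitz dependence on compact sets\<close>

lemma saddle_d_le:
  assumes "0 < b" "b \<le> B" "2 * B \<le> A"
  shows "saddle_d A B \<le> 1 / b"
proof (cases "saddle_d A B = 0")
  case False
  have "0 < B" using assms by simp
  then have d: "0 < saddle_d A B" using saddle_point[of B A] assms False by auto
  have "B \<le> 1 / saddle_d A B"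
    using moment1_le[OF saddle_point(1)[of B A] d] saddle_point(5)[of B A] assms by simp
  then have "b \<le> 1 / saddle_d A B" using assms by linarith
  then show ?thesis using d assms by (simp add: field_simps)
qed (use assms in simp)

lemma saddle_c_le:
  assumes "0 < b" "b \<le> B" "2 * B \<le> A"
  shows "saddle_c A B \<le> 1 / (2 * b)"
proof -
  have c: "0 < saddle_c A B" and "A \<le> 1 / saddle_c A B"
    using saddle_point[of B A] moment0_le[of "saddle_c A B" "saddle_d A B"] assms by auto
  then have "2 * b \<le> 1 / saddle_c A B" using assms by linarith
  then show ?thesis using c assms by (simp add: field_simps)
qed

text \<open>Replacing d by its upper bound 1 / b lowers \<open>moment0\<close>, so
  \<open>moment0 c (1 / b)\<close> is at most a. Its closed form grows like - b ln c as c tends to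
  0, hence c cannot be too small.\<close>

lemma saddle_c_ge:
  assumes "0 < b" "b \<le> B" "2 * B \<le> A" "A \<le> a"
  shows "(1 - exp (- 1 / b)) * exp (- a / b) \<le> saddle_c A B"
proof -
  let ?c = "saddle_c A B" and ?d = "saddle_d A B"
  have B: "0 < 2 * B" using assms by simp
  note sp = saddle_point[OF B assms(3)]
  have b: "0 < 1 / b" using assms by simp
  have "moment0 ?c (1 / b) \<le> moment0 ?c ?d"
  proof (rule has_integral_le[OF moment0_has_integral moment0_has_integral])
    fix t :: real assume t: "t \<in> {0..1}"
    have "?d * t \<le> 1 / b * t" using t saddle_d_le[OF assms(1-3)] by (intro mult_right_mono) auto
    then show "bose (?c + 1 / b * t) \<le> bose (?c + ?d * t)"
      using sp t by (intro bose_antimono affine_pos) auto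
  qed (use sp assms in auto)
  then have "(ln (1 - exp (- (?c + 1 / b))) - ln (1 - exp (- ?c))) / (1 / b) \<le> a"
    using sp assms moment0_closed_form[OF sp(1) b] by linarith
  then have "ln (1 - exp (- (?c + 1 / b))) - ln (1 - exp (- ?c)) \<le> a / b"
    using assms by (simp add: field_simps)
  then have "ln (1 - exp (- (?c + 1 / b))) \<le> a / b + ln (1 - exp (- ?c))" by simp
  then have "exp (ln (1 - exp (- (?c + 1 / b)))) \<le> exp (a / b) * exp (ln (1 - exp (- ?c)))"
    unfolding exp_add[symmetric] by simp
  then have "1 - exp (- (?c + 1 / b)) \<le> exp (a / b) * (1 - exp (- ?c))"
    using sp b by (simp add: add_pos_pos)
  moreover have "1 - exp (- 1 / b) \<le> 1 - exp (- (?c + 1 / b))" using sp by simp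
  moreover have "1 - exp (- ?c) \<le> ?c" using exp_ge_add_one_self[of "- ?c"] by linarith
  then have "exp (a / b) * (1 - exp (- ?c)) \<le> exp (a / b) * ?c" by (intro mult_left_mono) auto
  ultimately have "1 - exp (- 1 / b) \<le> exp (a / b) * ?c" by linarith
  then show ?thesis by (simp add: exp_minus field_simps)
qed

lemma saddle_bounds:
  assumes "compact K" "K \<subseteq> {(x, y). 2 * y \<le> x \<and> 0 < 2 * y}"
  obtains c0 M where "0 < c0"
    "\<And>A B. (A, B) \<in> K \<Longrightarrow> c0 \<le> saddle_c A B \<and> saddle_c A B + saddle_d A B \<le> M"
proof (cases "K = {}")
  case True
  then show ?thesis using that[of 1] by auto
next
  case False
  have "\<exists>p\<in>K. \<forall>q\<in>K. snd p \<le> snd q"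
    by (intro continuous_attains_inf assms False continuous_intros)
  then obtain p where p: "p \<in> K" "\<And>q. q \<in> K \<Longrightarrow> snd p \<le> snd q" by blast
  have "\<exists>r\<in>K. \<forall>q\<in>K. fst q \<le> fst r"
    by (intro continuous_attains_sup assms False continuous_intros)
  then obtain r where r: "r \<in> K" "\<And>q. q \<in> K \<Longrightarrow> fst q \<le> fst r" by blast
  have b: "0 < snd p" using p(1) assms(2) by auto
  show ?thesis
  proof (rule that[of "(1 - exp (- 1 / snd p)) * exp (- fst r / snd p)" "1 / (2 * snd p) + 1 / snd p"])
    show "0 < (1 - exp (- 1 / snd p)) * exp (- fst r / snd p)" using b by simp
    fix A B assume K: "(A, B) \<in> K"
    have "snd p \<le> B" "A \<le> fst r" "2 * B \<le> A" using p(2)[OF K] r(2)[OF K] K assms(2) by auto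
    then show "(1 - exp (- 1 / snd p)) * exp (- fst r / snd p) \<le> saddle_c A B \<and>
        saddle_c A B + saddle_d A B \<le> 1 / (2 * snd p) + 1 / snd p"
      using saddle_c_ge[OF b] saddle_c_le[OF b, of B A] saddle_d_le[OF b, of B A] by auto
  qed
qed

lemma saddle_lipschitz:
  assumes "compact K" "K \<subseteq> {(x, y). 2 * y \<le> x \<and> 0 < 2 * y}"
  shows "\<exists>L. L-lipschitz_on K (\<lambda>(x, y). (saddle_c x y, saddle_d x y))"
proof -
  obtain c0 M where M: "0 < c0" "\<And>A B. (A, B) \<in> K \<Longrightarrow> c0 \<le> saddle_c A B \<and> saddle_c A B + saddle_d A B \<le> M"
    using saddle_bounds[OF assms] by metis
  \<comment> \<open>For empty \<open>K\<close> nothing is known about \<open>M\<close>; the maximum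
    with 1 keeps the constant positive in every case.\<close>
  have "(16 / bose_var (max 1 M))-lipschitz_on K (\<lambda>(x, y). (saddle_c x y, saddle_d x y))"
  proof (rule lipschitz_onI)
    show "0 \<le> 16 / bose_var (max 1 M)" using bose_var_pos[of "max 1 M"] by (simp add: less_max_iff_disj)
    fix p q assume pq: "p \<in> K" "q \<in> K"
    obtain A B A' B' where e: "p = (A, B)" "q = (A', B')" by fastforce
    have AB: "0 < 2 * B" "2 * B \<le> A" "0 < 2 * B'" "2 * B' \<le> A'" using pq assms(2) e by auto
    show "dist ((\<lambda>(x, y). (saddle_c x y, saddle_d x y)) p) ((\<lambda>(x, y). (saddle_c x y, saddle_d x y)) q)
        \<le> 16 / bose_var (max 1 M) * dist p q"
      using moments_inverse_lipschitz[of "saddle_c A B" "saddle_d A B" "max 1 M" "saddle_c A' B'" "saddle_d A' B'"]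
        saddle_point[OF AB(1,2)] saddle_point[OF AB(3,4)] M(2)[of A B] M(2)[of A' B'] pq e by auto
  qed
  then show ?thesis by blast
qed

section \<open>The determinant as a covariance determinant\<close>

definition variance_integral :: "nat \<Rightarrow> real \<Rightarrow> real \<Rightarrow> real" where
  "variance_integral k c d = integral {0..1} (\<lambda>t. t ^ k * bose_var (c + d * t))"

lemma variance_has_integral:
  "0 < c \<Longrightarrow> 0 \<le> d \<Longrightarrow> ((\<lambda>t. t ^ k * bose_var (c + d * t)) has_integral variance_integral k c d) {0..1}"
  unfolding variance_integral_def
  by (intro integrable_integral integrable_bose_affine continuous_intros)

text \<open>The variance integrals for k = 0, 1, 2 are the limiting covariances of the sums of X_j
  and of (j / m) X_j, divided by m. For d > 0, integration by parts expresses d times each of them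
  by A, B and end-point values of \<open>bose\<close>. For d = 0 the variance is constant, and 1/12
  is 1 * 1/3 - (1/2)^2.\<close>

lemma saddle_Delta_eq:
  assumes "0 < 2 * B" "2 * B \<le> A"
  shows "saddle_Delta A B = variance_integral 0 (saddle_c A B) (saddle_d A B) *
    variance_integral 2 (saddle_c A B) (saddle_d A B) - (variance_integral 1 (saddle_c A B) (saddle_d A B))\<^sup>2"
proof -
  note sp = saddle_point[OF assms]
  define c d where "c = saddle_c A B" and "d = saddle_d A B"
  have c: "0 < c" and d: "0 \<le> d" and m: "moment0 c d = A" "moment1 c d = B" using sp by (auto simp: c_def d_def)
  show ?thesis
  proof (cases "A = 2 * B")
    case True
    then have "d = 0" using sp d_def by simp
    have "bose c = A" using m by (simp add: moment0_def \<open>d = 0\<close>)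
    then have v: "bose_var c = A * (A + 1)" by (simp add: bose_var_def add.commute)
    have "((\<lambda>t. t ^ k * bose_var c) has_integral 1 / real (Suc k) * bose_var c) {0..1 :: real}" for k
    proof (rule has_integral_mult_left)
      have "((\<lambda>t. t ^ k) has_integral 1 ^ Suc k / real (Suc k) - 0 ^ Suc k / real (Suc k)) {0..1 :: real}"
        by (rule fundamental_theorem_of_calculus)
           (auto intro!: DERIV_cong[OF DERIV_cdivide[OF DERIV_pow]]
              simp: has_real_derivative_iff_has_vector_derivative[symmetric] simp del: of_nat_Suc power_Suc)
      then show "((\<lambda>t. t ^ k) has_integral 1 / real (Suc k)) {0..1 :: real}" by simp
    qed
    then have *: "variance_integral k c d = 1 / real (Suc k) * bose_var c" for k
      unfolding variance_integral_def \<open>d = 0\<close> mult_zero_left add_0_right by (rule integral_unique)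
    have "saddle_Delta A B = A\<^sup>2 * (A + 1)\<^sup>2 / 12" using True by (simp add: saddle_Delta_def Let_def)
    then show ?thesis unfolding c_def[symmetric] d_def[symmetric] * v
      by (simp add: power2_eq_square field_simps)
  next
    case False
    then have d: "0 < d" using sp d d_def by auto
    have V0: "d * variance_integral 0 c d = bose c - bose (c + d)"
    proof -
      have "((\<lambda>t. d * (t ^ 0 * bose_var (c + d * t))) has_integral (- bose (c + d * 1)) - (- bose (c + d * 0))) {0..1}"
      proof (rule fundamental_theorem_of_calculus, simp, goal_cases)
        case (1 t)
        show ?case
          unfolding has_real_derivative_iff_has_vector_derivative[symmetric] using c d 1
          by (intro DERIV_cong[OF DERIV_minus[OF bose_affine_derivative]]) (auto simp: algebra_simps)
      qed
      from has_integral_unique[OF this has_integral_mult_right[OF variance_has_integral]] show ?thesis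
        using c d by simp
    qed
    have V1: "d * variance_integral 1 c d = A - bose (c + d)"
    proof -
      have "((\<lambda>t. d * (t ^ 1 * bose_var (c + d * t)) - bose (c + d * t)) has_integral
          (- (1 * bose (c + d * 1))) - (- (0 * bose (c + d * 0)))) {0..1}"
      proof (rule fundamental_theorem_of_calculus, simp, goal_cases)
        case (1 t)
        show ?case
          unfolding has_real_derivative_iff_has_vector_derivative[symmetric] using c d 1
          by (intro DERIV_cong[OF DERIV_minus[OF DERIV_mult[OF DERIV_ident bose_affine_derivative]]]) (auto simp: algebra_simps)
      qed
      from has_integral_unique[OF this has_integral_diff[OF has_integral_mult_right[OF variance_has_integral] moment0_has_integral]]
      show ?thesis using c d m by simp
    qed
    have V2: "d * variance_integral 2 c d = 2 * B - bose (c + d)"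
    proof -
      have "((\<lambda>t. d * (t ^ 2 * bose_var (c + d * t)) - 2 * (t * bose (c + d * t))) has_integral
          (- (1\<^sup>2 * bose (c + d * 1))) - (- (0\<^sup>2 * bose (c + d * 0)))) {0..1}"
      proof (rule fundamental_theorem_of_calculus, simp, goal_cases)
        case (1 t)
        show ?case
          unfolding has_real_derivative_iff_has_vector_derivative[symmetric] using c d 1
          by (intro DERIV_cong[OF DERIV_minus[OF DERIV_mult[OF DERIV_pow[of 2] bose_affine_derivative]]]) (auto simp: algebra_simps)
      qed
      from has_integral_unique[OF this has_integral_diff[OF has_integral_mult_right[OF variance_has_integral]
            has_integral_mult_right[OF moment1_has_integral]]]
      show ?thesis using c d m by simp
    qed
    have "d\<^sup>2 * (variance_integral 0 c d * variance_integral 2 c d - (variance_integral 1 c d)\<^sup>2)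
        = (d * variance_integral 0 c d) * (d * variance_integral 2 c d) - (d * variance_integral 1 c d)\<^sup>2"
      by (simp add: power2_eq_square algebra_simps)
    also have "\<dots> = (bose c - bose (c + d)) * (2 * B - bose (c + d)) - (A - bose (c + d))\<^sup>2"
      unfolding V0 V1 V2 ..
    also have "\<dots> = (2 * B * exp c * (exp d - 1) + 2 * A * (exp c - 1) - 1) /
             ((exp (d + c) - 1) * (exp c - 1)) - A\<^sup>2"
    proof -
      define x y where "x = exp c - 1" and "y = exp (c + d) - 1"
      have xy: "x \<noteq> 0" "y \<noteq> 0" using c d by (auto simp: x_def y_def)
      have e: "exp c * (exp d - 1) = y - x" "exp (d + c) - 1 = y"
        by (simp_all add: x_def y_def exp_add algebra_simps)
      show ?thesis
        unfolding mult.assoc[of "2 * B"] e bose_def x_def[symmetric] y_def[symmetric]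
        using xy by (simp add: field_simps power2_eq_square)
    qed
    finally have "d\<^sup>2 * (variance_integral 0 c d * variance_integral 2 c d - (variance_integral 1 c d)\<^sup>2) = \<dots>" .
    then have "variance_integral 0 c d * variance_integral 2 c d - (variance_integral 1 c d)\<^sup>2 = \<dots> / d\<^sup>2"
      using d by (simp add: eq_divide_eq mult.commute)
    also have "\<dots> = saddle_Delta A B"
      using False by (simp add: saddle_Delta_def Let_def c_def[symmetric] d_def[symmetric] diff_divide_distrib mult_ac)
    finally show ?thesis unfolding c_def d_def ..
  qed
qed

section \<open>Characteristic functions of geometric laws\<close>

text \<open>Half-angle formula 1 - cos x = 2 sin^2 (x / 2) together with sin y >= y / 2 on the
  quarter period.\<close>

lemma one_minus_cos_ge:
  fixes x :: real
  assumes "\<bar>x\<bar> \<le> pi"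
  shows "x\<^sup>2 / 8 \<le> 1 - cos x"
proof -
  define y where "y = \<bar>x\<bar> / 2"
  have y: "0 \<le> y" "y \<le> pi / 2" using assms by (auto simp: y_def)
  have "y / 2 \<le> sin y"
  \<comment> \<open>Up to pi / 3 the derivative cos y - 1/2 is nonnegative; beyond, sin y >= sqrt 3
    / 2 >= pi / 4 >= y / 2.\<close>
  proof (cases "y \<le> pi / 3")
    case True
    have "sin 0 - 0 / 2 \<le> sin y - y / 2"
    proof (rule DERIV_nonneg_imp_nondecreasing[OF y(1)])
      fix z assume z: "0 \<le> z" "z \<le> y"
      have "cos (pi / 3) \<le> cos z" using z True by (intro cos_monotone_0_pi_le) auto
      then show "\<exists>D. ((\<lambda>y. sin y - y / 2) has_real_derivative D) (at z) \<and> 0 \<le> D"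
        by (intro exI[of _ "cos z - 1 / 2"]) (auto intro!: derivative_eq_intros simp: cos_60)
    qed
    then show ?thesis by simp
  next
    case False
    have "y / 2 \<le> pi / 4" using y by simp
    also have "\<dots> \<le> sqrt 3 / 2"
    proof -
      have "pi / 2 \<le> 1.6" using pi_less_4 pi_approx by simp
      also have "\<dots> \<le> sqrt 3" by (intro real_le_rsqrt) (simp add: power2_eq_square)
      finally show ?thesis by simp
    qed
    also have "\<dots> = sin (pi / 3)" by (simp add: sin_60)
    also have "\<dots> \<le> sin y" using False y by (intro sin_monotone_2pi_le) auto
    finally show ?thesis .
  qed
  then have "(y / 2)\<^sup>2 \<le> (sin y)\<^sup>2" using y by (intro power_mono) auto
  moreover have "cos x = 1 - 2 * (sin y)\<^sup>2"
    using cos_double_sin[of y] by (simp add: y_def)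
  ultimately show ?thesis by (simp add: y_def power_divide)
qed

lemma one_minus_cos_le: "1 - cos x \<le> x\<^sup>2 / 2" for x :: real
proof -
  have "\<bar>sin (x / 2)\<bar>\<^sup>2 \<le> \<bar>x / 2\<bar>\<^sup>2" by (intro power_mono abs_sin_x_le_abs_x) auto
  then have "(sin (x / 2))\<^sup>2 \<le> (x / 2)\<^sup>2" by (simp add: power_divide)
  moreover have "cos x = 1 - 2 * (sin (x / 2))\<^sup>2" using cos_double_sin[of "x / 2"] by simp
  ultimately show ?thesis by (simp add: power_divide)
qed

text \<open>With z = exp (i a) - 1 and w = exp (i b) - 1 this is |z - w|^2 <= 2 |z|^2 + 2 |w|^2, by
  the parallelogram law: the nonnegative quantity in the proof is |z + w|^2.\<close>

lemma one_minus_cos_diff_le: "1 - cos (a - b) \<le> 2 * (1 - cos a) + 2 * (1 - cos b)" for a b :: real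
proof -
  have "0 \<le> (cos a + cos b - 2)\<^sup>2 + (sin a + sin b)\<^sup>2" by simp
  also have "\<dots> = 6 + 2 * (cos a * cos b + sin a * sin b) - 4 * cos a - 4 * cos b"
    by (simp add: power2_eq_square algebra_simps)
      (use sin_cos_squared_add3[of a] sin_cos_squared_add3[of b] in linarith)
  finally show ?thesis by (simp add: cos_diff)
qed

text \<open>Geometric series: its numerator has norm at most 2 and its denominator |1 - exp (i y)|
  at least |y| / 2, by \<open>one_minus_cos_ge\<close>.\<close>

lemma norm_sum_cis_le:
  assumes "0 < \<bar>y\<bar>" "\<bar>y\<bar> \<le> pi"
  shows "norm (\<Sum>j<M. cis (x + real j * y)) \<le> 4 / \<bar>y\<bar>"
proof -
  have n: "norm (1 - cis y) = sqrt (2 * (1 - cos y))"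
  proof -
    have "(1 - cos y)\<^sup>2 + (sin y)\<^sup>2 = ((sin y)\<^sup>2 + (cos y)\<^sup>2) + 1 - 2 * cos y"
      by (simp add: power2_eq_square algebra_simps)
    then show ?thesis by (simp add: cmod_def)
  qed
  have "\<bar>y\<bar> / 2 = sqrt (y\<^sup>2 / 4)" by (simp add: real_sqrt_divide)
  also have "\<dots> \<le> norm (1 - cis y)"
    unfolding n using one_minus_cos_ge[OF assms(2)] by (intro real_sqrt_le_mono) simp
  finally have le: "\<bar>y\<bar> / 2 \<le> norm (1 - cis y)" .
  have "(1 - cis y) * (\<Sum>j<M. cis (x + real j * y)) = cis x * ((1 - cis y) * (\<Sum>j<M. cis y ^ j))"
  proof -
    have "cis (x + real j * y) = cis x * cis y ^ j" for j by (simp add: cis_mult Complex.DeMoivre)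
    then show ?thesis by (simp add: sum_distrib_left mult_ac)
  qed
  also have "(1 - cis y) * (\<Sum>j<M. cis y ^ j) = 1 - cis y ^ M"
    by (simp add: one_diff_power_eq)
  finally have "norm ((1 - cis y) * (\<Sum>j<M. cis (x + real j * y))) = norm (cis x * (1 - cis y ^ M))"
    by (rule arg_cong)
  then have "norm (1 - cis y) * norm (\<Sum>j<M. cis (x + real j * y)) = norm (1 - cis y ^ M)"
    unfolding norm_mult norm_cis mult_1 .
  also have "\<dots> \<le> 2" using norm_triangle_ineq4[of 1 "cis y ^ M"] by (simp add: norm_power)
  finally have "norm (1 - cis y) * norm (\<Sum>j<M. cis (x + real j * y)) \<le> 2" .
  moreover have "\<bar>y\<bar> / 2 * norm (\<Sum>j<M. cis (x + real j * y)) \<le> norm (1 - cis y) * norm (\<Sum>j<M. cis (x + real j * y))"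
    by (intro mult_right_mono le) auto
  ultimately have "\<bar>y\<bar> / 2 * norm (\<Sum>j<M. cis (x + real j * y)) \<le> 2" by linarith
  then show ?thesis using assms(1) by (simp add: field_simps)
qed

text \<open>Away from the origin the lower bound comes from the geometric sum; near the origin, pairing
  the indices \<open>j\<close> and \<open>j + k\<close> with \<open>k\<close> about \<open>m / 3\<close> eliminates \<open>x\<close>.\<close>

lemma sum_one_minus_cos_ge:
  fixes x y :: real
  assumes m: "4 \<le> m" and x: "\<bar>x\<bar> \<le> pi" and y: "\<bar>y\<bar> \<le> pi"
  shows "real m / 2 \<le> (\<Sum>j<Suc m. 1 - cos (x + real j * y)) \<or>
    (real m * x\<^sup>2 + real m ^ 3 * y\<^sup>2) / 60000 \<le> (\<Sum>j<Suc m. 1 - cos (x + real j * y))"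
\<comment> \<open>The threshold makes the bound 4 / |y| on the cosine sum at most m / 2, half of the
  trivial value.\<close>
proof (cases "8 / real m \<le> \<bar>y\<bar>")
  case True
  have "0 < 8 / real m" using m by simp
  then have y0: "0 < \<bar>y\<bar>" using True by (rule less_le_trans)
  have "(\<Sum>j<Suc m. cos (x + real j * y)) = Re (\<Sum>j<Suc m. cis (x + real j * y))" by simp
  also have "\<dots> \<le> 4 / \<bar>y\<bar>"
    using complex_Re_le_cmod norm_sum_cis_le[OF y0 y] by (rule order_trans)
  also have "\<dots> \<le> real m / 2" using True y0 m by (simp add: field_simps)
  finally have "(\<Sum>j<Suc m. cos (x + real j * y)) \<le> real m / 2" .
  moreover have "(\<Sum>j<Suc m. 1 - cos (x + real j * y)) = real (Suc m) - (\<Sum>j<Suc m. cos (x + real j * y))"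
    by (simp add: sum_subtractf del: sum.lessThan_Suc)
  ultimately have "real m / 2 \<le> (\<Sum>j<Suc m. 1 - cos (x + real j * y))" by linarith
  then show ?thesis ..
next
  case False
  define S where "S = (\<Sum>j<Suc m. 1 - cos (x + real j * y))"
  \<comment> \<open>Now k |y| <= 8/3 < pi, so \<open>one_minus_cos_ge\<close> applies to k y, and
    the index blocks starting at 0 and at k are disjoint and lie below \<open>Suc m\<close>.\<close>
  define k where "k = m div 3"
  have k: "real m / 6 \<le> real k" "3 * k \<le> m" using m by (auto simp: k_def)
  have ky: "\<bar>real k * y\<bar> \<le> pi"
  proof -
    have "real k * \<bar>y\<bar> \<le> (real m / 3) * (8 / real m)"
      using False k by (intro mult_mono) auto
    also have "\<dots> \<le> pi" using m pi_gt3 by simp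
    finally show ?thesis by (simp add: abs_mult)
  qed
  have "real k * (1 - cos (real k * y)) = (\<Sum>j<k. 1 - cos ((x + real (j + k) * y) - (x + real j * y)))"
  proof -
    have "(x + real (j + k) * y) - (x + real j * y) = real k * y" for j by (simp add: distrib_right)
    then show ?thesis by simp
  qed
  also have "\<dots> \<le> (\<Sum>j<k. 2 * (1 - cos (x + real (j + k) * y)) + 2 * (1 - cos (x + real j * y)))"
    by (intro sum_mono one_minus_cos_diff_le)
  also have "\<dots> = 2 * ((\<Sum>j<k. 1 - cos (x + real j * y)) + (\<Sum>j<k. 1 - cos (x + real (j + k) * y)))"
    unfolding sum.distrib sum_distrib_left[symmetric] by simp
  also have "(\<Sum>j<k. 1 - cos (x + real (j + k) * y)) = (\<Sum>j\<in>{k..<k + k}. 1 - cos (x + real j * y))"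
    by (rule sum.reindex_bij_witness[of _ "\<lambda>j. j - k" "\<lambda>j. j + k"]) auto
  also have "(\<Sum>j<k. 1 - cos (x + real j * y)) + \<dots> = (\<Sum>j\<in>{..<k + k}. 1 - cos (x + real j * y))"
    by (subst sum.union_disjoint[symmetric]) (auto intro!: sum.cong)
  also have "\<dots> \<le> S" unfolding S_def using k by (intro sum_mono2) auto
  finally have kS: "real k * (1 - cos (real k * y)) \<le> 2 * S" by simp
  have "real k ^ 3 * y\<^sup>2 / 8 = real k * ((real k * y)\<^sup>2 / 8)"
    by (simp add: power2_eq_square power3_eq_cube)
  also have "\<dots> \<le> real k * (1 - cos (real k * y))"
    by (intro mult_left_mono one_minus_cos_ge ky) auto
  finally have "real k ^ 3 * y\<^sup>2 \<le> 16 * S" using kS by simp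
  moreover have "(real m / 6) ^ 3 * y\<^sup>2 \<le> real k ^ 3 * y\<^sup>2"
    using k by (intro mult_right_mono power_mono) auto
  ultimately have yS: "real m ^ 3 * y\<^sup>2 \<le> 3456 * S" by (simp add: power_divide)
  \<comment> \<open>With y controlled (3456 = 16 * 6^3), x is recovered by removing j y from each
    phase, at a cost of order m^3 y^2 in total.\<close>
  have "real (Suc m) * (1 - cos x) = (\<Sum>j<Suc m. 1 - cos ((x + real j * y) - real j * y))" by simp
  also have "\<dots> \<le> (\<Sum>j<Suc m. 2 * (1 - cos (x + real j * y)) + real m ^ 2 * y\<^sup>2)"
  proof (intro sum_mono)
    fix j assume "j \<in> {..<Suc m}"
    then have "(real j)\<^sup>2 \<le> (real m)\<^sup>2" by (intro power_mono) auto
    then have "(real j)\<^sup>2 * y\<^sup>2 \<le> (real m)\<^sup>2 * y\<^sup>2" by (intro mult_right_mono) auto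
    then show "1 - cos ((x + real j * y) - real j * y) \<le> 2 * (1 - cos (x + real j * y)) + real m ^ 2 * y\<^sup>2"
      using one_minus_cos_diff_le[of "x + real j * y" "real j * y"] one_minus_cos_le[of "real j * y"]
      by (simp add: power_mult_distrib)
  qed
  also have "\<dots> = 2 * S + real (Suc m) * (real m ^ 2 * y\<^sup>2)"
    by (simp add: S_def sum.distrib sum_distrib_left)
  also have "real (Suc m) * (real m ^ 2 * y\<^sup>2) \<le> 2 * real m * (real m ^ 2 * y\<^sup>2)"
    using m by (intro mult_right_mono) auto
  also have "\<dots> = 2 * (real m ^ 3 * y\<^sup>2)" by (simp add: power2_eq_square power3_eq_cube)
  finally have "real (Suc m) * (1 - cos x) \<le> 6914 * S" using yS by simp
  moreover have "real m * (x\<^sup>2 / 8) \<le> real (Suc m) * (1 - cos x)"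
    by (intro mult_mono one_minus_cos_ge x) auto
  ultimately have "real m * x\<^sup>2 \<le> 55312 * S" by simp
  \<comment> \<open>58768 = 8 * 6914 + 3456 with 6914 = 2 + 2 * 3456; rounding up gives
    60000.\<close>
  then have "real m * x\<^sup>2 + real m ^ 3 * y\<^sup>2 \<le> 58768 * S" using yS by simp
  moreover have "0 \<le> S" unfolding S_def by (intro sum_nonneg) simp
  ultimately have "real m * x\<^sup>2 + real m ^ 3 * y\<^sup>2 \<le> 60000 * S" by simp
  then show ?thesis by (simp add: S_def)
qed

text \<open>The characteristic function of a geometric law with mean \<open>g\<close>.\<close>

definition geom_char :: "real \<Rightarrow> real \<Rightarrow> complex" where
  "geom_char g a = 1 / (1 - of_real g * (cis a - 1))"

lemma norm_geom_char_denominator: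
  "(norm (1 - of_real g * (cis a - 1)))\<^sup>2 = 1 + 2 * (g * (1 + g)) * (1 - cos a)"
proof -
  have "(norm (1 - of_real g * (cis a - 1)))\<^sup>2 = (1 + g * (1 - cos a))\<^sup>2 + (g * sin a)\<^sup>2"
    by (simp add: cmod_power2 algebra_simps)
  also have "\<dots> = 1 + 2 * (g * (1 + g)) * (1 - cos a)"
    unfolding power_mult_distrib sin_squared_eq by (simp add: power2_eq_square algebra_simps)
  finally show ?thesis .
qed

lemma norm_geom_char_denominator_ge_1:
  "0 \<le> g \<Longrightarrow> 1 \<le> norm (1 - of_real g * (cis a - 1))"
  by (rule power2_le_imp_le) (auto simp: norm_geom_char_denominator)

text \<open>The squared norm is at most 1 / (1 + y) <= exp (- y / (1 + y)) with y = 2 k (1 - cos a).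
  Since 1 - cos a <= 2, y is at most 4 k, which gives the denominator; the square root removes the
  factor 2.\<close>

lemma norm_geom_char_le:
  assumes "0 \<le> g" "0 < k" "k \<le> g * (1 + g)"
  shows "norm (geom_char g a) \<le> exp (- (k / (1 + 4 * k) * (1 - cos a)))"
proof -
  define y where "y = 2 * k * (1 - cos a)"
  have c: "0 \<le> 1 - cos a" "1 - cos a \<le> 2" by simp_all
  have y: "0 \<le> y" using assms c by (simp add: y_def)
  have "2 * k * (1 - cos a) \<le> 2 * k * 2" using assms c by (intro mult_left_mono) auto
  then have y4: "y \<le> 4 * k" by (simp add: y_def)
  have "y / (1 + 4 * k) \<le> y / (1 + y)" using y y4 assms by (intro divide_left_mono) auto
  have "1 / (1 + y) = 1 + - (y / (1 + y))" using y by (simp add: field_simps)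
  also have "\<dots> \<le> exp (- (y / (1 + y)))" by (rule exp_ge_add_one_self)
  also have "\<dots> \<le> exp (- (y / (1 + 4 * k)))" using \<open>y / (1 + 4 * k) \<le> y / (1 + y)\<close> by simp
  finally have "1 / (1 + y) \<le> exp (- (y / (1 + 4 * k)))" .
  have "(norm (geom_char g a))\<^sup>2 = 1 / (1 + 2 * (g * (1 + g)) * (1 - cos a))"
    by (simp add: geom_char_def norm_divide power_divide norm_geom_char_denominator)
  also have "\<dots> \<le> 1 / (1 + y)"
    unfolding y_def using assms c by (intro divide_left_mono add_left_mono mult_right_mono mult_left_mono)
      (auto intro!: mult_pos_pos add_pos_nonneg)
  also have "\<dots> \<le> exp (- (y / (1 + 4 * k)))" by fact
  also have "\<dots> = (exp (- (k / (1 + 4 * k) * (1 - cos a))))\<^sup>2"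
    by (simp add: exp_double[symmetric] y_def)
  finally show ?thesis by (rule power2_le_imp_le) simp
qed

lemma exp_minus_approx: "0 \<le> y \<Longrightarrow> \<bar>exp (- y) - (1 - y)\<bar> \<le> y\<^sup>2" for y :: real
proof -
  assume y: "0 \<le> y"
  have "1 - y \<le> exp (- y)" using exp_ge_add_one_self[of "- y"] by simp
  moreover have "exp (- y) \<le> 1 / (1 + y)"
    using y exp_ge_add_one_self[of y] by (simp add: exp_minus inverse_eq_divide divide_left_mono)
  moreover have "1 / (1 + y) \<le> 1 - y + y\<^sup>2"
    using y by (simp add: field_simps power2_eq_square)
  ultimately show ?thesis by simp
qed

lemma cis_approx: "norm (cis x - (1 + \<i> * of_real x - of_real (x\<^sup>2 / 2))) \<le> \<bar>x\<bar> ^ 3"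
proof -
  have "cis x - (1 + \<i> * of_real x - of_real (x\<^sup>2 / 2)) = iexp x - (\<Sum>k\<le>2. (\<i> * of_real x) ^ k / fact k)"
  proof -
    have "(\<Sum>k\<le>2. f k) = f 0 + f 1 + f 2" for f :: "nat \<Rightarrow> complex"
      by (simp add: numeral_2_eq_2)
    then show ?thesis by (simp add: cis_conv_exp power_mult_distrib)
  qed
  also have "norm \<dots> \<le> \<bar>x\<bar> ^ 3 / 6" using iexp_approx1[of x 2] by (simp add: fact_numeral)
  also have "\<dots> \<le> \<bar>x\<bar> ^ 3" by simp
  finally show ?thesis .
qed

text \<open>Third order Taylor expansion, multiplied out with the denominator of \<open>geom_char\<close>.\<close>

lemma geom_char_approx:
  assumes g: "0 \<le> g" "g \<le> G" and a: "\<bar>a\<bar> \<le> 1"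
  shows "norm (cis (- (g * a)) * geom_char g a - of_real (exp (- (g * (1 + g) * a\<^sup>2 / 2))))
    \<le> 20 * (1 + G) ^ 5 * \<bar>a\<bar> ^ 3"
proof -
  define v w where "v = g * (1 + g)" and "w = exp (- (v * a\<^sup>2 / 2))"
  define R1 where "R1 = cis (- (g * a)) - (1 + \<i> * of_real (- (g * a)) - of_real ((- (g * a))\<^sup>2 / 2))"
  define R2 where "R2 = cis a - (1 + \<i> * of_real a - of_real (a\<^sup>2 / 2))"
  define R3 where "R3 = w - (1 - v * a\<^sup>2 / 2)"
  define D where "D = 1 - of_real g * (cis a - 1)"
  have v: "0 \<le> v" using g by (simp add: v_def)
  let ?H = "1 + G"
  have H: "1 \<le> ?H" using g by simp
  have gH: "g \<le> ?H" using g by simp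
  have vH: "v \<le> ?H\<^sup>2" unfolding v_def power2_eq_square using g by (intro mult_mono) auto
  have w: "0 \<le> w" "w \<le> 1" using v by (auto simp: w_def)
  have D1: "1 \<le> norm D" unfolding D_def using g by (intro norm_geom_char_denominator_ge_1)
  then have D0: "D \<noteq> 0" by auto
  have a2: "a\<^sup>2 \<le> 1" using a by (simp add: abs_square_le_1)
  have a3: "0 \<le> \<bar>a\<bar> ^ 3" by simp
  have a4: "\<bar>a\<bar> ^ 4 \<le> \<bar>a\<bar> ^ 3" using a by (intro power_decreasing) auto
  have Hp: "?H ^ i \<le> ?H ^ 5" if "i \<le> 5" for i using H that by (intro power_increasing)
  have n1: "norm R1 \<le> ?H ^ 5 * \<bar>a\<bar> ^ 3"
  proof -
    have "norm R1 \<le> \<bar>- (g * a)\<bar> ^ 3" unfolding R1_def by (rule cis_approx)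
    also have "\<dots> = g ^ 3 * \<bar>a\<bar> ^ 3" using g by (simp add: abs_mult power_mult_distrib)
    also have "g ^ 3 \<le> ?H ^ 3" using g by (intro power_mono) auto
    also have "\<dots> \<le> ?H ^ 5" by (rule Hp) simp
    finally show ?thesis using a3 by (simp add: mult_right_mono)
  qed
  have n2: "norm R2 \<le> \<bar>a\<bar> ^ 3" unfolding R2_def by (rule cis_approx)
  have n3: "\<bar>R3\<bar> \<le> ?H ^ 4 * \<bar>a\<bar> ^ 3"
  proof -
    have "\<bar>R3\<bar> \<le> (v * a\<^sup>2 / 2)\<^sup>2" unfolding R3_def w_def using v by (intro exp_minus_approx) auto
    also have "\<dots> = v\<^sup>2 / 4 * \<bar>a\<bar> ^ 4"
      by (simp add: power_mult_distrib power_divide power_abs[symmetric] flip: power_mult)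
    also have "\<dots> \<le> v\<^sup>2 * \<bar>a\<bar> ^ 3" using a4 by (intro mult_mono) auto
    also have "v\<^sup>2 \<le> (?H\<^sup>2)\<^sup>2" using v vH by (intro power_mono) auto
    also have "\<dots> = ?H ^ 4" by (simp flip: power_mult)
    finally show ?thesis using a3 by (simp add: mult_right_mono)
  qed
  define Q where "Q = 1 - \<i> * of_real (g * a) + of_real (g * a\<^sup>2 / 2)"
  have nQ: "norm Q \<le> 3 * ?H"
  proof -
    have "norm Q \<le> norm (1 :: complex) + norm (\<i> * of_real (g * a)) + norm (of_real (g * a\<^sup>2 / 2) :: complex)"
      unfolding Q_def by (intro norm_triangle_le norm_triangle_le_diff add_mono order_refl)
    also have "\<dots> = 1 + \<bar>g * a\<bar> + \<bar>g * a\<^sup>2 / 2\<bar>"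
      by (simp only: norm_mult norm_of_real norm_one norm_ii mult_1)
    also have "\<bar>g * a\<bar> \<le> g * 1" unfolding abs_mult using g a by (intro mult_mono) auto
    also have "\<bar>g * a\<^sup>2 / 2\<bar> = g * (a\<^sup>2 / 2)" using g by (simp add: abs_mult)
    also have "\<dots> \<le> g * 1" using a2 g by (intro mult_left_mono) auto
    finally show ?thesis using g by simp
  qed
  define P where "P = - \<i> * of_real (g * a) + of_real (g * a\<^sup>2 / 2)"
  have nP: "norm P \<le> 2 * ?H * \<bar>a\<bar>"
  proof -
    have "norm P \<le> norm (- \<i> * of_real (g * a)) + norm (of_real (g * a\<^sup>2 / 2) :: complex)"
      unfolding P_def by (rule norm_triangle_ineq)
    also have "\<dots> = \<bar>g * a\<bar> + \<bar>g * a\<^sup>2 / 2\<bar>"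
      by (simp only: norm_mult norm_of_real norm_minus_cancel norm_ii mult_1)
    also have "\<bar>g * a\<bar> \<le> g * \<bar>a\<bar>" using g by (simp add: abs_mult)
    also have "\<bar>g * a\<^sup>2 / 2\<bar> = g * (a\<^sup>2 / 2)" using g by (simp add: abs_mult)
    also have "g * (a\<^sup>2 / 2) \<le> g * \<bar>a\<bar>"
    proof -
      have "a\<^sup>2 / 2 \<le> \<bar>a\<bar> * 1" using a mult_left_mono[of "\<bar>a\<bar>" 1 "\<bar>a\<bar>"]
        by (auto simp: power2_eq_square abs_mult_self_eq)
      then show ?thesis using g by (intro mult_left_mono) auto
    qed
    also have "g * \<bar>a\<bar> + g * \<bar>a\<bar> \<le> 2 * ?H * \<bar>a\<bar>" using gH by (simp add: mult_right_mono flip: distrib_right)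
    finally show ?thesis by simp
  qed
  \<comment> \<open>Here D = Q - g R2 and P = Q - 1. The quadratic terms cancel because v = g + g^2
    is the variance, so every remaining term is at least cubic in a.\<close>
  have "cis (- (g * a)) - of_real w * D
      = R1 + of_real (v * a\<^sup>2 / 2) * P - of_real R3 * Q + of_real (w * g) * R2"
    (is "_ = ?R")
    unfolding D_def P_def Q_def R1_def R2_def R3_def v_def
    by (simp add: field_simps power2_eq_square)
  then have "norm (cis (- (g * a)) - of_real w * D) = norm ?R" by (rule arg_cong)
  also have "\<dots> \<le> norm R1 + norm (of_real (v * a\<^sup>2 / 2) * P) + norm (of_real R3 * Q) + norm (of_real (w * g) * R2)"
    by (intro norm_triangle_le norm_triangle_le_diff add_mono order_refl)
  also have "norm (of_real (v * a\<^sup>2 / 2) * P) \<le> 2 * ?H ^ 5 * \<bar>a\<bar> ^ 3"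
  proof -
    have "norm (of_real (v * a\<^sup>2 / 2) * P) \<le> (?H\<^sup>2 * \<bar>a\<bar>\<^sup>2) * (2 * ?H * \<bar>a\<bar>)"
      unfolding norm_mult norm_of_real
    proof (intro mult_mono nP)
      have "\<bar>v * a\<^sup>2 / 2\<bar> \<le> v * \<bar>a\<bar>\<^sup>2" using v by (simp add: abs_mult)
      also have "\<dots> \<le> ?H\<^sup>2 * \<bar>a\<bar>\<^sup>2" using vH by (intro mult_right_mono) auto
      finally show "\<bar>v * a\<^sup>2 / 2\<bar> \<le> ?H\<^sup>2 * \<bar>a\<bar>\<^sup>2" .
    qed simp_all
    also have "\<dots> = 2 * ?H ^ 3 * \<bar>a\<bar> ^ 3" by (simp add: power2_eq_square power3_eq_cube)
    also have "\<dots> \<le> 2 * ?H ^ 5 * \<bar>a\<bar> ^ 3" using Hp[of 3] a3 by (intro mult_right_mono mult_left_mono) auto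
    finally show ?thesis .
  qed
  also have "norm (of_real R3 * Q) \<le> 3 * ?H ^ 5 * \<bar>a\<bar> ^ 3"
  proof -
    have "norm (of_real R3 * Q) \<le> (?H ^ 4 * \<bar>a\<bar> ^ 3) * (3 * ?H)"
      unfolding norm_mult norm_of_real using a3 H by (intro mult_mono n3 nQ) auto
    then show ?thesis by (simp add: eval_nat_numeral mult_ac)
  qed
  also have "norm (of_real (w * g) * R2) \<le> ?H ^ 5 * \<bar>a\<bar> ^ 3"
  proof -
    have "w * g \<le> 1 * ?H" using w g by (intro mult_mono) auto
    also have "\<dots> \<le> ?H ^ 5" using Hp[of 1] by simp
    finally show ?thesis unfolding norm_mult norm_of_real using w g n2 by (intro mult_mono) auto
  qed
  \<comment> \<open>7 = 1 + 2 + 3 + 1, one contribution for each of the four terms.\<close>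
  finally have "norm (cis (- (g * a)) - of_real w * D) \<le> 7 * (?H ^ 5 * \<bar>a\<bar> ^ 3)"
    using n1 by (simp add: algebra_simps)
  moreover have "cis (- (g * a)) * geom_char g a - of_real w = (cis (- (g * a)) - of_real w * D) / D"
  proof -
    have "geom_char g a = 1 / D" by (simp only: geom_char_def D_def)
    then show ?thesis using D0 by (simp add: field_simps)
  qed
  then have "norm (cis (- (g * a)) * geom_char g a - of_real w) \<le> norm (cis (- (g * a)) - of_real w * D) / 1"
    by (simp only: norm_divide) (rule frac_le, use D1 in auto)
  moreover have "7 * (?H ^ 5 * \<bar>a\<bar> ^ 3) \<le> 20 * ?H ^ 5 * \<bar>a\<bar> ^ 3"
    using H a3 by (simp add: mult_right_mono)
  ultimately show ?thesis unfolding w_def v_def by linarith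
qed

section \<open>Riemann sums and Gaussian integrals\<close>

lemma real_derivative_mvt_within:
  fixes f f' :: "real \<Rightarrow> real"
  assumes "a \<le> b" "\<And>x. x \<in> {a..b} \<Longrightarrow> (f has_real_derivative f' x) (at x within {a..b})"
  obtains z where "z \<in> {a..b}" "f b - f a = f' z * (b - a)"
  using mvt_very_simple[OF assms(1), of f "\<lambda>x. (*) (f' x)"] assms(2)
  by (auto simp: has_field_derivative_def)

lemma left_rule_error:
  fixes F f f' :: "real \<Rightarrow> real"
  assumes "a \<le> b"
    and F: "\<And>x. x \<in> {a..b} \<Longrightarrow> (F has_real_derivative f x) (at x within {a..b})"
    and f: "\<And>x. x \<in> {a..b} \<Longrightarrow> (f has_real_derivative f' x) (at x within {a..b})"
    and L: "\<And>x. x \<in> {a..b} \<Longrightarrow> \<bar>f' x\<bar> \<le> L"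
  shows "\<bar>F b - F a - (b - a) * f a\<bar> \<le> L * (b - a)\<^sup>2"
proof -
  obtain z where z: "z \<in> {a..b}" "F b - F a = f z * (b - a)"
    using real_derivative_mvt_within[OF assms(1) F] by metis
  have az: "a \<le> z" "{a..z} \<subseteq> {a..b}" using z by auto
  obtain y where y: "y \<in> {a..z}" "f z - f a = f' y * (z - a)"
    using real_derivative_mvt_within[OF az(1), of f f'] f DERIV_subset[OF _ az(2)] az(2) by (metis subsetD)
  have "\<bar>f z - f a\<bar> \<le> L * (b - a)"
    unfolding y(2) abs_mult using y z az L[of y] by (intro mult_mono) auto
  then have "\<bar>f z - f a\<bar> * (b - a) \<le> L * (b - a) * (b - a)"
    using assms(1) by (intro mult_right_mono) auto
  moreover have "F b - F a - (b - a) * f a = (f z - f a) * (b - a)"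
    unfolding z(2) by (simp add: algebra_simps)
  ultimately show ?thesis using assms(1) by (simp add: abs_mult power2_eq_square)
qed

text \<open>The error \<open>E\<close> as a function of the right end point vanishes at a and has
  derivative (f x - f a - (x - a) f' x) / 2. The mean value theorem for \<open>E\<close>, then f,
  then f' gives three powers of b - a; the optimal constant is not sought.\<close>

lemma trapezoid_rule_error:
  fixes F f f' f'' :: "real \<Rightarrow> real"
  assumes "a \<le> b"
    and F: "\<And>x. x \<in> {a..b} \<Longrightarrow> (F has_real_derivative f x) (at x within {a..b})"
    and f: "\<And>x. x \<in> {a..b} \<Longrightarrow> (f has_real_derivative f' x) (at x within {a..b})"
    and f': "\<And>x. x \<in> {a..b} \<Longrightarrow> (f' has_real_derivative f'' x) (at x within {a..b})"
    and L: "\<And>x. x \<in> {a..b} \<Longrightarrow> \<bar>f'' x\<bar> \<le> L"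
  shows "\<bar>F b - F a - (b - a) * ((f a + f b) / 2)\<bar> \<le> L * (b - a) ^ 3"
proof -
  define E where "E = (\<lambda>x. F x - F a - (x - a) * ((f a + f x) / 2))"
  have dE: "(E has_real_derivative f x - ((f a + f x) / 2 + (x - a) * (f' x / 2))) (at x within {a..b})"
    if "x \<in> {a..b}" for x
    unfolding E_def using F[OF that] f[OF that] by (auto intro!: derivative_eq_intros simp: field_simps)
  obtain z where z: "z \<in> {a..b}" "E b - E a = (f z - ((f a + f z) / 2 + (z - a) * (f' z / 2))) * (b - a)"
    using real_derivative_mvt_within[OF assms(1) dE] by blast
  have az: "a \<le> z" "{a..z} \<subseteq> {a..b}" using z by auto
  obtain y where y: "y \<in> {a..z}" "f z - f a = f' y * (z - a)"
    using real_derivative_mvt_within[OF az(1), of f f'] f DERIV_subset[OF _ az(2)] az(2) by (metis subsetD)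
  have yz: "y \<le> z" "{y..z} \<subseteq> {a..b}" using y z by auto
  obtain x where x: "x \<in> {y..z}" "f' z - f' y = f'' x * (z - y)"
    using real_derivative_mvt_within[OF yz(1), of f' f''] f' DERIV_subset[OF _ yz(2)] yz(2) by (metis subsetD)
  have L0: "0 \<le> L" using L[OF z(1)] by simp
  have "\<bar>f' z - f' y\<bar> \<le> L * (b - a)"
    unfolding x(2) abs_mult using x y z L[of x] by (intro mult_mono) auto
  then have "\<bar>f' z - f' y\<bar> * (z - a) \<le> L * (b - a) * (b - a)"
    using z L0 by (intro mult_mono) auto
  moreover have "f z - ((f a + f z) / 2 + (z - a) * (f' z / 2)) = - ((f' z - f' y) * (z - a)) / 2"
    using y(2) by (simp add: field_simps)
  then have "\<bar>f z - ((f a + f z) / 2 + (z - a) * (f' z / 2))\<bar> = \<bar>f' z - f' y\<bar> * (z - a) / 2"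
    using z by (simp add: abs_mult)
  ultimately have "\<bar>f z - ((f a + f z) / 2 + (z - a) * (f' z / 2))\<bar> \<le> L * (b - a) * (b - a) / 2"
    by simp
  also have "\<dots> \<le> L * (b - a) * (b - a)" using L0 assms(1) by simp
  finally have "\<bar>E b - E a\<bar> \<le> L * (b - a) * (b - a) * (b - a)"
    unfolding z(2) abs_mult using assms(1) by (simp add: mult_right_mono)
  then show ?thesis by (simp add: E_def power3_eq_cube)
qed

lemma unit_grid:
  assumes "0 < m" "j < m"
  shows "real j / real m \<le> real (Suc j) / real m" "{real j / real m..real (Suc j) / real m} \<subseteq> {0..1}"
    "real (Suc j) / real m - real j / real m = 1 / real m"
  using assms by (auto simp: field_simps Suc_le_eq intro: order_trans)

lemma integral_telescope:
  fixes f :: "real \<Rightarrow> real"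
  assumes "0 < m" "continuous_on {0..1} f"
  defines "F \<equiv> \<lambda>x. integral {0..x} f"
  shows "\<And>x. x \<in> {0..1} \<Longrightarrow> (F has_real_derivative f x) (at x within {0..1})"
    and "integral {0..1} f = (\<Sum>j<m. F (real (Suc j) / real m) - F (real j / real m))"
proof -
  show "(F has_real_derivative f x) (at x within {0..1})" if "x \<in> {0..1}" for x
    unfolding F_def using assms(2) that by (rule integral_has_real_derivative)
  have "(\<Sum>j<m. F (real (Suc j) / real m) - F (real j / real m)) = F (real m / real m) - F (real 0 / real m)"
    by (rule sum_lessThan_telescope)
  then show "integral {0..1} f = (\<Sum>j<m. F (real (Suc j) / real m) - F (real j / real m))"
    using assms(1) by (simp add: F_def)
qed

text \<open>Each of the m cells contributes L / m; \<open>\<bar>f 1\<bar>\<close> pays for the extra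
  node j = m.\<close>

lemma riemann_sum_error:
  fixes f f' :: "real \<Rightarrow> real"
  assumes m: "0 < m"
    and f: "\<And>x. x \<in> {0..1} \<Longrightarrow> (f has_real_derivative f' x) (at x within {0..1})"
    and L: "\<And>x. x \<in> {0..1} \<Longrightarrow> \<bar>f' x\<bar> \<le> L"
  shows "\<bar>(\<Sum>j<Suc m. f (real j / real m)) - real m * integral {0..1} f\<bar> \<le> L + \<bar>f 1\<bar>"
proof -
  have cont: "continuous_on {0..1} f"
    using f by (rule DERIV_continuous_on)
  define F where "F = (\<lambda>x. integral {0..x} f)"
  have F: "\<And>x. x \<in> {0..1} \<Longrightarrow> (F has_real_derivative f x) (at x within {0..1})"
    "integral {0..1} f = (\<Sum>j<m. F (real (Suc j) / real m) - F (real j / real m))"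
    unfolding F_def using integral_telescope[OF m cont] by auto
  have step: "\<bar>f (real j / real m) - real m * (F (real (Suc j) / real m) - F (real j / real m))\<bar> \<le> L / real m"
    if "j < m" for j
  proof -
    note g = unit_grid[OF m that]
    have "\<bar>F (real (Suc j) / real m) - F (real j / real m) - (1 / real m) * f (real j / real m)\<bar> \<le> L * (1 / real m)\<^sup>2"
      unfolding g(3)[symmetric]
    proof (rule left_rule_error[OF g(1)])
      fix x assume "x \<in> {real j / real m..real (Suc j) / real m}"
      then have x: "x \<in> {0..1}" using g(2) by (rule subsetD[rotated])
      show "(F has_real_derivative f x) (at x within {real j / real m..real (Suc j) / real m})"
        by (rule DERIV_subset[OF F(1)[OF x] g(2)])
      show "(f has_real_derivative f' x) (at x within {real j / real m..real (Suc j) / real m})"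
        by (rule DERIV_subset[OF f[OF x] g(2)])
      show "\<bar>f' x\<bar> \<le> L" by (rule L[OF x])
    qed
    then have "real m * \<bar>F (real (Suc j) / real m) - F (real j / real m) - (1 / real m) * f (real j / real m)\<bar>
        \<le> real m * (L * (1 / real m)\<^sup>2)" by (intro mult_left_mono) auto
    then have "\<bar>real m * (F (real (Suc j) / real m) - F (real j / real m) - (1 / real m) * f (real j / real m))\<bar>
        \<le> L / real m" using m by (simp add: abs_mult power2_eq_square)
    moreover have "real m * (F (real (Suc j) / real m) - F (real j / real m) - (1 / real m) * f (real j / real m))
      = - (f (real j / real m) - real m * (F (real (Suc j) / real m) - F (real j / real m)))"
      using m by (simp add: right_diff_distrib)
    ultimately show ?thesis by (simp only: abs_minus_cancel)
  qed
  have "\<bar>(\<Sum>j<m. f (real j / real m)) - real m * integral {0..1} f\<bar>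
      = \<bar>\<Sum>j<m. f (real j / real m) - real m * (F (real (Suc j) / real m) - F (real j / real m))\<bar>"
    unfolding F(2) sum_distrib_left by (simp only: sum_subtractf)
  also have "\<dots> \<le> (\<Sum>j<m. L / real m)"
    by (rule order_trans[OF sum_abs]) (intro sum_mono step, simp)
  also have "\<dots> = L" using m by simp
  finally show ?thesis using m by simp
qed

text \<open>The cell errors L / m^2 add up to L / m. Unlike a bounded error, this one disappears
  after exponentiation.\<close>

lemma trapezoid_sum_error:
  fixes f f' f'' :: "real \<Rightarrow> real"
  assumes m: "0 < m"
    and f: "\<And>x. x \<in> {0..1} \<Longrightarrow> (f has_real_derivative f' x) (at x within {0..1})"
    and f': "\<And>x. x \<in> {0..1} \<Longrightarrow> (f' has_real_derivative f'' x) (at x within {0..1})"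
    and L: "\<And>x. x \<in> {0..1} \<Longrightarrow> \<bar>f'' x\<bar> \<le> L"
  shows "\<bar>(\<Sum>j<Suc m. f (real j / real m)) - (f 0 + f 1) / 2 - real m * integral {0..1} f\<bar> \<le> L / real m"
proof -
  have cont: "continuous_on {0..1} f"
    using f by (rule DERIV_continuous_on)
  define F where "F = (\<lambda>x. integral {0..x} f)"
  have F: "\<And>x. x \<in> {0..1} \<Longrightarrow> (F has_real_derivative f x) (at x within {0..1})"
    "integral {0..1} f = (\<Sum>j<m. F (real (Suc j) / real m) - F (real j / real m))"
    unfolding F_def using integral_telescope[OF m cont] by auto
  define S where "S = (\<lambda>j. (f (real j / real m) + f (real (Suc j) / real m)) / 2)"
  have step: "\<bar>S j - real m * (F (real (Suc j) / real m) - F (real j / real m))\<bar> \<le> L / (real m)\<^sup>2"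
    if "j < m" for j
  proof -
    note g = unit_grid[OF m that]
    have "\<bar>F (real (Suc j) / real m) - F (real j / real m) - (1 / real m) * S j\<bar> \<le> L * (1 / real m) ^ 3"
      unfolding g(3)[symmetric] S_def
    proof (rule trapezoid_rule_error[OF g(1)])
      fix x assume "x \<in> {real j / real m..real (Suc j) / real m}"
      then have x: "x \<in> {0..1}" using g(2) by (rule subsetD[rotated])
      show "(F has_real_derivative f x) (at x within {real j / real m..real (Suc j) / real m})"
        by (rule DERIV_subset[OF F(1)[OF x] g(2)])
      show "(f has_real_derivative f' x) (at x within {real j / real m..real (Suc j) / real m})"
        by (rule DERIV_subset[OF f[OF x] g(2)])
      show "(f' has_real_derivative f'' x) (at x within {real j / real m..real (Suc j) / real m})"
        by (rule DERIV_subset[OF f'[OF x] g(2)])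
      show "\<bar>f'' x\<bar> \<le> L" by (rule L[OF x])
    qed
    then have "real m * \<bar>F (real (Suc j) / real m) - F (real j / real m) - (1 / real m) * S j\<bar>
        \<le> real m * (L * (1 / real m) ^ 3)" by (intro mult_left_mono) auto
    then have "\<bar>real m * (F (real (Suc j) / real m) - F (real j / real m) - (1 / real m) * S j)\<bar>
        \<le> L / (real m)\<^sup>2" using m by (simp add: abs_mult power2_eq_square power3_eq_cube)
    moreover have "real m * (F (real (Suc j) / real m) - F (real j / real m) - (1 / real m) * S j)
      = - (S j - real m * (F (real (Suc j) / real m) - F (real j / real m)))"
      using m by (simp add: right_diff_distrib)
    ultimately show ?thesis by (simp only: abs_minus_cancel)
  qed
  have S: "(\<Sum>j<k. S j) = (\<Sum>j<Suc k. f (real j / real m)) - (f 0 + f (real k / real m)) / 2" for k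
    by (induction k) (auto simp: S_def field_simps)
  have "\<bar>(\<Sum>j<m. S j) - real m * integral {0..1} f\<bar>
      = \<bar>\<Sum>j<m. S j - real m * (F (real (Suc j) / real m) - F (real j / real m))\<bar>"
    unfolding F(2) sum_distrib_left by (simp only: sum_subtractf)
  also have "\<dots> \<le> (\<Sum>j<m. L / (real m)\<^sup>2)"
    by (rule order_trans[OF sum_abs]) (intro sum_mono step, simp)
  also have "\<dots> = L / real m" using m by (simp add: power2_eq_square)
  finally show ?thesis unfolding S using m by simp
qed

lemma bose_var_affine_derivative:
  assumes "0 < c" "0 \<le> d" "t \<in> {0..1}"
  shows "((\<lambda>t. bose_var (c + d * t)) has_real_derivative
    - (bose_var (c + d * t) * (1 + 2 * bose (c + d * t)) * d)) (at t within S)"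
proof -
  have "((\<lambda>t. bose (c + d * t) * (1 + bose (c + d * t))) has_real_derivative
      (- bose_var (c + d * t) * d) * (1 + bose (c + d * t)) + (0 + (- bose_var (c + d * t) * d)) * bose (c + d * t)) (at t within S)"
    by (intro DERIV_mult DERIV_add DERIV_const bose_affine_derivative assms)
  then show ?thesis
    unfolding bose_var_def[of "c + d * x" for x] by (rule DERIV_cong) (simp add: bose_var_def algebra_simps)
qed

text \<open>One constant serves all admissible c and d, since \<open>bose\<close> and
  \<open>bose_var\<close> are largest at \<open>c0\<close>. The first three sums enter after
  division by at least sqrt m, so bounded errors suffice; the logarithmic sum is exponentiated and
  needs the end-point correction.\<close>

lemma riemann_bounds:
  assumes c0: "0 < c0"
  obtains R where "0 \<le> R"
    "\<And>c d m. \<lbrakk>c0 \<le> c; 0 \<le> d; d \<le> M; 0 < m\<rbrakk> \<Longrightarrow>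
       \<bar>(\<Sum>j<Suc m. bose (c + d * (real j / real m))) - real m * moment0 c d\<bar> \<le> R"
    "\<And>c d m. \<lbrakk>c0 \<le> c; 0 \<le> d; d \<le> M; 0 < m\<rbrakk> \<Longrightarrow>
       \<bar>(\<Sum>j<Suc m. real j / real m * bose (c + d * (real j / real m))) - real m * moment1 c d\<bar> \<le> R"
    "\<And>c d m k. \<lbrakk>c0 \<le> c; 0 \<le> d; d \<le> M; 0 < m; k \<le> 2\<rbrakk> \<Longrightarrow>
       \<bar>(\<Sum>j<Suc m. (real j / real m) ^ k * bose_var (c + d * (real j / real m))) - real m * variance_integral k c d\<bar> \<le> R"
    "\<And>c d m. \<lbrakk>c0 \<le> c; 0 \<le> d; d \<le> M; 0 < m\<rbrakk> \<Longrightarrow>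
       \<bar>(\<Sum>j<Suc m. ln (1 - exp (- (c + d * (real j / real m)))))
          - (ln (1 - exp (- c)) + ln (1 - exp (- (c + d)))) / 2
          - real m * (ln (1 - exp (- (c + d))) - d * moment1 c d)\<bar> \<le> R / real m"
\<comment> \<open>For negative \<open>M\<close> no d is admissible and the claims are
  vacuous.\<close>
proof (cases "0 \<le> M")
  case False
  then show ?thesis using that[of 0] by fastforce
next
  case M: True
  define G V where "G = bose c0" and "V = bose_var c0"
  have GV: "0 < G" "0 < V" using c0 by (auto simp: G_def V_def bose_pos bose_var_pos)
  have b: "\<bar>bose (c + d * t)\<bar> \<le> G" "\<bar>bose_var (c + d * t)\<bar> \<le> V" "0 < c"
    if "c0 \<le> c" "0 \<le> d" "t \<in> {0..1}" for c d t
  proof -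
    have "c \<le> c + d * t" using that by (intro affine_in_interval(1))
    then have "c0 \<le> c + d * t" using that(1) by linarith
    then show "\<bar>bose (c + d * t)\<bar> \<le> G" "\<bar>bose_var (c + d * t)\<bar> \<le> V" "0 < c"
      using bose_antimono[OF c0, of "c + d * t"] bose_var_antimono[OF c0, of "c + d * t"]
        bose_pos[of "c + d * t"] bose_var_pos[of "c + d * t"] c0 that by (auto simp: G_def V_def)
  qed
  define R where "R = 3 * G + 3 * V + V * M + V * (1 + 2 * G) * M + V * M * M"
  have R: "0 \<le> R" using GV M by (simp add: R_def)
  have nn: "0 \<le> V * M" "0 \<le> V * (1 + 2 * G) * M" "0 \<le> V * M * M" using GV M by simp_all
  show ?thesis
  proof (rule that[OF R], goal_cases)
    case (1 c d m)
    have "\<bar>(\<Sum>j<Suc m. bose (c + d * (real j / real m))) - real m * moment0 c d\<bar> \<le> V * M + \<bar>bose (c + d * 1)\<bar>"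
      unfolding moment0_def
    proof (rule riemann_sum_error)
      fix x :: real assume x: "x \<in> {0..1}"
      show "((\<lambda>t. bose (c + d * t)) has_real_derivative - bose_var (c + d * x) * d) (at x within {0..1})"
        using 1 x b by (intro bose_affine_derivative) auto
      show "\<bar>- bose_var (c + d * x) * d\<bar> \<le> V * M"
        unfolding abs_mult abs_minus_cancel using 1 x b[of c d x] GV by (intro mult_mono) auto
    qed (use 1 in auto)
    also have "\<bar>bose (c + d * 1)\<bar> \<le> G" using b(1)[of c d 1] 1 by simp
    finally show ?case using nn GV unfolding R_def by linarith
  next
    case (2 c d m)
    have "\<bar>(\<Sum>j<Suc m. real j / real m * bose (c + d * (real j / real m))) - real m * moment1 c d\<bar>
        \<le> (G + V * M) + \<bar>bose (c + d * 1)\<bar>"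
      unfolding moment1_def
    proof (rule riemann_sum_error[of m "\<lambda>t. t * bose (c + d * t)", unfolded mult_1])
      fix x :: real assume x: "x \<in> {0..1}"
      show "((\<lambda>t. t * bose (c + d * t)) has_real_derivative 1 * bose (c + d * x) + (- bose_var (c + d * x) * d) * x) (at x within {0..1})"
        using 2 x b by (intro DERIV_mult DERIV_ident bose_affine_derivative) auto
      have "\<bar>- bose_var (c + d * x) * d * x\<bar> \<le> V * M * 1"
        unfolding abs_mult abs_minus_cancel using 2 x b[of c d x] GV M by (intro mult_mono) auto
      then show "\<bar>1 * bose (c + d * x) + (- bose_var (c + d * x) * d) * x\<bar> \<le> G + V * M"
        using b(1)[of c d x] 2 x by linarith
    qed (use 2 in auto)
    also have "\<bar>bose (c + d * 1)\<bar> \<le> G" using b(1)[of c d 1] 2 by simp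
    finally show ?case using nn GV unfolding R_def by linarith
  next
    case (3 c d m k)
    have "\<bar>(\<Sum>j<Suc m. (real j / real m) ^ k * bose_var (c + d * (real j / real m))) - real m * variance_integral k c d\<bar>
        \<le> (2 * V + V * (1 + 2 * G) * M) + \<bar>bose_var (c + d * 1)\<bar>"
      unfolding variance_integral_def
    proof (rule riemann_sum_error[of m "\<lambda>t. t ^ k * bose_var (c + d * t)", unfolded mult_1 power_one])
      fix x :: real assume x: "x \<in> {0..1}"
      let ?D = "(bose_var (c + d * x) * (1 + 2 * bose (c + d * x)) * d)"
      show "((\<lambda>t. t ^ k * bose_var (c + d * t)) has_real_derivative
          (real k * x ^ (k - Suc 0)) * bose_var (c + d * x) + (- ?D) * x ^ k) (at x within {0..1})"
        using 3 x b by (intro DERIV_mult DERIV_pow bose_var_affine_derivative) auto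
      have "\<bar>real k * x ^ (k - Suc 0)\<bar> \<le> 2 * 1"
        unfolding abs_mult power_abs using x 3 by (intro mult_mono power_le_one) auto
      then have "\<bar>(real k * x ^ (k - Suc 0)) * bose_var (c + d * x)\<bar> \<le> 2 * V"
        unfolding abs_mult[of "real k * x ^ (k - Suc 0)"] using b(2)[of c d x] 3 x by (intro mult_mono) auto
      moreover have "\<bar>?D * x ^ k\<bar> \<le> V * (1 + 2 * G) * M * 1"
        unfolding abs_mult power_abs using 3 x b[of c d x] GV M
        by (intro mult_mono power_le_one) auto
      ultimately show "\<bar>(real k * x ^ (k - Suc 0)) * bose_var (c + d * x) + (- ?D) * x ^ k\<bar> \<le> 2 * V + V * (1 + 2 * G) * M"
        by (simp only: mult_minus_left)
    qed (use 3 in auto)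
    also have "\<bar>bose_var (c + d * 1)\<bar> \<le> V" using b(2)[of c d 1] 3 by simp
    finally show ?case using nn GV unfolding R_def by linarith
  next
    case (4 c d m)
    define f where "f = (\<lambda>t. ln (1 - exp (- (c + d * t))))"
    have c: "0 < c" using 4 c0 by simp
    have I: "integral {0..1} f = ln (1 - exp (- (c + d))) - d * moment1 c d"
      unfolding f_def by (rule integral_unique[OF ln_one_minus_exp_has_integral[OF c 4(2)]])
    have "\<bar>(\<Sum>j<Suc m. f (real j / real m)) - (f 0 + f 1) / 2 - real m * integral {0..1} f\<bar> \<le> (V * M * M) / real m"
    proof (rule trapezoid_sum_error)
      fix x :: real assume x: "x \<in> {0..1}"
      show "(f has_real_derivative bose (c + d * x) * d) (at x within {0..1})"
        unfolding f_def using c 4 x by (intro ln_one_minus_exp_affine_derivative) auto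
      show "((\<lambda>x. bose (c + d * x) * d) has_real_derivative (- bose_var (c + d * x) * d) * d) (at x within {0..1})"
        using c 4 x by (intro DERIV_cmult_right bose_affine_derivative) auto
      show "\<bar>- bose_var (c + d * x) * d * d\<bar> \<le> V * M * M"
        unfolding abs_mult abs_minus_cancel using 4 x b[of c d x] GV M by (intro mult_mono) auto
    qed (use 4 in auto)
    also have "\<dots> \<le> R / real m" using GV M by (intro divide_right_mono) (auto simp: R_def)
    finally show ?case unfolding I by (simp add: f_def)
  qed
qed

section \<open>The limiting covariance form\<close>

definition variance_form :: "real \<Rightarrow> real \<Rightarrow> real \<Rightarrow> real \<Rightarrow> real" where
  "variance_form c d u w = variance_integral 0 c d * u\<^sup>2 + variance_integral 1 c d * (2 * (u * w))
     + variance_integral 2 c d * w\<^sup>2"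

definition variance_det :: "real \<Rightarrow> real \<Rightarrow> real" where
  "variance_det c d = variance_integral 0 c d * variance_integral 2 c d - (variance_integral 1 c d)\<^sup>2"

text \<open>The form is the integral of \<open>bose_var (c + d * t)\<close> times (u + w t)^2;
  bounding the weight below by \<open>bose_var M\<close> leaves
  \<open>quadratic_form_lower\<close>.\<close>

lemma variance_form_ge:
  assumes "0 < c" "0 \<le> d" "c + d \<le> M"
  shows "bose_var M / 16 * (u\<^sup>2 + w\<^sup>2) \<le> variance_form c d u w"
proof -
  note I = variance_has_integral[OF assms(1,2)]
  have "((\<lambda>t. (t ^ 0 * bose_var (c + d * t)) * u\<^sup>2 + (t ^ 1 * bose_var (c + d * t)) * (2 * (u * w))
      + (t ^ 2 * bose_var (c + d * t)) * w\<^sup>2) has_integral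
      variance_integral 0 c d * u\<^sup>2 + variance_integral 1 c d * (2 * (u * w)) + variance_integral 2 c d * w\<^sup>2) {0..1}"
    by (intro has_integral_add has_integral_mult_left I)
  then have J: "((\<lambda>t. bose_var (c + d * t) * (u + w * t)\<^sup>2) has_integral variance_form c d u w) {0..1}"
    unfolding variance_form_def
    by (rule has_integral_eq[rotated]) (simp add: power2_eq_square algebra_simps)
  have v: "0 < bose_var M" using assms by (intro bose_var_pos) auto
  have "bose_var M * (u\<^sup>2 + u * w + w\<^sup>2 / 3) \<le> variance_form c d u w"
  proof (rule has_integral_le[OF has_integral_mult_right[OF integral_affine_square] J])
    fix t :: real assume t: "t \<in> {0..1}"
    have "bose_var M \<le> bose_var (c + d * t)"
      using affine_in_interval[OF assms(2) t, of c] assms by (intro bose_var_antimono) auto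
    then show "bose_var M * (u + w * t)\<^sup>2 \<le> bose_var (c + d * t) * (u + w * t)\<^sup>2"
      by (intro mult_right_mono) auto
  qed
  moreover have "bose_var M * ((u\<^sup>2 + w\<^sup>2) / 16) \<le> bose_var M * (u\<^sup>2 + u * w + w\<^sup>2 / 3)"
    using v by (intro mult_left_mono quadratic_form_lower) auto
  ultimately show ?thesis by simp
qed

lemma variance_pos:
  assumes "0 < c" "0 \<le> d"
  shows "0 < variance_integral 0 c d" "0 < variance_det c d"
proof -
  have v: "0 < bose_var (c + d)" using assms by (intro bose_var_pos) auto
  note ge = variance_form_ge[OF assms order_refl]
  have "0 < bose_var (c + d) / 16 * (1\<^sup>2 + 0\<^sup>2)" using v by simp
  also have "\<dots> \<le> variance_integral 0 c d" using ge[of 1 0] by (simp add: variance_form_def)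
  finally show 0: "0 < variance_integral 0 c d" .
  have "0 < bose_var (c + d) / 16 * ((variance_integral 1 c d)\<^sup>2 + (variance_integral 0 c d)\<^sup>2)"
    using v 0 by (intro mult_pos_pos add_nonneg_pos) auto
  \<comment> \<open>At the vector (- V1, V0) the form takes the value V0 times the
    determinant.\<close>
  also have "\<dots> \<le> variance_integral 0 c d * variance_det c d"
    using ge[of "- variance_integral 1 c d" "variance_integral 0 c d"]
    by (simp add: variance_form_def variance_det_def power2_eq_square algebra_simps)
  finally show "0 < variance_det c d" using 0 by (simp add: zero_less_mult_iff)
qed

lemma variance_det_le:
  assumes "0 < c0" "c0 \<le> c" "0 \<le> d"
  shows "variance_det c d \<le> (bose_var c0)\<^sup>2"
proof -
  have c: "0 < c" using assms by simp
  have le: "variance_integral k c d \<le> bose_var c0" for k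
  proof -
    have "variance_integral k c d \<le> bose_var c0 * (1 - 0)"
    proof (rule has_integral_le[OF variance_has_integral[OF c assms(3)]])
      show "((\<lambda>t. bose_var c0) has_integral bose_var c0 * (1 - 0)) {0..1 :: real}"
        using has_integral_const_real[of "bose_var c0" 0 1] by simp
      fix t :: real assume t: "t \<in> {0..1}"
      have "c0 \<le> c + d * t" using affine_in_interval(1)[OF assms(3) t, of c] assms by simp
      then have "bose_var (c + d * t) \<le> bose_var c0" "0 < bose_var (c + d * t)"
        using assms by (auto intro!: bose_var_antimono bose_var_pos)
      then have "t ^ k * bose_var (c + d * t) \<le> 1 * bose_var c0"
        using t by (intro mult_mono power_le_one) auto
      then show "t ^ k * bose_var (c + d * t) \<le> bose_var c0" by simp
    qed
    then show ?thesis by simp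
  qed
  have v: "0 < bose_var c0" using assms by (intro bose_var_pos)
  have "variance_integral 0 c d * variance_integral 2 c d \<le> variance_integral 0 c d * bose_var c0"
    using variance_pos(1)[OF c assms(3)] by (intro mult_left_mono le) auto
  also have "\<dots> \<le> bose_var c0 * bose_var c0" using v by (intro mult_right_mono le) auto
  finally show ?thesis by (simp add: variance_det_def power2_eq_square) (smt (verit) zero_le_square)
qed

section \<open>Gaussian integrals and the integrable majorant\<close>

lemma gaussian_integral_1d:
  fixes a b :: real
  assumes "0 < a"
  shows "has_bochner_integral lborel (\<lambda>x. exp (- (a * (x + b)\<^sup>2 / 2))) (sqrt (2 * pi / a))"
proof -
  have s: "0 < 1 / sqrt a" using assms by simp
  have "has_bochner_integral lborel (normal_density (- b) (1 / sqrt a)) 1"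
    using integrable_normal_density[OF s] integral_normal_density[OF s] by (simp add: has_bochner_integral_iff)
  then have "has_bochner_integral lborel (\<lambda>x. sqrt (2 * pi / a) * normal_density (- b) (1 / sqrt a) x) (sqrt (2 * pi / a) * 1)"
    by (intro has_bochner_integral_mult_right)
  moreover have "sqrt (2 * pi / a) * normal_density (- b) (1 / sqrt a) x = exp (- (a * (x + b)\<^sup>2 / 2))" for x
    unfolding normal_density_def using assms by (simp add: power_divide field_simps)
  ultimately show ?thesis by simp
qed

text \<open>Completing the square in the first variable and integrating it out first leaves a
  centred Gaussian with coefficient (V0 V2 - V1^2) / V0.\<close>

lemma gaussian_integral_2d:
  fixes V0 V1 V2 :: real
  assumes "0 < V0" "0 < V0 * V2 - V1\<^sup>2"
    and int: "integrable lborel (\<lambda>p. exp (- ((V0 * (fst p)\<^sup>2 + 2 * V1 * (fst p * snd p) + V2 * (snd p)\<^sup>2) / 2)))"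
  shows "(\<integral>p. exp (- ((V0 * (fst p)\<^sup>2 + 2 * V1 * (fst p * snd p) + V2 * (snd p)\<^sup>2) / 2)) \<partial>lborel)
    = 2 * pi / sqrt (V0 * V2 - V1\<^sup>2)"
proof -
  let ?D = "V0 * V2 - V1\<^sup>2"
  let ?f = "\<lambda>u w. exp (- ((V0 * u\<^sup>2 + 2 * V1 * (u * w) + V2 * w\<^sup>2) / 2))"
  have split: "?f u w = exp (- (V0 * (u + V1 / V0 * w)\<^sup>2 / 2)) * exp (- (?D / V0 * (w + 0)\<^sup>2 / 2))" for u w
    unfolding exp_add[symmetric] using assms(1) by (simp add: field_simps power2_eq_square)
  have "(\<integral>p. ?f (fst p) (snd p) \<partial>lborel) = (\<integral>p. (case p of (u, w) \<Rightarrow> ?f u w) \<partial>(lborel \<Otimes>\<^sub>M lborel))"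
    by (simp add: lborel_prod case_prod_beta')
  also have "\<dots> = (\<integral>w. (\<integral>u. ?f u w \<partial>lborel) \<partial>lborel)"
    using int by (intro lborel_pair.integral_snd[symmetric]) (simp add: lborel_prod case_prod_beta')
  also have "\<dots> = (\<integral>w. sqrt (2 * pi / V0) * exp (- (?D / V0 * (w + 0)\<^sup>2 / 2)) \<partial>lborel)"
    unfolding split using gaussian_integral_1d[OF assms(1)] by (simp add: has_bochner_integral_iff)
  also have "\<dots> = sqrt (2 * pi / V0) * sqrt (2 * pi / (?D / V0))"
    using gaussian_integral_1d[of "?D / V0" 0] assms by (simp add: has_bochner_integral_iff)
  also have "\<dots> = sqrt ((2 * pi)\<^sup>2 / ?D)"
    unfolding real_sqrt_mult[symmetric] using assms(1) by (simp add: power2_eq_square)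
  also have "\<dots> = 2 * pi / sqrt ?D" by (simp only: real_sqrt_divide real_sqrt_abs) simp
  finally show ?thesis .
qed

text \<open>The common majorant for dominated convergence. Rational decay is weak enough to be
  matched far from the origin, where only a bound in terms of m is known.\<close>

lemma integrable_product_cauchy:
  "integrable lborel (\<lambda>p :: real \<times> real. 1 / ((1 + (fst p)\<^sup>2) * (1 + (snd p)\<^sup>2)))"
proof -
  have 1: "integrable lborel (\<lambda>x :: real. 1 / (1 + x\<^sup>2))"
    using integrable_inverse_1_plus_square
    by (simp add: set_integrable_def einterval_def inverse_eq_divide)
  have "integrable (lborel \<Otimes>\<^sub>M lborel) (\<lambda>p :: real \<times> real. 1 / ((1 + (fst p)\<^sup>2) * (1 + (snd p)\<^sup>2)))"
  proof (rule lborel_pair.Fubini_integrable)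
    have eq: "norm (1 / ((1 + x\<^sup>2) * (1 + y\<^sup>2))) = 1 / (1 + x\<^sup>2) * (1 / (1 + y\<^sup>2))" for x y :: real
      by (simp add: abs_mult)
    show "integrable lborel (\<lambda>x :: real. \<integral>y. norm (1 / ((1 + (fst (x, y))\<^sup>2) * (1 + (snd (x, y))\<^sup>2))) \<partial>lborel)"
      unfolding fst_conv snd_conv eq Bochner_Integration.integral_mult_right_zero
      by (intro integrable_mult_left 1)
    show "AE x in lborel. integrable lborel (\<lambda>y :: real. 1 / ((1 + (fst (x, y :: real))\<^sup>2) * (1 + (snd (x, y))\<^sup>2)))"
    proof (rule AE_I2)
      fix x :: real
      have "integrable lborel (\<lambda>y :: real. 1 / (1 + x\<^sup>2) * (1 / (1 + y\<^sup>2)))"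
        by (intro integrable_mult_right 1)
      then show "integrable lborel (\<lambda>y :: real. 1 / ((1 + (fst (x, y))\<^sup>2) * (1 + (snd (x, y))\<^sup>2)))" by simp
    qed
  qed measurable
  then show ?thesis by (simp add: lborel_prod)
qed

lemma exp_minus_square_le:
  fixes x k :: real
  assumes "0 < k"
  shows "exp (- (k * x\<^sup>2)) \<le> (1 + 1 / k) / (1 + x\<^sup>2)"
proof -
  have "1 + x\<^sup>2 \<le> (1 + 1 / k) * (1 + k * x\<^sup>2)"
    using assms by (simp add: field_simps)
  also have "\<dots> \<le> (1 + 1 / k) * exp (k * x\<^sup>2)"
    using assms by (intro mult_left_mono exp_ge_add_one_self) auto
  finally have "1 + x\<^sup>2 \<le> (1 + 1 / k) * exp (k * x\<^sup>2)" .
  then show ?thesis by (simp add: exp_minus field_simps add_pos_nonneg)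
qed

section \<open>The rescaled characteristic function\<close>

text \<open>With \<open>c\<close> and \<open>d\<close> the saddle point, \<open>lattice_char m l n c d\<close> is the rescaled characteristic function,
  centred at \<open>(l, n)\<close>, of the sum of independent vectors \<open>(X\<^sub>j, j * X\<^sub>j)\<close> with \<open>X\<^sub>j\<close>
  geometric of mean \<open>bose (c + d * j / m)\<close>, \<open>j \<le> m\<close>.\<close>

definition lattice_char :: "nat \<Rightarrow> nat \<Rightarrow> nat \<Rightarrow> real \<Rightarrow> real \<Rightarrow> real \<times> real \<Rightarrow> complex" where
  "lattice_char m l n c d p =
     cis (- (real l * (fst p / sqrt m) + real n * (snd p / (m * sqrt m)))) *
     (\<Prod>j<Suc m. geom_char (bose (c + d * (real j / real m))) (fst p / sqrt m + real j * (snd p / (m * sqrt m))))"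

text \<open>The characteristic function of a geometric law with ratio exp (-x) is (1 - exp (-x)) /
  (1 - exp (-x + i a)); the lemma is this formula with the ratio expressed by the mean
  \<open>bose x\<close>.\<close>

lemma one_minus_exp_eq_geom_char:
  assumes "0 < x"
  shows "1 - exp (Complex (- x) a) = of_real (1 - exp (- x)) / geom_char (bose x) a"
proof -
  have g: "(1 - exp (- x)) * bose x = exp (- x)"
    using assms by (simp add: bose_def exp_minus field_simps)
  have "exp (Complex (- x) a) = of_real (exp (- x)) * cis a"
    by (simp add: exp_eq_polar)
  moreover have "of_real (1 - exp (- x)) * (1 - of_real (bose x) * (cis a - 1))
      = of_real (1 - exp (- x)) - of_real ((1 - exp (- x)) * bose x) * (cis a - 1)"
    by (simp add: algebra_simps)
  ultimately show ?thesis unfolding g by (simp add: geom_char_def algebra_simps)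
qed

text \<open>Exponential tilting: on the contour with radii exp (-c) and exp (- d / m) the kernel is
  a characteristic function times the inverse of the common probability of all solution
  vectors.\<close>

lemma cauchy_kernel_eq_lattice_char:
  assumes "0 < c" "0 \<le> d" "0 < m"
  shows "cauchy_kernel (Suc m) (int l) (int n) (Complex (- c) (fst p / sqrt m)) (Complex (- (d / m)) (snd p / (m * sqrt m)))
    = of_real (exp (c * l + d * n / m) / (\<Prod>j<Suc m. 1 - exp (- (c + d * (real j / real m))))) * lattice_char m l n c d p"
proof -
  let ?u = "fst p / sqrt m" and ?w = "snd p / (m * sqrt m)"
  have "exp (- (of_int (int l) * Complex (- c) ?u + of_int (int n) * Complex (- (d / m)) ?w))
      = exp (Complex (c * l + d * n / m) (- (real l * ?u + real n * ?w)))"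
    by (rule arg_cong[where f = exp]) (simp add: complex_eq_iff algebra_simps)
  also have "\<dots> = of_real (exp (c * l + d * n / m)) * cis (- (real l * ?u + real n * ?w))"
    by (simp add: exp_eq_polar)
  finally have 1: "exp (- (of_int (int l) * Complex (- c) ?u + of_int (int n) * Complex (- (d / m)) ?w)) = \<dots>" .
  have "1 - exp (Complex (- c) ?u + of_nat j * Complex (- (d / m)) ?w)
      = of_real (1 - exp (- (c + d * (real j / real m)))) / geom_char (bose (c + d * (real j / real m))) (?u + real j * ?w)" for j
  proof -
    have "Complex (- c) ?u + of_nat j * Complex (- (d / m)) ?w = Complex (- (c + d * (real j / real m))) (?u + real j * ?w)"
      by (simp add: complex_eq_iff)
    moreover have "0 < c + d * (real j / real m)" using assms by (intro affine_pos) auto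
    ultimately show ?thesis by (simp only: one_minus_exp_eq_geom_char)
  qed
  then show ?thesis
    unfolding cauchy_kernel_def 1 lattice_char_def by (simp add: prod_dividef del: prod.lessThan_Suc)
qed

lemma geom_char_denominator_nonzero: "0 \<le> g \<Longrightarrow> 1 - of_real g * (cis a - 1) \<noteq> 0"
  using norm_geom_char_denominator_ge_1[of g a] by auto

lemma continuous_on_geom_char [continuous_intros]:
  assumes "0 \<le> g" "continuous_on S f"
  shows "continuous_on S (\<lambda>x. geom_char g (f x))"
  unfolding geom_char_def using assms
  by (intro continuous_intros) (blast dest: geom_char_denominator_nonzero)+

lemma continuous_on_lattice_char:
  assumes "0 < c" "0 \<le> d" "0 < m"
  shows "continuous_on S (lattice_char m l n c d)"
proof -
  have "0 \<le> bose (c + d * (real j / real m))" for j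
    using assms by (intro less_imp_le[OF bose_pos] affine_pos) auto
  then show ?thesis
    unfolding lattice_char_def using assms by (intro continuous_intros) auto
qed

lemma integrable_lattice_char:
  assumes "0 < c" "0 \<le> d" "0 < m"
  shows "integrable lborel (\<lambda>p. indicator (rect s t) p *\<^sub>R lattice_char m l n c d p)"
  by (intro borel_integrable_compact continuous_on_lattice_char assms) simp

lemma box_partition_count_eq_integral:
  assumes "0 < c" "0 \<le> d" "0 < m"
  shows "of_real (4 * pi\<^sup>2 * (real m)\<^sup>2 * real (box_partition_count n l m)) =
    of_real (exp (c * l + d * n / m) / (\<Prod>j<Suc m. 1 - exp (- (c + d * (real j / real m))))) *
    (\<integral>p. indicator (rect (sqrt m) (m * sqrt m)) p *\<^sub>R lattice_char m l n c d p \<partial>lborel)"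
proof -
  have "sqrt m * (m * sqrt m) = (real m)\<^sup>2" by (simp add: power2_eq_square)
  then have "of_real (4 * pi\<^sup>2 * (real m)\<^sup>2 * real (box_partition_count n l m))
      = kernel_integral c (d / m) (sqrt m) (m * sqrt m) (Suc m) (int l) (int n)"
    using assms by (subst kernel_integral_box_partition_count) (auto simp: mult.assoc)
  also have "\<dots> = (\<integral>p. of_real (exp (c * l + d * n / m) / (\<Prod>j<Suc m. 1 - exp (- (c + d * (real j / real m))))) *
      (indicator (rect (sqrt m) (m * sqrt m)) p *\<^sub>R lattice_char m l n c d p) \<partial>lborel)"
    unfolding kernel_integral_def cauchy_kernel_eq_lattice_char[OF assms]
    by (simp only: mult_scaleR_right)
  finally show ?thesis by (simp only: integral_mult_right_zero)
qed

lemma norm_geom_char_le_1: "0 \<le> g \<Longrightarrow> norm (geom_char g a) \<le> 1"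
  using norm_geom_char_denominator_ge_1[of g a] by (simp add: geom_char_def norm_divide divide_le_eq_1)

text \<open>The fourth power compensates m * m^3, the order of (1 + u^2) (1 + w^2) on the
  rectangle.\<close>

lemma exp_minus_le_power4: "0 < x \<Longrightarrow> exp (- x) \<le> (4 / x) ^ 4" for x :: real
proof -
  assume x: "0 < x"
  have "x / 4 \<le> exp (x / 4)" using exp_ge_add_one_self[of "x / 4"] by linarith
  then have "(x / 4) ^ 4 \<le> exp (x / 4) ^ 4" using x by (intro power_mono) auto
  also have "\<dots> = exp x" by (simp flip: exp_of_nat_mult)
  finally show ?thesis using x by (simp add: exp_minus field_simps power_divide)
qed

text \<open>The two alternatives of \<open>sum_one_minus_cos_ge\<close> become exponential decay in
  m, enough since u^2 and w^2 are O(m) and O(m^3) on the rectangle, and Gaussian decay in u and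
  w.\<close>

lemma norm_lattice_char_le:
  assumes M: "0 < M"
  obtains C where "0 \<le> C" "\<And>c d m l n p. \<lbrakk>0 < c; 0 \<le> d; c + d \<le> M; 4 \<le> m; p \<in> rect (sqrt m) (m * sqrt m)\<rbrakk> \<Longrightarrow>
    norm (lattice_char m l n c d p) \<le> C * (1 / ((1 + (fst p)\<^sup>2) * (1 + (snd p)\<^sup>2)))"
proof -
  define k where "k = bose_var M"
  have k: "0 < k" using M by (simp add: k_def bose_var_pos)
  define r where "r = k / (1 + 4 * k)"
  have r: "0 < r" using k by (simp add: r_def)
  define q where "q = r / 60000"
  have q: "0 < q" using r by (simp add: q_def)
  \<comment> \<open>The first summand serves the Gaussian case. In the second, 289 = 17^2 comes from
    1 + pi^2 m <= 17 m and the same bound with m^3.\<close>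
  define C where "C = (1 + 1 / q)\<^sup>2 + 289 * (8 / r) ^ 4"
  have C: "(1 + 1 / q)\<^sup>2 \<le> C" "289 * (8 / r) ^ 4 \<le> C" "0 \<le> C" using r by (auto simp: C_def)
  show ?thesis
  proof (rule that[OF C(3)])
    fix c d m l n p assume c: "0 < c" "0 \<le> d" "c + d \<le> M" and m: "4 \<le> m"
      and p: "p \<in> rect (sqrt (real m)) (real m * sqrt (real m))"
    define u w where "u = fst p" and "w = snd p"
    define x y where "x = u / sqrt m" and "y = w / (m * sqrt m)"
    have sm: "0 < sqrt m" "0 < m * sqrt m" using m by auto
    have uw: "\<bar>u\<bar> \<le> pi * sqrt m" "\<bar>w\<bar> \<le> pi * (m * sqrt m)"
      using p by (auto simp: rect_def u_def w_def mem_Times_iff abs_le_iff)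
    have xy: "\<bar>x\<bar> \<le> pi" "\<bar>y\<bar> \<le> pi"
      using uw sm by (simp_all add: x_def y_def abs_mult field_simps)
    have xu: "real m * x\<^sup>2 = u\<^sup>2" "real m ^ 3 * y\<^sup>2 = w\<^sup>2"
      using m by (simp_all add: x_def y_def power_divide power_mult_distrib power2_eq_square power3_eq_cube)
    let ?S = "\<Sum>j<Suc m. 1 - cos (x + real j * y)"
    have "norm (lattice_char m l n c d p) = (\<Prod>j<Suc m. norm (geom_char (bose (c + d * (real j / real m))) (x + real j * y)))"
      unfolding lattice_char_def norm_mult norm_cis prod_norm[symmetric] x_def y_def u_def w_def by simp
    also have "\<dots> \<le> (\<Prod>j<Suc m. exp (- (r * (1 - cos (x + real j * y)))))"
    proof (intro prod_mono conjI norm_ge_zero)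
      fix j assume "j \<in> {..<Suc m}"
      then have j: "real j / real m \<in> {0..1}" using m by simp
      have pos: "0 < c + d * (real j / real m)" using c j by (intro affine_pos) auto
      have "k \<le> bose_var (c + d * (real j / real m))"
        unfolding k_def using affine_in_interval(2)[OF c(2) j, of c] c pos by (intro bose_var_antimono) auto
      then show "norm (geom_char (bose (c + d * (real j / real m))) (x + real j * y)) \<le> exp (- (r * (1 - cos (x + real j * y))))"
        unfolding r_def using bose_pos[OF pos] k by (intro norm_geom_char_le) (auto simp: bose_var_def)
    qed
    also have "\<dots> = exp (- (r * ?S))"
      unfolding exp_sum[OF finite_lessThan, symmetric] by (simp only: sum_negf sum_distrib_left)
    finally have le: "norm (lattice_char m l n c d p) \<le> exp (- (r * ?S))" .
    have uw0: "0 < (1 + u\<^sup>2) * (1 + w\<^sup>2)" by (intro mult_pos_pos add_pos_nonneg) auto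
    have "norm (lattice_char m l n c d p) \<le> C / ((1 + u\<^sup>2) * (1 + w\<^sup>2))"
      using sum_one_minus_cos_ge[OF m xy]
    proof
      assume "real m / 2 \<le> ?S"
      then have "r * (real m / 2) \<le> r * ?S" using r by (intro mult_left_mono) auto
      then have "exp (- (r * ?S)) \<le> exp (- (r * (real m / 2)))" by simp
      also have "\<dots> \<le> (4 / (r * (real m / 2))) ^ 4" using r m by (intro exp_minus_le_power4) auto
      also have "\<dots> = (8 / r) ^ 4 / real m ^ 4" by (simp add: power_divide power_mult_distrib)
      finally have e: "exp (- (r * ?S)) \<le> (8 / r) ^ 4 / real m ^ 4" .
      have "(1 + u\<^sup>2) * (1 + w\<^sup>2) \<le> (17 * real m) * (17 * real m ^ 3)"
      proof (intro mult_mono)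
        have pi2: "pi\<^sup>2 \<le> 16" using power_mono[of pi 4 2] pi_less_4 by simp
        have "u\<^sup>2 \<le> (pi * sqrt m)\<^sup>2" "w\<^sup>2 \<le> (pi * (m * sqrt m))\<^sup>2"
          using power_mono[OF uw(1) abs_ge_zero, of 2] power_mono[OF uw(2) abs_ge_zero, of 2]
          by (simp_all only: power2_abs)
        moreover have "(pi * sqrt m)\<^sup>2 = pi\<^sup>2 * m" "(pi * (m * sqrt m))\<^sup>2 = pi\<^sup>2 * real m ^ 3"
          by (simp_all add: power_mult_distrib) (simp add: power2_eq_square power3_eq_cube)
        ultimately have "u\<^sup>2 \<le> pi\<^sup>2 * m" "w\<^sup>2 \<le> pi\<^sup>2 * real m ^ 3" by simp_all
        moreover have "pi\<^sup>2 * m \<le> 16 * m" "pi\<^sup>2 * real m ^ 3 \<le> 16 * real m ^ 3"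
          using pi2 by (auto intro: mult_right_mono)
        moreover have "1 \<le> real m" "1 \<le> real m ^ 3" using m by (auto intro: one_le_power)
        ultimately show "1 + u\<^sup>2 \<le> 17 * real m" "1 + w\<^sup>2 \<le> 17 * real m ^ 3" by linarith+
      qed auto
      also have "\<dots> = 289 * real m ^ 4" by (simp add: eval_nat_numeral)
      finally have uwm: "(1 + u\<^sup>2) * (1 + w\<^sup>2) \<le> 289 * real m ^ 4" .
      have "exp (- (r * ?S)) * ((1 + u\<^sup>2) * (1 + w\<^sup>2)) \<le> (8 / r) ^ 4 / real m ^ 4 * (289 * real m ^ 4)"
        by (rule mult_mono[OF e uwm]) (use less_imp_le[OF uw0] in simp_all)
      also have "\<dots> = 289 * (8 / r) ^ 4" using m by simp
      also have "\<dots> \<le> C" by fact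
      finally have "exp (- (r * ?S)) \<le> C / ((1 + u\<^sup>2) * (1 + w\<^sup>2))"
        using uw0 by (simp add: pos_le_divide_eq)
      with le show ?thesis by (rule order_trans)
    next
      assume "(real m * x\<^sup>2 + real m ^ 3 * y\<^sup>2) / 60000 \<le> ?S"
      then have "r * ((u\<^sup>2 + w\<^sup>2) / 60000) \<le> r * ?S" using r unfolding xu by (intro mult_left_mono) auto
      then have "exp (- (r * ?S)) \<le> exp (- (r * ((u\<^sup>2 + w\<^sup>2) / 60000)))" by simp
      also have "\<dots> = exp (- (q * u\<^sup>2)) * exp (- (q * w\<^sup>2))"
        by (simp add: q_def field_simps flip: exp_add)
      also have "\<dots> \<le> ((1 + 1 / q) / (1 + u\<^sup>2)) * ((1 + 1 / q) / (1 + w\<^sup>2))"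
        using q by (intro mult_mono exp_minus_square_le) auto
      also have "\<dots> = (1 + 1 / q)\<^sup>2 / ((1 + u\<^sup>2) * (1 + w\<^sup>2))" by (simp add: power2_eq_square)
      also have "\<dots> \<le> C / ((1 + u\<^sup>2) * (1 + w\<^sup>2))" using uw0 C by (intro divide_right_mono) auto
      finally show ?thesis using le by (rule order_trans[rotated])
    qed
    then show "norm (lattice_char m l n c d p) \<le> C * (1 / ((1 + (fst p)\<^sup>2) * (1 + (snd p)\<^sup>2)))"
      by (simp add: u_def w_def)
  qed
qed

lemma prod_cis: "finite A \<Longrightarrow> (\<Prod>j\<in>A. cis (f j)) = cis (\<Sum>j\<in>A. f j)"
  by (simp add: cis_conv_exp exp_sum sum_distrib_left)

lemma norm_cis_minus_1_le: "norm (cis x - 1) \<le> \<bar>x\<bar>"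
  using iexp_approx1[of x 0] by (simp add: cis_conv_exp)

lemma norm_diff_triangle3: "norm (a - e) \<le> norm (a - z) + norm (z - y) + norm (y - e)"
  for a e z y :: "'a :: real_normed_vector"
  using norm_triangle_ineq[of "a - z" "z - e"] norm_triangle_ineq[of "z - y" "y - e"] by simp

lemma exp_minus_diff_le:
  fixes x y :: real
  assumes "0 \<le> x" "0 \<le> y"
  shows "\<bar>exp (- x) - exp (- y)\<bar> \<le> \<bar>x - y\<bar>"
proof -
  have *: "exp (- x) - exp (- y) \<le> y - x" if "0 \<le> x" "x \<le> y" for x y :: real
  proof -
    have "1 - exp (x - y) \<le> y - x" using exp_ge_add_one_self[of "x - y"] by linarith
    have "exp (- x) - exp (- y) = exp (- x) * (1 - exp (x - y))"
      by (simp add: right_diff_distrib flip: exp_add)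
    also have "\<dots> \<le> 1 * (y - x)"
      using that \<open>1 - exp (x - y) \<le> y - x\<close> by (intro mult_mono) auto
    finally show ?thesis by simp
  qed
  show ?thesis
    using *[of x y] *[of y x] assms by (cases "x \<le> y") auto
qed

text \<open>Three replacements, with T = |u| + |w|: the mismatch of the centring costs T, the
  factorwise Gaussian approximation T^3, and passing from the variance sums to integrals T^2, each
  divided by sqrt m. The condition T <= sqrt m keeps all angles in the range of
  \<open>geom_char_approx\<close>.\<close>

lemma lattice_char_approx:
  assumes c0: "0 < c0"
  obtains C where "0 \<le> C" "\<And>c d m l n u w. \<lbrakk>c0 \<le> c; 0 \<le> d; c + d \<le> M; 0 < m;
      real l = real m * moment0 c d; real n = (real m)\<^sup>2 * moment1 c d; \<bar>u\<bar> + \<bar>w\<bar> \<le> sqrt m\<rbrakk> \<Longrightarrow>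
    norm (lattice_char m l n c d (u, w) - of_real (exp (- (variance_form c d u w / 2))))
      \<le> C * ((\<bar>u\<bar> + \<bar>w\<bar>) + (\<bar>u\<bar> + \<bar>w\<bar>)\<^sup>2 + (\<bar>u\<bar> + \<bar>w\<bar>) ^ 3) / sqrt m"
proof -
  obtain R where R: "0 \<le> R" and
    R0: "\<And>c d m. \<lbrakk>c0 \<le> c; 0 \<le> d; d \<le> M; 0 < m\<rbrakk> \<Longrightarrow>
       \<bar>(\<Sum>j<Suc m. bose (c + d * (real j / real m))) - real m * moment0 c d\<bar> \<le> R" and
    R1: "\<And>c d m. \<lbrakk>c0 \<le> c; 0 \<le> d; d \<le> M; 0 < m\<rbrakk> \<Longrightarrow>
       \<bar>(\<Sum>j<Suc m. real j / real m * bose (c + d * (real j / real m))) - real m * moment1 c d\<bar> \<le> R" and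
    RV: "\<And>c d m k. \<lbrakk>c0 \<le> c; 0 \<le> d; d \<le> M; 0 < m; k \<le> 2\<rbrakk> \<Longrightarrow>
       \<bar>(\<Sum>j<Suc m. (real j / real m) ^ k * bose_var (c + d * (real j / real m))) - real m * variance_integral k c d\<bar> \<le> R"
    by (rule riemann_bounds[OF c0, of M]) blast
  define G where "G = bose c0"
  have G: "0 < G" using c0 by (simp add: G_def bose_pos)
  \<comment> \<open>Twice the constant 20 of \<open>geom_char_approx\<close>, because the number of
    factors \<open>Suc m\<close> is bounded by 2 m.\<close>
  define H where "H = 40 * (1 + G) ^ 5"
  have H: "0 \<le> H" using G by (simp add: H_def)
  show ?thesis
  proof (rule that[of "R + H"])
    show "0 \<le> R + H" using R H by simp
    fix c d m l n u w
    assume a: "c0 \<le> c" "0 \<le> d" "c + d \<le> M" "0 < m"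
      and l: "real l = real m * moment0 c d" and n: "real n = (real m)\<^sup>2 * moment1 c d"
      and T: "\<bar>u\<bar> + \<bar>w\<bar> \<le> sqrt (real m)"
    define T where "T = \<bar>u\<bar> + \<bar>w\<bar>"
    have T0: "0 \<le> T" by (simp add: T_def)
    have c: "0 < c" and dM: "d \<le> M" using a c0 by auto
    have sm: "0 < sqrt m" using a by simp
    have sm2: "sqrt m * sqrt m = m" by simp
    define g where "g = (\<lambda>j :: nat. bose (c + d * (real j / real m)))"
    define x where "x = (\<lambda>j :: nat. u / sqrt m + real j * (w / (m * sqrt m)))"
    have x_eq: "x j = (u + w * (real j / real m)) / sqrt m" for j
      by (simp add: x_def add_divide_distrib)
    have g: "0 \<le> g j" "g j \<le> G" for j
    proof -
      have "0 \<le> d * (real j / real m)" using a by simp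
      then have "c0 \<le> c + d * (real j / real m)" using a by linarith
      then show "0 \<le> g j" "g j \<le> G"
        using c0 unfolding g_def G_def by (auto intro!: bose_antimono less_imp_le[OF bose_pos])
    qed
    have xT: "\<bar>x j\<bar> \<le> T / sqrt m" if "j < Suc m" for j
    proof -
      have "real j / real m \<le> 1" using that a by simp
      then have "\<bar>w\<bar> * (real j / real m) \<le> \<bar>w\<bar> * 1" by (intro mult_left_mono) auto
      then have "\<bar>u + w * (real j / real m)\<bar> \<le> T"
        unfolding T_def using abs_triangle_ineq[of u "w * (real j / real m)"] by (simp add: abs_mult)
      then show ?thesis unfolding x_eq using sm by (simp add: divide_right_mono)
    qed
    have T1: "T / sqrt m \<le> 1" using T sm by (simp add: T_def)
    define z where "z = (\<lambda>j. cis (- (g j * x j)) * geom_char (g j) (x j))"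
    define y where "y = (\<lambda>j. of_real (exp (- (g j * (1 + g j) * (x j)\<^sup>2 / 2))) :: complex)"
    \<comment> \<open>The phase left over because the true mean is a Riemann sum, whereas (l, n) is
      given by the moment integrals.\<close>
    define X where "X = (\<Sum>j<Suc m. g j * x j) - (real l * (u / sqrt m) + real n * (w / (m * sqrt m)))"
    have cX: "cis X * (\<Prod>j<Suc m. cis (- (g j * x j))) = cis (- (real l * (u / sqrt m) + real n * (w / (m * sqrt m))))"
    proof -
      have "X + (\<Sum>j<Suc m. - (g j * x j)) = - (real l * (u / sqrt (real m)) + real n * (w / (real m * sqrt (real m))))"
        unfolding sum_negf X_def by linarith
      then show ?thesis unfolding prod_cis[OF finite_lessThan] cis_mult by (rule arg_cong)
    qed
    have L: "lattice_char m l n c d (u, w) = cis X * (\<Prod>j<Suc m. z j)"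
      unfolding lattice_char_def fst_conv snd_conv cX[symmetric] z_def prod.distrib
      by (simp only: g_def x_def mult.assoc)
    have zn: "norm (z j) \<le> 1" for j
      unfolding z_def norm_mult norm_cis using g(1) by (simp add: norm_geom_char_le_1)
    have yn: "norm (y j) \<le> 1" for j
      unfolding y_def norm_of_real using g(1) by simp
    have "norm (\<Prod>j<Suc m. z j) = (\<Prod>j<Suc m. norm (z j))" by (simp only: prod_norm)
    also have "\<dots> \<le> 1" by (intro prod_le_1) (simp add: zn)
    finally have Zn: "norm (\<Prod>j<Suc m. z j) \<le> 1" .
    have X: "\<bar>X\<bar> \<le> R * T / sqrt m"
    proof -
      let ?a = "(\<Sum>j<Suc m. g j) - real m * moment0 c d"
      let ?b = "(\<Sum>j<Suc m. real j / real m * g j) - real m * moment1 c d"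
      have "(\<Sum>j<Suc m. g j * x j) = (\<Sum>j<Suc m. (u / sqrt m) * g j + (w / sqrt m) * (real j / real m * g j))"
        by (intro sum.cong refl) (simp add: x_eq add_divide_distrib algebra_simps)
      also have "\<dots> = (u / sqrt m) * (\<Sum>j<Suc m. g j) + (w / sqrt m) * (\<Sum>j<Suc m. real j / real m * g j)"
        by (simp only: sum.distrib sum_distrib_left)
      finally have gx: "(\<Sum>j<Suc m. g j * x j) = \<dots>" .
      have Xeq: "X = (u / sqrt m) * ?a + (w / sqrt m) * ?b"
      proof -
        have "real m * moment0 c d * (u / sqrt (real m)) = (u / sqrt m) * (real m * moment0 c d)"
          "(real m)\<^sup>2 * moment1 c d * (w / (real m * sqrt (real m))) = (w / sqrt m) * (real m * moment1 c d)"
          using a by (simp_all add: power2_eq_square)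
        then show ?thesis
          using gx unfolding X_def l n right_diff_distrib by linarith
      qed
      have "\<bar>X\<bar> \<le> \<bar>u / sqrt m\<bar> * \<bar>?a\<bar> + \<bar>w / sqrt m\<bar> * \<bar>?b\<bar>"
        unfolding Xeq abs_mult[symmetric] by (rule abs_triangle_ineq)
      also have "\<dots> \<le> \<bar>u / sqrt m\<bar> * R + \<bar>w / sqrt m\<bar> * R"
        using R0[OF a(1,2) dM a(4)] R1[OF a(1,2) dM a(4)] unfolding g_def
        by (intro add_mono mult_left_mono) auto
      also have "\<dots> = R * T / sqrt m" by (simp add: T_def add_divide_distrib algebra_simps)
      finally show ?thesis .
    qed
    have Z: "norm ((\<Prod>j<Suc m. z j) - (\<Prod>j<Suc m. y j)) \<le> H * T ^ 3 / sqrt m"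
    proof -
      have "norm ((\<Prod>j<Suc m. z j) - (\<Prod>j<Suc m. y j)) \<le> (\<Sum>j<Suc m. norm (z j - y j))"
        by (intro norm_prod_diff zn yn)
      also have "\<dots> \<le> (\<Sum>j<Suc m. 20 * (1 + G) ^ 5 * (T / sqrt m) ^ 3)"
      proof (intro sum_mono)
        fix j assume "j \<in> {..<Suc m}"
        then have j: "\<bar>x j\<bar> \<le> T / sqrt m" by (intro xT) simp
        have "norm (z j - y j) \<le> 20 * (1 + G) ^ 5 * \<bar>x j\<bar> ^ 3"
          unfolding z_def y_def using j T1 by (intro geom_char_approx g) simp
        also have "\<dots> \<le> 20 * (1 + G) ^ 5 * (T / sqrt m) ^ 3"
          using G j by (intro mult_left_mono power_mono) auto
        finally show "norm (z j - y j) \<le> 20 * (1 + G) ^ 5 * (T / sqrt m) ^ 3" .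
      qed
      also have "\<dots> = real (Suc m) * (20 * (1 + G) ^ 5 * (T / sqrt m) ^ 3)" by simp
      also have "\<dots> \<le> (2 * real m) * (20 * (1 + G) ^ 5 * (T / sqrt m) ^ 3)"
        using a G T0 by (intro mult_right_mono) auto
      also have "\<dots> = H * T ^ 3 / sqrt m"
        using sm a by (simp add: H_def power_divide power3_eq_cube field_simps)
      finally show ?thesis .
    qed
    define W where "W = (\<Sum>j<Suc m. g j * (1 + g j) * (x j)\<^sup>2)"
    have yW: "(\<Prod>j<Suc m. y j) = of_real (exp (- (W / 2)))"
      unfolding y_def of_real_prod[symmetric] exp_sum[OF finite_lessThan, symmetric] W_def
      by (simp only: sum_negf sum_divide_distrib)
    have W: "\<bar>exp (- (W / 2)) - exp (- (variance_form c d u w / 2))\<bar> \<le> R * T\<^sup>2 / sqrt m"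
    proof -
      let ?v = "\<lambda>k. \<Sum>j<Suc m. (real j / real m) ^ k * bose_var (c + d * (real j / real m))"
      let ?e = "\<lambda>k. ?v k - real m * variance_integral k c d"
      have W0: "0 \<le> W" unfolding W_def using g(1) by (intro sum_nonneg mult_nonneg_nonneg) (auto intro: add_nonneg_nonneg)
      have "0 \<le> bose_var (c + d) / 16 * (u\<^sup>2 + w\<^sup>2)"
        using bose_var_pos[of "c + d"] c a by simp
      then have V0: "0 \<le> variance_form c d u w" using variance_form_ge[OF c a(2) order_refl, of u w] by linarith
      have "real m * W = (\<Sum>j<Suc m. u\<^sup>2 * ((real j / real m) ^ 0 * bose_var (c + d * (real j / real m)))
          + (2 * (u * w)) * ((real j / real m) ^ 1 * bose_var (c + d * (real j / real m)))
          + w\<^sup>2 * ((real j / real m) ^ 2 * bose_var (c + d * (real j / real m))))"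
        unfolding W_def sum_distrib_left
      proof (intro sum.cong refl)
        fix j
        have bv: "g j * (1 + g j) = bose_var (c + d * (real j / real m))" by (simp add: g_def bose_var_def)
        have "real m * (g j * (1 + g j) * (x j)\<^sup>2) = bose_var (c + d * (real j / real m)) * (u + w * (real j / real m))\<^sup>2"
          unfolding x_eq power_divide bv using a by simp
        also have "\<dots> = u\<^sup>2 * ((real j / real m) ^ 0 * bose_var (c + d * (real j / real m)))
          + (2 * (u * w)) * ((real j / real m) ^ 1 * bose_var (c + d * (real j / real m)))
          + w\<^sup>2 * ((real j / real m) ^ 2 * bose_var (c + d * (real j / real m)))"
          unfolding power2_sum power_mult_distrib by (simp add: algebra_simps)
        finally show "real m * (g j * (1 + g j) * (x j)\<^sup>2) = \<dots>" .
      qed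
      also have "\<dots> = u\<^sup>2 * ?v 0 + (2 * (u * w)) * ?v 1 + w\<^sup>2 * ?v 2"
        by (simp only: sum.distrib sum_distrib_left)
      finally have "real m * (W - variance_form c d u w) = u\<^sup>2 * ?e 0 + (2 * (u * w)) * ?e 1 + w\<^sup>2 * ?e 2"
        unfolding variance_form_def right_diff_distrib by (simp only: algebra_simps)
      then have "\<bar>real m * (W - variance_form c d u w)\<bar> = \<bar>u\<^sup>2 * ?e 0 + (2 * (u * w)) * ?e 1 + w\<^sup>2 * ?e 2\<bar>"
        by (rule arg_cong)
      then have "real m * \<bar>W - variance_form c d u w\<bar> = \<bar>u\<^sup>2 * ?e 0 + (2 * (u * w)) * ?e 1 + w\<^sup>2 * ?e 2\<bar>"
        unfolding abs_mult[of "real m"] abs_of_nat .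
      also have "\<dots> \<le> \<bar>u\<^sup>2 * ?e 0\<bar> + \<bar>(2 * (u * w)) * ?e 1\<bar> + \<bar>w\<^sup>2 * ?e 2\<bar>"
        by linarith
      also have "\<dots> \<le> \<bar>u\<^sup>2\<bar> * R + \<bar>2 * (u * w)\<bar> * R + \<bar>w\<^sup>2\<bar> * R"
        unfolding abs_mult[of "u\<^sup>2"] abs_mult[of "2 * (u * w)"] abs_mult[of "w\<^sup>2"]
        by (intro add_mono mult_left_mono RV a dM) auto
      also have "\<dots> = R * T\<^sup>2"
        by (simp add: T_def power2_sum abs_mult algebra_simps)
      finally have "\<bar>W - variance_form c d u w\<bar> \<le> R * T\<^sup>2 / real m"
        using a by (simp add: field_simps)
      also have "\<dots> \<le> R * T\<^sup>2 / sqrt m"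
      proof (rule divide_left_mono)
        have "sqrt m * 1 \<le> sqrt m * sqrt m" using a by (intro mult_left_mono) auto
        then show "sqrt m \<le> real m" by simp
      qed (use R a in auto)
      finally have "\<bar>W - variance_form c d u w\<bar> \<le> R * T\<^sup>2 / sqrt m" .
      moreover have "\<bar>exp (- (W / 2)) - exp (- (variance_form c d u w / 2))\<bar> \<le> \<bar>W / 2 - variance_form c d u w / 2\<bar>"
        using W0 V0 by (intro exp_minus_diff_le) auto
      moreover have "\<bar>W / 2 - variance_form c d u w / 2\<bar> \<le> \<bar>W - variance_form c d u w\<bar>"
        by (simp flip: diff_divide_distrib)
      ultimately show ?thesis by linarith
    qed
    have Y: "norm ((\<Prod>j<Suc m. y j) - of_real (exp (- (variance_form c d u w / 2)))) \<le> R * T\<^sup>2 / sqrt m"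
      unfolding yW of_real_diff[symmetric] norm_of_real by (rule W)
    have "norm (cis X * (\<Prod>j<Suc m. z j) - (\<Prod>j<Suc m. z j)) = norm (cis X - 1) * norm (\<Prod>j<Suc m. z j)"
      by (simp only: left_diff_distrib mult_1 flip: norm_mult)
    also have "\<dots> \<le> \<bar>X\<bar> * 1" by (intro mult_mono norm_cis_minus_1_le Zn) auto
    finally have "norm (cis X * (\<Prod>j<Suc m. z j) - (\<Prod>j<Suc m. z j)) \<le> R * T / sqrt m" using X by simp
    with Z Y norm_diff_triangle3[of "cis X * (\<Prod>j<Suc m. z j)" "of_real (exp (- (variance_form c d u w / 2)))"
        "\<Prod>j<Suc m. z j" "\<Prod>j<Suc m. y j"]
    have "norm (lattice_char m l n c d (u, w) - of_real (exp (- (variance_form c d u w / 2))))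
        \<le> R * T / sqrt m + H * T ^ 3 / sqrt m + R * T\<^sup>2 / sqrt m"
      unfolding L by linarith
    also have "\<dots> \<le> (R + H) * T / sqrt m + (R + H) * T ^ 3 / sqrt m + (R + H) * T\<^sup>2 / sqrt m"
      using R H T0 by (intro add_mono divide_right_mono mult_right_mono) auto
    also have "\<dots> = (R + H) * (T + T\<^sup>2 + T ^ 3) / sqrt m"
      by (simp add: distrib_left add_divide_distrib)
    finally show "norm (lattice_char m l n c d (u, w) - of_real (exp (- (variance_form c d u w / 2))))
      \<le> (R + H) * ((\<bar>u\<bar> + \<bar>w\<bar>) + (\<bar>u\<bar> + \<bar>w\<bar>)\<^sup>2 + (\<bar>u\<bar> + \<bar>w\<bar>) ^ 3) / sqrt m"
      unfolding T_def .
  qed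
qed

section \<open>The local limit theorem\<close>

lemma exp_variance_form_le:
  assumes "0 < k" "k * (u\<^sup>2 + w\<^sup>2) \<le> variance_form c d u w"
  shows "exp (- (variance_form c d u w / 2)) \<le> (1 + 2 / k)\<^sup>2 * (1 / ((1 + u\<^sup>2) * (1 + w\<^sup>2)))"
proof -
  have "exp (- (variance_form c d u w / 2)) \<le> exp (- (k / 2 * u\<^sup>2)) * exp (- (k / 2 * w\<^sup>2))"
    using assms by (simp add: field_simps flip: exp_add)
  also have "\<dots> \<le> ((1 + 1 / (k / 2)) / (1 + u\<^sup>2)) * ((1 + 1 / (k / 2)) / (1 + w\<^sup>2))"
    using assms by (intro mult_mono exp_minus_square_le) auto
  finally show ?thesis by (simp add: power2_eq_square)
qed

lemma integrable_exp_variance_form: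
  assumes "0 < c" "0 \<le> d"
  shows "integrable lborel (\<lambda>p. exp (- (variance_form c d (fst p) (snd p) / 2)))"
proof (rule Bochner_Integration.integrable_bound)
  let ?k = "bose_var (c + d) / 16"
  have k: "0 < ?k" using bose_var_pos[of "c + d"] assms by simp
  show "integrable lborel (\<lambda>p :: real \<times> real. (1 + 2 / ?k)\<^sup>2 * (1 / ((1 + (fst p)\<^sup>2) * (1 + (snd p)\<^sup>2))))"
    by (intro integrable_mult_right integrable_product_cauchy)
  have "continuous_on UNIV (\<lambda>p. exp (- (variance_form c d (fst p) (snd p) / 2)))"
    unfolding variance_form_def by (intro continuous_intros) simp_all
  then show "(\<lambda>p. exp (- (variance_form c d (fst p) (snd p) / 2))) \<in> borel_measurable lborel"
    by (simp add: borel_measurable_continuous_onI)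
  have le: "exp (- (variance_form c d u w / 2)) \<le> (1 + 2 / ?k)\<^sup>2 * (1 / ((1 + u\<^sup>2) * (1 + w\<^sup>2)))" for u w
    by (intro exp_variance_form_le k variance_form_ge assms order_refl)
  have "norm (exp (- (variance_form c d u w / 2))) \<le> norm ((1 + 2 / ?k)\<^sup>2 * (1 / ((1 + u\<^sup>2) * (1 + w\<^sup>2))))" for u w
    using order_trans[OF le abs_ge_self] by simp
  then show "AE p in lborel. norm (exp (- (variance_form c d (fst p) (snd p) / 2))) \<le>
      norm ((1 + 2 / ?k)\<^sup>2 * (1 / ((1 + (fst p)\<^sup>2) * (1 + (snd p)\<^sup>2))))"
    by (intro AE_I2)
qed

lemma integral_exp_variance_form:
  assumes "0 < c" "0 \<le> d"
  shows "(\<integral>p. exp (- (variance_form c d (fst p) (snd p) / 2)) \<partial>lborel) = 2 * pi / sqrt (variance_det c d)"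
proof -
  have eq: "variance_form c d u w = variance_integral 0 c d * u\<^sup>2 + 2 * variance_integral 1 c d * (u * w)
     + variance_integral 2 c d * w\<^sup>2" for u w
    by (simp add: variance_form_def)
  show ?thesis
    using integrable_exp_variance_form[OF assms] variance_pos[OF assms]
    unfolding eq variance_det_def by (intro gaussian_integral_2d)
qed

lemma filterlim_real_at_top_of_le:
  fixes m :: "nat \<Rightarrow> nat"
  assumes "\<And>i. i + k \<le> m i"
  shows "filterlim (\<lambda>i. real (m i)) at_top sequentially"
  by (rule filterlim_at_top_mono[OF filterlim_real_sequentially])
    (intro always_eventually allI, simp add: add_leD1[OF assms])

text \<open>The parameters c i and d i need not converge, so the Gaussian is subtracted inside the
  integral: the differences tend to 0 pointwise and share an integrable majorant.\<close>

lemma lattice_char_integral_tendsto: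
  fixes m l n :: "nat \<Rightarrow> nat" and c d :: "nat \<Rightarrow> real"
  assumes c0: "0 < c0" and c: "\<And>i. c0 \<le> c i" and d: "\<And>i. 0 \<le> d i" and M: "\<And>i. c i + d i \<le> M"
    and m: "\<And>i. i + 4 \<le> m i"
    and l: "\<And>i. real (l i) = real (m i) * moment0 (c i) (d i)"
    and n: "\<And>i. real (n i) = (real (m i))\<^sup>2 * moment1 (c i) (d i)"
  shows "(\<lambda>i. (\<integral>p. indicator (rect (sqrt (m i)) (m i * sqrt (m i))) p *\<^sub>R lattice_char (m i) (l i) (n i) (c i) (d i) p \<partial>lborel)
      - of_real (2 * pi / sqrt (variance_det (c i) (d i)))) \<longlonglongrightarrow> 0"
proof -
  define f where "f = (\<lambda>i p. indicator (rect (sqrt (m i)) (m i * sqrt (m i))) p *\<^sub>R lattice_char (m i) (l i) (n i) (c i) (d i) p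
    - of_real (exp (- (variance_form (c i) (d i) (fst p) (snd p) / 2))))"
  have cp: "0 < c i" for i using c0 c[of i] by linarith
  have mp: "0 < m i" "4 \<le> m i" for i using m[of i] by auto
  have Mp: "0 < M" using cp[of 0] d[of 0] M[of 0] by linarith
  have I1: "integrable lborel (\<lambda>p. indicator (rect (sqrt (m i)) (m i * sqrt (m i))) p *\<^sub>R lattice_char (m i) (l i) (n i) (c i) (d i) p)" for i
    by (intro integrable_lattice_char cp d mp)
  have I2: "integrable lborel (\<lambda>p. of_real (exp (- (variance_form (c i) (d i) (fst p) (snd p) / 2))) :: complex)" for i
    by (intro integrable_of_real integrable_exp_variance_form cp d)
  have int: "(\<integral>p. f i p \<partial>lborel) = (\<integral>p. indicator (rect (sqrt (m i)) (m i * sqrt (m i))) p *\<^sub>R lattice_char (m i) (l i) (n i) (c i) (d i) p \<partial>lborel)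
      - of_real (2 * pi / sqrt (variance_det (c i) (d i)))" for i
    unfolding f_def Bochner_Integration.integral_diff[OF I1 I2] integral_exp_variance_form[OF cp d, symmetric]
    by (simp only: integral_complex_of_real)
  obtain C where C: "0 \<le> C" "\<And>c d m l n p. \<lbrakk>0 < c; 0 \<le> d; c + d \<le> M; 4 \<le> m; p \<in> rect (sqrt m) (m * sqrt m)\<rbrakk> \<Longrightarrow>
    norm (lattice_char m l n c d p) \<le> C * (1 / ((1 + (fst p)\<^sup>2) * (1 + (snd p)\<^sup>2)))"
    using norm_lattice_char_le[OF Mp] by blast
  obtain D where D: "0 \<le> D" "\<And>c d m l n u w. \<lbrakk>c0 \<le> c; 0 \<le> d; c + d \<le> M; 0 < m;
      real l = real m * moment0 c d; real n = (real m)\<^sup>2 * moment1 c d; \<bar>u\<bar> + \<bar>w\<bar> \<le> sqrt m\<rbrakk> \<Longrightarrow>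
    norm (lattice_char m l n c d (u, w) - of_real (exp (- (variance_form c d u w / 2))))
      \<le> D * ((\<bar>u\<bar> + \<bar>w\<bar>) + (\<bar>u\<bar> + \<bar>w\<bar>)\<^sup>2 + (\<bar>u\<bar> + \<bar>w\<bar>) ^ 3) / sqrt m"
    using lattice_char_approx[OF c0] by blast
  define k where "k = bose_var M / 16"
  have k: "0 < k" using bose_var_pos[OF Mp] by (simp add: k_def)
  have sm: "filterlim (\<lambda>i. sqrt (real (m i))) at_top sequentially"
    by (rule filterlim_compose[OF sqrt_at_top filterlim_real_at_top_of_le[OF m]])
  have "(\<lambda>i. \<integral>p. f i p \<partial>lborel) \<longlonglongrightarrow> (\<integral>p. 0 \<partial>(lborel :: (real \<times> real) measure))"
  proof (rule integral_dominated_convergence)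
    show "integrable lborel (\<lambda>p :: real \<times> real. (C + (1 + 2 / k)\<^sup>2) * (1 / ((1 + (fst p)\<^sup>2) * (1 + (snd p)\<^sup>2))))"
      by (intro integrable_mult_right integrable_product_cauchy)
    show "f i \<in> borel_measurable lborel" for i
      unfolding f_def using I1 I2 by (intro borel_measurable_diff borel_measurable_integrable)
    show "AE p in lborel. norm (f i p) \<le> (C + (1 + 2 / k)\<^sup>2) * (1 / ((1 + (fst p)\<^sup>2) * (1 + (snd p)\<^sup>2)))" for i
    proof (rule AE_I2)
      fix p :: "real \<times> real"
      let ?q = "1 / ((1 + (fst p)\<^sup>2) * (1 + (snd p)\<^sup>2))"
      let ?a = "indicator (rect (sqrt (m i)) (m i * sqrt (m i))) p *\<^sub>R lattice_char (m i) (l i) (n i) (c i) (d i) p"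
      let ?b = "of_real (exp (- (variance_form (c i) (d i) (fst p) (snd p) / 2))) :: complex"
      have q: "0 \<le> ?q" by simp
      have "norm ?a \<le> C * ?q"
      proof (cases "p \<in> rect (sqrt (m i)) (m i * sqrt (m i))")
        case True
        with C(2)[OF cp d M mp(2) True] show ?thesis by simp
      next
        case False
        then show ?thesis using mult_nonneg_nonneg[OF C(1) q] by simp
      qed
      moreover have "norm ?b \<le> (1 + 2 / k)\<^sup>2 * ?q"
        unfolding norm_of_real abs_exp_cancel using variance_form_ge[of "c i" "d i" M "fst p" "snd p", OF cp d M] k
        by (intro exp_variance_form_le) (auto simp: k_def)
      moreover have "norm (f i p) \<le> norm ?a + norm ?b" unfolding f_def by (rule norm_triangle_ineq4)
      ultimately show "norm (f i p) \<le> (C + (1 + 2 / k)\<^sup>2) * ?q" unfolding distrib_right by linarith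
    qed
    show "AE p in lborel. (\<lambda>i. f i p) \<longlonglongrightarrow> 0"
    proof (rule AE_I2)
      fix p :: "real \<times> real"
      obtain u w where p: "p = (u, w)" by fastforce
      let ?T = "\<bar>u\<bar> + \<bar>w\<bar>"
      let ?K = "D * (?T + ?T\<^sup>2 + ?T ^ 3)"
      have "\<forall>\<^sub>F i in sequentially. ?T \<le> sqrt (m i)"
        using sm by (simp add: filterlim_at_top)
      then have "\<forall>\<^sub>F i in sequentially. norm (f i p) \<le> ?K / sqrt (m i)"
      proof eventually_elim
        case (elim i)
        have s: "1 \<le> sqrt (m i)" "1 \<le> real (m i)" using mp[of i] by auto
        have "sqrt (m i) \<le> pi * sqrt (m i)" using pi_gt3 s by simp
        moreover have "1 * sqrt (m i) \<le> (pi * m i) * sqrt (m i)"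
          using pi_gt3 s mult_mono[of 1 pi 1 "real (m i)"] by (intro mult_right_mono) auto
        ultimately have "\<bar>u\<bar> \<le> pi * sqrt (m i)" "\<bar>w\<bar> \<le> pi * (m i * sqrt (m i))"
          using elim by (simp_all add: mult.assoc)
        then have "p \<in> rect (sqrt (m i)) (m i * sqrt (m i))" by (auto simp: rect_def p abs_le_iff)
        then have "f i p = lattice_char (m i) (l i) (n i) (c i) (d i) (u, w) - of_real (exp (- (variance_form (c i) (d i) u w / 2)))"
          by (simp add: f_def p)
        then show ?case using D(2)[OF c d M mp(1) l n elim] by simp
      qed
      moreover have "(\<lambda>i. ?K / sqrt (m i)) \<longlonglongrightarrow> 0"
        by (intro tendsto_divide_0[OF tendsto_const] filterlim_at_top_imp_at_infinity sm)
      ultimately show "(\<lambda>i. f i p) \<longlonglongrightarrow> 0" by (rule Lim_null_comparison)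
    qed
  qed simp
  then show ?thesis unfolding int by simp
qed

text \<open>Dominated convergence is a statement about sequences. If the limit failed, a
  counterexample with m >= i + 4 could be chosen for every i; the 4 supplies the lower bound on m
  required by \<open>sum_one_minus_cos_ge\<close>.\<close>

lemma tendsto_rescaled_in:
  fixes f :: "nat \<times> nat \<times> nat \<Rightarrow> real"
  assumes "\<And>m l n. \<lbrakk>\<And>i. i + 4 \<le> m i; \<And>i. 0 < l i; \<And>i. 0 < n i;
      \<And>i. (real (l i) / real (m i), real (n i) / (real (m i))\<^sup>2) \<in> K\<rbrakk> \<Longrightarrow> (\<lambda>i. f (m i, l i, n i)) \<longlonglongrightarrow> L"
  shows "(f \<longlongrightarrow> L) (rescaled_in K)"
proof (rule tendstoI, rule ccontr)
  fix e :: real assume e: "0 < e"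
  let ?S = "{(m, l, n). 0 < m \<and> 0 < l \<and> 0 < n \<and> (real l / real m, real n / (real m)\<^sup>2) \<in> K}"
  assume "\<not> (\<forall>\<^sub>F x in rescaled_in K. dist (f x) L < e)"
  then have "\<not> (\<exists>N. \<forall>x. N \<le> fst x \<longrightarrow> x \<in> ?S \<longrightarrow> dist (f x) L < e)"
    unfolding rescaled_in_def eventually_inf_principal eventually_filtercomap_at_top_linorder by blast
  then have "\<forall>i. \<exists>x. i + 4 \<le> fst x \<and> x \<in> ?S \<and> \<not> dist (f x) L < e" by blast
  from choice[OF this] obtain X where "\<forall>i. i + 4 \<le> fst (X i) \<and> X i \<in> ?S \<and> \<not> dist (f (X i)) L < e" ..
  then have X: "\<And>i. i + 4 \<le> fst (X i)" "\<And>i. X i \<in> ?S" "\<And>i. \<not> dist (f (X i)) L < e"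
    by (auto simp del: mem_Collect_eq)
  have "(\<lambda>i. f (fst (X i), fst (snd (X i)), snd (snd (X i)))) \<longlonglongrightarrow> L"
    using X(1,2) by (intro assms) (auto simp: case_prod_beta')
  then have "(\<lambda>i. f (X i)) \<longlonglongrightarrow> L" by simp
  then have "\<forall>\<^sub>F i in sequentially. dist (f (X i)) L < e" using e by (rule tendstoD)
  with X(3) show False by simp
qed

theorem theorem1:
  fixes K :: "(real \<times> real) set"
  assumes "compact K"
    and "K \<subseteq> {(x, y). x \<ge> 2 * y \<and> 2 * y > 0}"
  shows "(\<lambda>(m, l, n). real (box_partition_count n l m))
           \<sim>[rescaled_in K]
         (\<lambda>(m, l, n).
            let A = real l / real m;
                B = real n / (real m)\<^sup>2;
                c = saddle_c A B;
                d = saddle_d A B;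
                \<Delta> = saddle_Delta A B
            in exp (real m * (c * A + 2 * d * B - ln (1 - exp (- c - d)))) /
               (2 * pi * (real m)\<^sup>2 * sqrt (\<Delta> * (1 - exp (- c)) * (1 - exp (- c - d)))))
       \<and> (\<exists>L. L-lipschitz_on K (\<lambda>(x, y). saddle_c x y))
       \<and> (\<exists>L. L-lipschitz_on K (\<lambda>(x, y). saddle_d x y))"
proof (intro conjI)
  obtain L where L: "L-lipschitz_on K (\<lambda>(x, y). (saddle_c x y, saddle_d x y))"
    using saddle_lipschitz[OF assms] by blast
  have "L-lipschitz_on K (\<lambda>(x, y). saddle_c x y)"
  proof (rule lipschitz_onI)
    show "dist ((\<lambda>(x, y). saddle_c x y) p) ((\<lambda>(x, y). saddle_c x y) q) \<le> L * dist p q" if "p \<in> K" "q \<in> K" for p q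
      using order_trans[OF dist_fst_le lipschitz_onD[OF L that]] by (simp add: case_prod_beta')
  qed (rule lipschitz_on_nonneg[OF L])
  then show "\<exists>L. L-lipschitz_on K (\<lambda>(x, y). saddle_c x y)" by blast
  have "L-lipschitz_on K (\<lambda>(x, y). saddle_d x y)"
  proof (rule lipschitz_onI)
    show "dist ((\<lambda>(x, y). saddle_d x y) p) ((\<lambda>(x, y). saddle_d x y) q) \<le> L * dist p q" if "p \<in> K" "q \<in> K" for p q
      using order_trans[OF dist_snd_le lipschitz_onD[OF L that]] by (simp add: case_prod_beta')
  qed (rule lipschitz_on_nonneg[OF L])
  then show "\<exists>L. L-lipschitz_on K (\<lambda>(x, y). saddle_d x y)" by blast
next
  obtain c0 M where c0: "0 < c0" and bounds:
    "\<And>A B. (A, B) \<in> K \<Longrightarrow> c0 \<le> saddle_c A B \<and> saddle_c A B + saddle_d A B \<le> M"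
    using saddle_bounds[OF assms] by metis
  obtain R where trap: "\<And>c d m. \<lbrakk>c0 \<le> c; 0 \<le> d; d \<le> M; 0 < m\<rbrakk> \<Longrightarrow>
       \<bar>(\<Sum>j<Suc m. ln (1 - exp (- (c + d * (real j / real m)))))
          - (ln (1 - exp (- c)) + ln (1 - exp (- (c + d)))) / 2
          - real m * (ln (1 - exp (- (c + d))) - d * moment1 c d)\<bar> \<le> R / real m"
    by (rule riemann_bounds[OF c0, of M]) blast
  show "(\<lambda>(m, l, n). real (box_partition_count n l m)) \<sim>[rescaled_in K]
         (\<lambda>(m, l, n).
            let A = real l / real m;
                B = real n / (real m)\<^sup>2;
                c = saddle_c A B;
                d = saddle_d A B;
                \<Delta> = saddle_Delta A B
            in exp (real m * (c * A + 2 * d * B - ln (1 - exp (- c - d)))) /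
               (2 * pi * (real m)\<^sup>2 * sqrt (\<Delta> * (1 - exp (- c)) * (1 - exp (- c - d)))))"
    unfolding asymp_equiv_def
  proof (rule tendsto_rescaled_in, goal_cases)
    case (1 m l n)
    define A B where "A = (\<lambda>i. real (l i) / real (m i))" and "B = (\<lambda>i. real (n i) / (real (m i))\<^sup>2)"
    define c d where "c = (\<lambda>i. saddle_c (A i) (B i))" and "d = (\<lambda>i. saddle_d (A i) (B i))"
    define V where "V = (\<lambda>i. variance_det (c i) (d i))"
    define P where "P = (\<lambda>i. (1 - exp (- c i)) * (1 - exp (- c i - d i)))"
    define I where "I = (\<lambda>i. \<integral>p. indicator (rect (sqrt (m i)) (m i * sqrt (m i))) p *\<^sub>R
        lattice_char (m i) (l i) (n i) (c i) (d i) p \<partial>lborel)"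
    \<comment> \<open>The trapezoid error, the only source of error in the explicit factor.\<close>
    define r where "r = (\<lambda>i. (\<Sum>j<Suc (m i). ln (1 - exp (- (c i + d i * (real j / real (m i))))))
          - (ln (1 - exp (- c i)) + ln (1 - exp (- (c i + d i)))) / 2
          - real (m i) * (ln (1 - exp (- (c i + d i))) - d i * B i))"
    have K: "(A i, B i) \<in> K" for i using 1(4) by (simp add: A_def B_def)
    have AB: "0 < 2 * B i" "2 * B i \<le> A i" for i using K[of i] assms(2) by auto
    have m: "0 < m i" for i using 1(1)[of i] by simp
    have c: "0 < c i" "c0 \<le> c i" and d: "0 \<le> d i" and M: "c i + d i \<le> M" "d i \<le> M"
      and mom: "moment0 (c i) (d i) = A i" "moment1 (c i) (d i) = B i" for i
      using saddle_point[OF AB, of i] bounds[OF K, of i] by (auto simp: c_def d_def)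
    have V: "0 < V i" "V i \<le> (bose_var c0)\<^sup>2" for i
      unfolding V_def using variance_pos(2)[OF c(1) d] variance_det_le[OF c0 c(2) d] by auto
    have De: "saddle_Delta (A i) (B i) = V i" for i
      using saddle_Delta_eq[OF AB, of i] by (simp add: V_def variance_det_def c_def d_def)
    have lm: "real (l i) = real (m i) * A i" and nm: "real (n i) = (real (m i))\<^sup>2 * B i" for i
      using m[of i] by (simp_all add: A_def B_def)
    have rbound: "\<bar>r i\<bar> \<le> R / real (m i)" for i
      using trap[of "c i" "d i" "m i", OF c(2) d M(2) m] unfolding r_def mom .
    \<comment> \<open>An exact identity: the quotient of count and claimed asymptotics is split into
      the quadrature factor and the local limit factor, each of which tends to 1.\<close>
    have ratio: "real (box_partition_count (n i) (l i) (m i)) /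
        (exp (real (m i) * (c i * A i + 2 * d i * B i - ln (1 - exp (- c i - d i)))) /
          (2 * pi * (real (m i))\<^sup>2 * sqrt (V i * (1 - exp (- c i)) * (1 - exp (- c i - d i)))))
      = exp (- r i) * (Re (I i) * sqrt (V i) / (2 * pi))" for i
    proof -
      let ?m = "real (m i)"
      let ?L = "\<lambda>x. ln (1 - exp (- x))"
      let ?S = "\<Sum>j<Suc (m i). ?L (c i + d i * (real j / ?m))"
      have P0: "0 < 1 - exp (- c i)" "0 < 1 - exp (- c i - d i)" using c[of i] d[of i] by auto
      have "(\<Prod>j<Suc (m i). 1 - exp (- (c i + d i * (real j / ?m)))) = (\<Prod>j<Suc (m i). exp (?L (c i + d i * (real j / ?m))))"
      proof (intro prod.cong refl)
        fix j
        have "0 < c i + d i * (real j / ?m)" using c[of i] d[of i] by (intro affine_pos) auto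
        then show "1 - exp (- (c i + d i * (real j / ?m))) = exp (?L (c i + d i * (real j / ?m)))" by simp
      qed
      also have "\<dots> = exp ?S" by (rule exp_sum[OF finite_lessThan, symmetric])
      finally have prod: "(\<Prod>j<Suc (m i). 1 - exp (- (c i + d i * (real j / ?m)))) = exp ?S" .
      have lin: "c i * l i + d i * n i / ?m = ?m * (c i * A i + d i * B i)"
        unfolding lm nm using m[of i] by (simp add: power2_eq_square field_simps)
      have "of_real (4 * pi\<^sup>2 * ?m\<^sup>2 * real (box_partition_count (n i) (l i) (m i)))
          = of_real (exp (?m * (c i * A i + d i * B i)) / exp ?S) * I i"
        using box_partition_count_eq_integral[of "c i" "d i" "m i" "n i" "l i", OF c(1) d m] unfolding I_def prod lin .
      then have re: "Re (of_real (4 * pi\<^sup>2 * ?m\<^sup>2 * real (box_partition_count (n i) (l i) (m i))))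
          = Re (of_real (exp (?m * (c i * A i + d i * B i)) / exp ?S) * I i)" by (rule arg_cong)
      have "4 * pi\<^sup>2 * ?m\<^sup>2 * real (box_partition_count (n i) (l i) (m i))
          = exp (?m * (c i * A i + d i * B i) - ?S) * Re (I i)"
      proof -
        have "Re (of_real a * z) = a * Re z" for a z by simp
        from re[unfolded Re_complex_of_real this] show ?thesis unfolding exp_diff .
      qed
      then have N: "real (box_partition_count (n i) (l i) (m i))
          = exp (?m * (c i * A i + d i * B i) - ?S) * Re (I i) / (4 * pi\<^sup>2 * ?m\<^sup>2)"
        using m[of i] by (simp add: field_simps)
      have "sqrt (V i * (1 - exp (- c i)) * (1 - exp (- c i - d i)))
          = sqrt (V i) * (sqrt (1 - exp (- c i)) * sqrt (1 - exp (- c i - d i)))"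
        by (simp add: real_sqrt_mult)
      also have "sqrt (1 - exp (- c i)) * sqrt (1 - exp (- c i - d i)) = exp ((?L (c i) + ?L (c i + d i)) / 2)"
        using P0 by (simp add: ln_sqrt[symmetric] add_divide_distrib exp_add)
      finally have sq: "sqrt (V i * (1 - exp (- c i)) * (1 - exp (- c i - d i)))
          = sqrt (V i) * exp ((?L (c i) + ?L (c i + d i)) / 2)" .
      \<comment> \<open>One d B comes from the tilt, the other from the integral of the logarithm;
        together they form the 2 d B of the claim. The end-point term becomes the square
        root.\<close>
      have "- r i = (?m * (c i * A i + d i * B i) - ?S) + (?L (c i) + ?L (c i + d i)) / 2
          - ?m * (c i * A i + 2 * d i * B i - ln (1 - exp (- c i - d i)))"
        unfolding r_def by (simp add: algebra_simps)
      then have er: "exp (- r i) = exp (?m * (c i * A i + d i * B i) - ?S) * exp ((?L (c i) + ?L (c i + d i)) / 2)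
          / exp (?m * (c i * A i + 2 * d i * B i - ln (1 - exp (- c i - d i))))"
        by (simp only: exp_add exp_diff)
      have "(a * b / (4 * pi\<^sup>2 * ?m\<^sup>2)) / (x / (2 * pi * ?m\<^sup>2 * (v * e))) = a * e / x * (b * v / (2 * pi))"
        if "x \<noteq> 0" for a b e v x :: real
        using m[of i] that by (simp add: field_simps power2_eq_square)
      from this[OF exp_not_eq_zero] show ?thesis unfolding N sq er .
    qed
    have "(\<lambda>i. exp (- r i)) \<longlonglongrightarrow> exp (- 0)"
    proof (intro tendsto_intros Lim_null_comparison[of r])
      show "\<forall>\<^sub>F i in sequentially. norm (r i) \<le> R / real (m i)" using rbound by simp
      show "(\<lambda>i. R / real (m i)) \<longlonglongrightarrow> 0"
        by (intro tendsto_divide_0[OF tendsto_const] filterlim_at_top_imp_at_infinity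
            filterlim_real_at_top_of_le[OF 1(1)])
    qed
    moreover have "(\<lambda>i. Re (I i) * sqrt (V i) / (2 * pi)) \<longlonglongrightarrow> 1"
    proof -
      have "(\<lambda>i. I i - of_real (2 * pi / sqrt (V i))) \<longlonglongrightarrow> 0"
        unfolding I_def V_def
        by (rule lattice_char_integral_tendsto[OF c0 c(2) d M(1) 1(1)]) (simp_all add: mom lm nm)
      \<comment> \<open>The difference tends to 0, and the upper bound
        \<open>V i \<le> (bose_var c0)\<^sup>2\<close> allows multiplication by sqrt (V i) although
        V i need not converge.\<close>
      then have lim: "(\<lambda>i. norm (I i - of_real (2 * pi / sqrt (V i))) * (bose_var c0 / (2 * pi))) \<longlonglongrightarrow> 0 * (bose_var c0 / (2 * pi))"
        by (intro tendsto_mult tendsto_norm_zero tendsto_const)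
      have "(\<lambda>i. Re (I i) * sqrt (V i) / (2 * pi) - 1) \<longlonglongrightarrow> 0"
      proof (rule Lim_null_comparison)
        show "\<forall>\<^sub>F i in sequentially. norm (Re (I i) * sqrt (V i) / (2 * pi) - 1)
            \<le> norm (I i - of_real (2 * pi / sqrt (V i))) * (bose_var c0 / (2 * pi))"
        proof (intro always_eventually allI)
          fix i
          have "Re (I i) * sqrt (V i) / (2 * pi) - 1 = Re (I i - of_real (2 * pi / sqrt (V i))) * (sqrt (V i) / (2 * pi))"
            using V(1)[of i] by (simp add: field_simps)
          then have "norm (Re (I i) * sqrt (V i) / (2 * pi) - 1)
              = \<bar>Re (I i - of_real (2 * pi / sqrt (V i)))\<bar> * (sqrt (V i) / (2 * pi))"
            using V(1)[of i] by (simp add: abs_mult)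
          also have "\<dots> \<le> norm (I i - of_real (2 * pi / sqrt (V i))) * (bose_var c0 / (2 * pi))"
            using V[of i] bose_var_pos[OF c0]
            by (intro mult_mono abs_Re_le_cmod divide_right_mono real_le_lsqrt) auto
          finally show "norm (Re (I i) * sqrt (V i) / (2 * pi) - 1) \<le> \<dots>" .
        qed
      qed (use lim in simp)
      then show ?thesis by (simp add: LIM_zero_iff)
    qed
    ultimately have "(\<lambda>i. exp (- r i) * (Re (I i) * sqrt (V i) / (2 * pi))) \<longlonglongrightarrow> exp (- 0) * 1"
      by (rule tendsto_mult)
    \<comment> \<open>Asymptotic equivalence assigns the quotient 1 to 0 / 0; positivity of the
      denominator excludes that branch.\<close>
    moreover have "0 < exp (real (m i) * (c i * A i + 2 * d i * B i - ln (1 - exp (- c i - d i)))) /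
          (2 * pi * (real (m i))\<^sup>2 * sqrt (V i * (1 - exp (- c i)) * (1 - exp (- c i - d i))))" for i
      using m[of i] V(1)[of i] c(1)[of i] d[of i] by (intro divide_pos_pos mult_pos_pos) auto
    then have "exp (real (m i) * (c i * A i + 2 * d i * B i - ln (1 - exp (- c i - d i)))) /
          (2 * pi * (real (m i))\<^sup>2 * sqrt (V i * (1 - exp (- c i)) * (1 - exp (- c i - d i)))) \<noteq> 0" for i
      by (metis less_irrefl)
    then have "(if real (box_partition_count (n i) (l i) (m i)) = 0 \<and>
          exp (real (m i) * (c i * A i + 2 * d i * B i - ln (1 - exp (- c i - d i)))) /
          (2 * pi * (real (m i))\<^sup>2 * sqrt (V i * (1 - exp (- c i)) * (1 - exp (- c i - d i)))) = 0 then 1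
        else real (box_partition_count (n i) (l i) (m i)) /
          (exp (real (m i) * (c i * A i + 2 * d i * B i - ln (1 - exp (- c i - d i)))) /
          (2 * pi * (real (m i))\<^sup>2 * sqrt (V i * (1 - exp (- c i)) * (1 - exp (- c i - d i))))))
      = exp (- r i) * (Re (I i) * sqrt (V i) / (2 * pi))" for i
      by (simp only: ratio simp_thms if_False)
    moreover have "real (l i) / real (m i) = A i" "real (n i) / (real (m i))\<^sup>2 = B i"
      "saddle_c (A i) (B i) = c i" "saddle_d (A i) (B i) = d i" for i
      by (simp_all add: A_def B_def c_def d_def)
    ultimately show ?case
      by (simp only: prod.case Let_def De) simp
  qed
qed

end
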